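(* Let $n,d$ be integers with $0<d<n$, let $\Gamma\subset\mathbb{R}^n$ be a $d$-Ahlfors regular set with Ahlfors regular measure $\sigma$ of constant $C_\sigma$, assume $\Gamma$ is uniformly rectifiable with constant $C_0$, and let $\Omega=\mathbb{R}^n\setminus\Gamma$. Then for any $\alpha,\beta>0$, the function $X\mapsto\operatorname{dist}(X,\Gamma)\,\nabla[D_\beta/D_\alpha](X)$ on $\Omega$ satisfies the Carleson measure condition with a constant that depends only on $C_\sigma$, $C_0$, $\alpha$, $\beta$, $n$ and $d$.
   Context: Ahlfors regularity: $\Gamma$ is closed and $\sigma$ is a measure supported on $\Gamma$ with $C_\sigma^{-1}r^d\le\sigma(B(x,r))\le C_\sigma r^d$ for all $x\in\Gamma$, $r>0$. A flat measure is $\mu=c\mu_P$ with $c>0$ and $\mu_P$ the $d$-dimensional Hausdorff measure on an affine $d$-plane $P\subset\mathbb{R}^n$; $\mathcal{F}$ is the set of flat measures. $Lip(x,r)$ is the set of $1$-Lipschitz functions $f:\mathbb{R}^n\to\mathbb{R}$ vanishing outside $B(x,r)$; $\operatorname{dist}_{x,r}(\mu,\sigma)=r^{-d-1}\sup_{f\in Lip(x,r)}|\int f\,d\sigma-\int f\,d\mu|$; $\alpha_\sigma(x,r)=\inf_{\mu\in\mathcal{F}}\operatorname{dist}_{x,r}(\mu,\sigma)$. $\Gamma$ is uniformly rectifiable with constant $C_0$ if $$\int_0^r\int_{\Gamma\cap B(x,r)}|\alpha_\sigma(y,s)|^2\,d\sigma(y)\,\frac{ds}{s}\le C_0\,\sigma(B(x,r))\qquad\text{for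 all }x\in\Gamma,\ r>0.$$ For $\beta>0$ and $X\in\Omega$, $D_\beta(X)=\big(\int_\Gamma|X-y|^{-d-\beta}\,d\sigma(y)\big)^{-1/\beta}$ (and likewise $D_\alpha$ with $\alpha$ in place of $\beta$). A (scalar or vector) function $f$ on $\Omega$ satisfies the Carleson measure condition with constant $C$ if $f\in L^\infty(\Omega)$ and $\int_{B(x,r)}|f(X)|^2\operatorname{dist}(X,\Gamma)^{d-n}\,dX\le C\,\sigma(B(x,r))$ for all $x\in\Gamma$, $r>0$. *)

theory Defs
  imports "HOL-Analysis.Analysis"
begin

text \<open>
  \<open>\<real>\<^sup>n\<close> is \<^typ>\<open>real ^ 'n\<close> with \<open>n = CARD('n)\<close>. Measures on it are Borel measures, and \<open>B(x,r)\<close>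
  is the open ball. Quantities that are bounded or finite only because of Ahlfors regularity
  (the distances between measures, the numbers \<open>\<alpha>\<^sub>\<sigma>\<close>, the integrals in the Carleson type
  conditions) take values in \<^typ>\<open>ennreal\<close>, so that no default value can occur for them.
\<close>

definition ahlfors_regular ::
    "nat \<Rightarrow> real \<Rightarrow> (real ^ 'n) set \<Rightarrow> (real ^ 'n) measure \<Rightarrow> bool" where
  "ahlfors_regular d C \<Gamma> \<sigma> \<longleftrightarrow>
     closed \<Gamma> \<and> sets \<sigma> = sets borel \<and> emeasure \<sigma> (- \<Gamma>) = 0 \<and> C > 0 \<and>
     (\<forall>x\<in>\<Gamma>. \<forall>r>0. ennreal (r ^ d / C) \<le> emeasure \<sigma> (ball x r) \<and>
                   emeasure \<sigma> (ball x r) \<le> ennreal (C * r ^ d))"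

text \<open>
  The \<open>d\<close>-dimensional Hausdorff outer measure for \<open>d > 0\<close>, without the usual normalising factor,
  which plays no role below because flat measures carry an arbitrary constant. The requirement
  \<^const>\<open>bounded\<close> is there because \<^const>\<open>diameter\<close> is unspecified on unbounded sets; finite covers
  are included since members of the sequence may be empty.
\<close>

definition hausdorff_pre_measure :: "nat \<Rightarrow> real \<Rightarrow> 'a::metric_space set \<Rightarrow> ennreal" where
  "hausdorff_pre_measure d \<delta> A =
     (INF U \<in> {U :: nat \<Rightarrow> 'a set.
                 A \<subseteq> (\<Union>i. U i) \<and> (\<forall>i. bounded (U i) \<and> diameter (U i) \<le> \<delta>)}.
        \<Sum>i. ennreal (diameter (U i) ^ d))"

definition hausdorff_outer_measure :: "nat \<Rightarrow> 'a::metric_space set \<Rightarrow> ennreal" where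
  "hausdorff_outer_measure d A = (SUP \<delta> \<in> {0<..}. hausdorff_pre_measure d \<delta> A)"

definition flat_measures :: "nat \<Rightarrow> (real ^ 'n) measure set" where
  "flat_measures d =
     {\<mu>. sets \<mu> = sets borel \<and>
          (\<exists>c>0. \<exists>P. affine P \<and> aff_dim P = int d \<and>
             (\<forall>A\<in>sets borel. emeasure \<mu> A = ennreal c * hausdorff_outer_measure d (A \<inter> P)))}"

definition Lip :: "real ^ 'n \<Rightarrow> real \<Rightarrow> (real ^ 'n \<Rightarrow> real) set" where
  "Lip x r = {f. 1-lipschitz_on UNIV f \<and> (\<forall>y. y \<notin> ball x r \<longrightarrow> f y = 0)}"

definition dist_measures ::
    "nat \<Rightarrow> real ^ 'n \<Rightarrow> real \<Rightarrow> (real ^ 'n) measure \<Rightarrow> (real ^ 'n) measure \<Rightarrow> ennreal" where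
  "dist_measures d x r \<mu> \<sigma> =
     ennreal (1 / r ^ (d + 1)) *
     (SUP f \<in> Lip x r. ennreal \<bar>(\<integral>y. f y \<partial>\<sigma>) - (\<integral>y. f y \<partial>\<mu>)\<bar>)"

definition alpha_number :: "nat \<Rightarrow> (real ^ 'n) measure \<Rightarrow> real ^ 'n \<Rightarrow> real \<Rightarrow> ennreal" where
  "alpha_number d \<sigma> x r = (INF \<mu> \<in> flat_measures d. dist_measures d x r \<mu> \<sigma>)"

definition uniformly_rectifiable ::
    "nat \<Rightarrow> real \<Rightarrow> (real ^ 'n) set \<Rightarrow> (real ^ 'n) measure \<Rightarrow> bool" where
  "uniformly_rectifiable d C \<Gamma> \<sigma> \<longleftrightarrow>
     C \<ge> 0 \<and>
     (\<forall>x\<in>\<Gamma>. \<forall>r>0.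
        (\<integral>\<^sup>+s\<in>{0<..<r}.
            (\<integral>\<^sup>+y\<in>\<Gamma> \<inter> ball x r. (alpha_number d \<sigma> y s)\<^sup>2 \<partial>\<sigma>) * ennreal (1 / s) \<partial>lborel)
        \<le> ennreal C * emeasure \<sigma> (ball x r))"

definition D_dist ::
    "nat \<Rightarrow> (real ^ 'n) set \<Rightarrow> (real ^ 'n) measure \<Rightarrow> real \<Rightarrow> real ^ 'n \<Rightarrow> real" where
  "D_dist d \<Gamma> \<sigma> \<beta> X =
     (LINT y:\<Gamma>|\<sigma>. norm (X - y) powr (- real d - \<beta>)) powr (- 1 / \<beta>)"

definition gradient :: "('a::real_inner \<Rightarrow> real) \<Rightarrow> 'a \<Rightarrow> 'a" where
  "gradient f X = (THE G. GDERIV f X :> G)"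

text \<open>
  In the following definition \<open>f\<close> is a function on \<open>\<Omega> = - \<Gamma>\<close>, so its values on \<open>\<Gamma>\<close> are ignored.
\<close>

definition carleson_measure_condition ::
    "nat \<Rightarrow> (real ^ 'n) set \<Rightarrow> (real ^ 'n) measure \<Rightarrow> real \<Rightarrow>
       (real ^ 'n \<Rightarrow> 'b::real_normed_vector) \<Rightarrow> bool" where
  "carleson_measure_condition d \<Gamma> \<sigma> C f \<longleftrightarrow>
     f \<in> borel_measurable (lebesgue_on (- \<Gamma>)) \<and>
     (\<exists>M. AE X in lebesgue_on (- \<Gamma>). norm (f X) \<le> M) \<and>
     (\<forall>x\<in>\<Gamma>. \<forall>r>0.
        (\<integral>\<^sup>+X\<in>ball x r - \<Gamma>.
            ennreal ((norm (f X))\<^sup>2 * infdist X \<Gamma> powr (real d - real CARD('n))) \<partial>lebesgue)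
        \<le> ennreal C * emeasure \<sigma> (ball x r))"

end

theory Submission
  imports Defs "HOL-Real_Asymp.Real_Asymp"
begin

text \<open>
  Write \<open>R\<^sub>p(X) = \<integral> |X - y|\<^bsup>-d-p\<^esup> d\<sigma>(y)\<close>, so that \<open>D\<^sub>p\<close> is a power of \<open>R\<^sub>p\<close>. If \<open>\<sigma>\<close> is flat on a plane \<open>P\<close>,
  then \<open>\<nabla>D\<^sub>p / D\<^sub>p\<close> is the same field for all \<open>p\<close>: reflecting \<open>P\<close> through the projection of \<open>X\<close> gives
  \<open>\<integral> g(|X - y|) (X - y) d\<mu> = v \<integral> g(|X - y|) d\<mu>\<close> with \<open>v\<close> normal to \<open>P\<close>, and dilating \<open>P\<close> gives
  \<open>(d + p) |v|\<^sup>2 R\<^bsub>p+2\<^esub> = p R\<^sub>p\<close>. For general \<open>\<sigma>\<close> the integrals are cut into dyadic annuli around \<open>X\<close>. On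
  each of them \<open>\<sigma>\<close> is replaced by a nearly optimal flat measure at the cost of one \<open>\<alpha>\<close>-number, and
  the vectors \<open>v\<close> of consecutive scales differ by such a number too. With \<open>\<delta>\<close> the distance of \<open>X\<close> to
  \<open>\<Gamma>\<close> this bounds \<open>\<delta> |\<nabla>(D\<^sub>\<beta> / D\<^sub>\<alpha>)|\<close> by a sum over \<open>j\<close> of \<open>\<alpha>\<^sub>\<sigma>(X, 2\<^bsup>j+1\<^esup>\<delta>)\<close> with geometric
  weights. Squaring, averaging the \<open>\<alpha>\<close>-numbers over nearby points of \<open>\<Gamma>\<close> and radii, and Fubini's theorem
  reduce the Carleson condition to uniform rectifiability; scales above \<open>r\<close> only cost a factor
  linear in \<open>j\<close>, since the \<open>\<alpha>\<close>-numbers may be truncated at \<open>1\<close>.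
\<close>

section \<open>Flat measures\<close>

text \<open>The nearly optimal planes of different scales are never compared with each other. The
  vector v of a scale is read off from \<sigma> itself, as a quotient of two moments. A test
  function at scale s is also one at scale 2s, so a single flat measure, nearly optimal at the
  larger scale, controls two consecutive vectors. Only Lipschitz test functions can be compared, so
  sharp annuli give way to differences of truncated powers: these are constant near the centre and
  vanish beyond radius 2, and so does a suitable antiderivative, hence the dilation identity can be
  used scale by scale. The delicate point in comparing two exponents is that \<delta> times the
  logarithmic gradient is close to \<rho> w with \<rho> |w|^2 close to 1, where w is the same for
  all exponents and bounded, but no lower bound for |w| is at hand. The two numbers \<rho> are
  therefore compared without dividing by |w|^2.\<close>

lemma diameter_similarity_le:
  fixes T :: "'a::metric_space \<Rightarrow> 'b::metric_space"
  assumes T: "\<And>x y. dist (T x) (T y) = c * dist x y" and c: "c > 0" and U: "bounded U"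
  shows "bounded (T ` U)" "diameter (T ` U) \<le> c * diameter U"
proof -
  obtain e where e: "\<forall>x\<in>U. \<forall>y\<in>U. dist x y \<le> e"
    using U bounded_two_points by metis
  have "\<forall>x\<in>T ` U. \<forall>y\<in>T ` U. dist x y \<le> c * e"
    using e c by (auto simp: T)
  then show "bounded (T ` U)"
    using bounded_two_points by metis
  show "diameter (T ` U) \<le> c * diameter U"
  proof (cases "U = {}")
    case False
    show ?thesis
      unfolding diameter_def[of "T ` U"]
    proof (simp add: False, rule cSUP_least)
      show "T ` U \<times> T ` U \<noteq> {}" using False by auto
      fix z assume "z \<in> T ` U \<times> T ` U"
      then obtain x y where "x \<in> U" "y \<in> U" "z = (T x, T y)" by auto
      then show "(case z of (x, y) \<Rightarrow> dist x y) \<le> c * diameter U"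
        using diameter_bounded_bound[OF U] c by (simp add: T)
    qed
  qed simp
qed

text \<open>A cover of A is pushed forward to a cover of the image, with diameters multiplied by at
  most c. For a homothety the reverse inequality is this same lemma applied to the inverse
  map.\<close>

lemma hausdorff_outer_measure_similarity_le:
  fixes T :: "'a::metric_space \<Rightarrow> 'b::metric_space"
  assumes T: "\<And>x y. dist (T x) (T y) = c * dist x y" and c: "c > 0"
  shows "ennreal (1 / c ^ d) * hausdorff_outer_measure d (T ` A) \<le> hausdorff_outer_measure d A"
proof -
  have pre: "ennreal (1 / c ^ d) * hausdorff_pre_measure d \<delta> (T ` A) \<le> hausdorff_pre_measure d (\<delta> / c) A"
    for \<delta>
  proof -
    have "ennreal (1 / c ^ d) * hausdorff_pre_measure d \<delta> (T ` A) \<le> (\<Sum>i. ennreal (diameter (U i) ^ d))"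
      if U: "A \<subseteq> (\<Union>i. U i)" "\<forall>i. bounded (U i) \<and> diameter (U i) \<le> \<delta> / c" for U :: "nat \<Rightarrow> 'a set"
    proof -
      have sim: "bounded (T ` U i)" "diameter (T ` U i) \<le> c * diameter (U i)" for i
        using diameter_similarity_le[OF T c, of "U i"] U by auto
      have \<delta>: "diameter (T ` U i) \<le> \<delta>" for i
        using sim(2)[of i] U c by (smt (verit) pos_le_divide_eq mult.commute)
      have "hausdorff_pre_measure d \<delta> (T ` A) \<le> (\<Sum>i. ennreal (diameter (T ` U i) ^ d))"
        unfolding hausdorff_pre_measure_def
      proof (rule INF_lower2[of "\<lambda>i. T ` U i"])
        show "(\<lambda>i. T ` U i) \<in> {V. T ` A \<subseteq> (\<Union>i. V i) \<and> (\<forall>i. bounded (V i) \<and> diameter (V i) \<le> \<delta>)}"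
          using U(1) sim(1) \<delta> by (simp add: image_UN[symmetric] image_mono)
      qed simp
      also have "\<dots> \<le> (\<Sum>i. ennreal (c ^ d) * ennreal (diameter (U i) ^ d))"
      proof (intro suminf_le summableI)
        fix i
        have "diameter (T ` U i) ^ d \<le> (c * diameter (U i)) ^ d"
          using sim by (intro power_mono diameter_ge_0) auto
        then show "ennreal (diameter (T ` U i) ^ d) \<le> ennreal (c ^ d) * ennreal (diameter (U i) ^ d)"
          using c by (simp add: power_mult_distrib ennreal_mult'[symmetric] ennreal_leI)
      qed
      also have "\<dots> = ennreal (c ^ d) * (\<Sum>i. ennreal (diameter (U i) ^ d))"
        by (rule ennreal_suminf_cmult)
      finally have "ennreal (1 / c ^ d) * hausdorff_pre_measure d \<delta> (T ` A)
          \<le> ennreal (1 / c ^ d) * (ennreal (c ^ d) * (\<Sum>i. ennreal (diameter (U i) ^ d)))"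
        by (intro mult_left_mono) auto
      also have "\<dots> = (\<Sum>i. ennreal (diameter (U i) ^ d))"
        using c by (simp add: mult.assoc[symmetric] ennreal_mult'[symmetric])
      finally show ?thesis .
    qed
    then show ?thesis
      unfolding hausdorff_pre_measure_def[of d "\<delta> / c" A]
      by (intro INF_greatest) auto
  qed
  have "ennreal (1 / c ^ d) * hausdorff_outer_measure d (T ` A)
      = (SUP \<delta>\<in>{0<..}. ennreal (1 / c ^ d) * hausdorff_pre_measure d \<delta> (T ` A))"
    unfolding hausdorff_outer_measure_def by (subst SUP_mult_left_ennreal) auto
  also have "\<dots> \<le> hausdorff_outer_measure d A"
    unfolding hausdorff_outer_measure_def
    using c by (intro SUP_least order_trans[OF pre] SUP_upper) auto
  finally show ?thesis .
qed

text \<open>One family covers both symmetries used for flat measures: l = -1 is the reflection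
  through the point e, and l > 0 gives the dilations.\<close>

definition homothety :: "'a::real_vector \<Rightarrow> real \<Rightarrow> 'a \<Rightarrow> 'a" where
  "homothety e l y = e + l *\<^sub>R (y - e)"

lemma homothety_inverse:
  assumes "l \<noteq> 0"
  shows "homothety e l (homothety e (1 / l) y) = y" "homothety e (1 / l) (homothety e l y) = y"
  using assms by (auto simp: homothety_def)

lemma dist_homothety: "dist (homothety e l x) (homothety e l y) = \<bar>l\<bar> * dist x (y::'a::real_normed_vector)"
  by (simp add: homothety_def dist_norm scaleR_diff_right[symmetric])

lemma hausdorff_outer_measure_homothety:
  fixes A :: "'a::real_normed_vector set"
  assumes "l \<noteq> 0"
  shows "hausdorff_outer_measure d (homothety e l ` A) = ennreal (\<bar>l\<bar> ^ d) * hausdorff_outer_measure d A"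
proof (rule antisym)
  have 1: "ennreal (1 / \<bar>l\<bar> ^ d) * hausdorff_outer_measure d (homothety e l ` A) \<le> hausdorff_outer_measure d A"
    using assms by (intro hausdorff_outer_measure_similarity_le dist_homothety) auto
  have "hausdorff_outer_measure d (homothety e l ` A)
      = ennreal (\<bar>l\<bar> ^ d) * (ennreal (1 / \<bar>l\<bar> ^ d) * hausdorff_outer_measure d (homothety e l ` A))"
    using assms by (simp add: mult.assoc[symmetric] ennreal_mult'[symmetric])
  also have "\<dots> \<le> ennreal (\<bar>l\<bar> ^ d) * hausdorff_outer_measure d A"
    by (intro mult_left_mono 1) auto
  finally show "hausdorff_outer_measure d (homothety e l ` A) \<le> ennreal (\<bar>l\<bar> ^ d) * hausdorff_outer_measure d A" .
  have im: "homothety e (1 / l) ` homothety e l ` A = A"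
    using assms by (auto simp: image_image homothety_inverse)
  show "ennreal (\<bar>l\<bar> ^ d) * hausdorff_outer_measure d A \<le> hausdorff_outer_measure d (homothety e l ` A)"
    using hausdorff_outer_measure_similarity_le[OF dist_homothety, of "1 / l" d e "homothety e l ` A"] assms
    unfolding im by (simp add: power_one_over power_abs)
qed

lemma homothety_affine:
  assumes "affine P" "e \<in> P" "l \<noteq> 0"
  shows "homothety e l y \<in> P \<longleftrightarrow> y \<in> P"
proof -
  have mem: "homothety e k z \<in> P" if "z \<in> P" for k z
    using mem_affine[OF assms(1) assms(2) that, of "1 - k" k]
    by (simp add: homothety_def algebra_simps)
  show ?thesis
    using mem[of y l] mem[of "homothety e l y" "1 / l"] homothety_inverse(2)[OF assms(3), of e y] by auto
qed

lemma homothety_continuous: "continuous_on UNIV (homothety e l :: 'a::real_normed_vector \<Rightarrow> 'a)"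
  unfolding homothety_def by (intro continuous_intros)

lemma homothety_borel [measurable]: "(homothety e l :: 'a::real_normed_vector \<Rightarrow> 'a) \<in> borel_measurable borel"
  by (intro borel_measurable_continuous_onI homothety_continuous)

section \<open>Homogeneity of a flat measure under homotheties centred on its plane\<close>

locale flat =
  fixes d :: nat and \<mu> :: "(real ^ 'n) measure" and c :: real and P :: "(real ^ 'n) set"
  assumes d: "d > 0"
    and sets [measurable_cong]: "sets \<mu> = sets borel"
    and affine: "affine P" and ne: "P \<noteq> {}"
    and emeasure: "\<And>A. A \<in> sets borel \<Longrightarrow> emeasure \<mu> A = ennreal c * hausdorff_outer_measure d (A \<inter> P)"
begin

lemma space: "space \<mu> = UNIV"
  using sets by (metis sets_eq_imp_space_eq space_borel)

lemma emeasure_vimage_homothety: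
  assumes "e \<in> P" "l \<noteq> 0" "A \<in> sets borel"
  shows "emeasure \<mu> (homothety e l -` A) = ennreal (1 / \<bar>l\<bar> ^ d) * emeasure \<mu> A"
proof -
  have m: "homothety e l -` A \<in> sets borel"
    using measurable_sets[OF homothety_borel assms(3), of e l] by simp
  have im: "homothety e l -` A \<inter> P = homothety e (1 / l) ` (A \<inter> P)"
  proof (intro set_eqI iffI)
    fix y assume "y \<in> homothety e l -` A \<inter> P"
    then show "y \<in> homothety e (1 / l) ` (A \<inter> P)"
      using assms by (intro image_eqI[of _ _ "homothety e l y"]) (auto simp: homothety_inverse homothety_affine affine)
  qed (use assms in \<open>auto simp: homothety_inverse homothety_affine affine\<close>)
  show ?thesis
    using assms unfolding emeasure[OF m] im emeasure[OF assms(3)]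
    by (subst hausdorff_outer_measure_homothety) (auto simp: power_one_over ac_simps)
qed

lemma AE_P: "AE y in \<mu>. y \<in> P"
proof -
  have "closed P" using closed_affine_hull[of P] affine by (simp add: hull_same)
  then have m: "- P \<in> sets borel" by (auto simp: borel_closed)
  have "hausdorff_outer_measure d ({} :: (real ^ 'n) set) = 0"
  proof -
    \<comment> \<open>The cover by empty sets costs \<open>0 ^ d\<close> per member, which is 0
      because d > 0.\<close>
    have "hausdorff_pre_measure d \<delta> ({} :: (real ^ 'n) set) = 0" if "\<delta> > 0" for \<delta>
    proof -
      have "hausdorff_pre_measure d \<delta> ({} :: (real ^ 'n) set) \<le> 0"
        unfolding hausdorff_pre_measure_def
        using that d by (intro INF_lower2[of "\<lambda>_. {}"]) (auto simp: zero_power)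
      then show ?thesis by simp
    qed
    then have "hausdorff_outer_measure d ({} :: (real ^ 'n) set) \<le> 0"
      unfolding hausdorff_outer_measure_def by (intro SUP_least) auto
    then show ?thesis by simp
  qed
  then have "emeasure \<mu> (- P) = 0"
    using emeasure[OF m] by simp
  then show ?thesis
    using m by (intro AE_I[of _ _ "- P"]) (auto simp: sets)
qed

text \<open>The push-forward of \<mu> is a constant multiple of \<mu>, and the Bochner integral is
  homogeneous in the measure whether or not f is integrable.\<close>

lemma integral_homothety:
  fixes f :: "real ^ 'n \<Rightarrow> 'b::{banach, second_countable_topology}"
  assumes "e \<in> P" "l \<noteq> 0" and f [measurable]: "f \<in> borel_measurable borel"
  shows "(\<integral>y. f (homothety e l y) \<partial>\<mu>) = (1 / \<bar>l\<bar> ^ d) *\<^sub>R (\<integral>y. f y \<partial>\<mu>)"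
proof -
  have eq: "distr \<mu> borel (homothety e l) = density \<mu> (\<lambda>_. ennreal (1 / \<bar>l\<bar> ^ d))"
  proof (rule measure_eqI)
    fix A assume A: "A \<in> sets (distr \<mu> borel (homothety e l))"
    then have A': "A \<in> sets borel" "A \<in> sets \<mu>" by (auto simp: sets)
    show "emeasure (distr \<mu> borel (homothety e l)) A = emeasure (density \<mu> (\<lambda>_. ennreal (1 / \<bar>l\<bar> ^ d))) A"
      using A' assms by (subst emeasure_distr) (auto simp: space emeasure_vimage_homothety emeasure_density_const)
  qed (simp add: sets)
  have "(\<integral>y. f (homothety e l y) \<partial>\<mu>) = (\<integral>y. f y \<partial>distr \<mu> borel (homothety e l))"
    by (subst integral_distr) auto
  also have "\<dots> = (1 / \<bar>l\<bar> ^ d) *\<^sub>R (\<integral>y. f y \<partial>\<mu>)"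
    unfolding eq by (subst integral_density) auto
  finally show ?thesis .
qed

text \<open>
  If \<open>\<mu>\<close> charges some ball infinitely, then by homogeneity it does so for every ball centred on \<open>P\<close>,
  and a continuous function is integrable only if it vanishes on \<open>P\<close>; the Bochner integral is
  \<open>0\<close> in both cases. So the comparison of Hausdorff with Lebesgue measure on \<open>P\<close> is never needed.
\<close>

lemma not_finite_imp_integral_0:
  fixes f :: "real ^ 'n \<Rightarrow> 'b::{banach, second_countable_topology}"
  assumes inf: "emeasure \<mu> (ball p r) = \<infinity>" and f: "continuous_on UNIV f"
  shows "(\<integral>y. f y \<partial>\<mu>) = 0"
proof (cases "integrable \<mu> f")
  case int: True
  have "f q = 0" if q: "q \<in> P" for q
  proof (rule ccontr)
    assume fq: "f q \<noteq> 0"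
    define \<epsilon> where "\<epsilon> = norm (f q) / 2"
    have \<epsilon>: "\<epsilon> > 0" using fq by (simp add: \<epsilon>_def)
    have "isCont f q" using f by (simp add: continuous_on_eq_continuous_at)
    then obtain \<rho> where \<rho>: "\<rho> > 0" "\<And>y. dist y q < \<rho> \<Longrightarrow> dist (f y) (f q) < \<epsilon>"
      using \<epsilon> unfolding continuous_at_eps_delta by blast
    have big: "norm (f y) \<ge> \<epsilon>" if "y \<in> ball q \<rho>" for y
    proof -
      have "dist (f y) (f q) < \<epsilon>" using that by (intro \<rho>(2)) (simp add: dist_commute)
      then show ?thesis using norm_triangle_ineq2[of "f q" "f y"]
        by (simp add: \<epsilon>_def dist_norm norm_minus_commute)
    qed
    \<comment> \<open>With this ratio the homothety centred at q maps the ball of infinite measure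
      into the ball on which the norm of f is at least \<epsilon>.\<close>
    obtain l where l: "l > 0" "l * (dist q p + \<bar>r\<bar> + 1) \<le> \<rho>"
      using \<rho>(1) by (intro that[of "\<rho> / (dist q p + \<bar>r\<bar> + 1)"]) (auto simp: field_simps add_pos_nonneg)
    have "ball p r \<subseteq> homothety q l -` ball q \<rho>"
    proof
      fix y assume y: "y \<in> ball p r"
      have "dist q y \<le> dist q p + dist p y" by (rule dist_triangle)
      also have "\<dots> < dist q p + \<bar>r\<bar> + 1" using y by simp
      finally have "l * dist q y < \<rho>" using l by (smt (verit) mult_strict_left_mono)
      then show "y \<in> homothety q l -` ball q \<rho>"
        using l dist_homothety[of q l q y] by (simp add: homothety_def)
    qed
    then have "emeasure \<mu> (ball p r) \<le> emeasure \<mu> (homothety q l -` ball q \<rho>)"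
      using measurable_sets[OF homothety_borel[of q l], of "ball q \<rho>"] by (intro emeasure_mono) (auto simp: sets)
    then have "ennreal (1 / \<bar>l\<bar> ^ d) * emeasure \<mu> (ball q \<rho>) = \<infinity>"
      using inf l q by (simp add: emeasure_vimage_homothety top_unique)
    then have inf': "emeasure \<mu> (ball q \<rho>) = \<infinity>"
      by (auto simp: ennreal_mult_eq_top_iff)
    have "ennreal \<epsilon> * emeasure \<mu> (ball q \<rho>) = (\<integral>\<^sup>+y. ennreal \<epsilon> * indicator (ball q \<rho>) y \<partial>\<mu>)"
      by (subst nn_integral_cmult_indicator) (auto simp: sets)
    also have "\<dots> \<le> (\<integral>\<^sup>+y. norm (f y) \<partial>\<mu>)"
      using big by (intro nn_integral_mono) (auto simp: indicator_def intro!: ennreal_leI)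
    also have "\<dots> < \<infinity>"
      using int by (simp add: integrable_iff_bounded)
    finally show False
      using inf' \<epsilon> by (simp add: ennreal_mult_top)
  qed
  then have "AE y in \<mu>. f y = 0" using AE_P by auto
  then have "(\<integral>y. f y \<partial>\<mu>) = (\<integral>y. 0 \<partial>\<mu>)"
    using f by (intro integral_cong_AE) (auto simp: measurable_cong_sets[OF sets refl] intro!: borel_measurable_continuous_onI)
  then show ?thesis by simp
qed (rule not_integrable_integral_eq)

lemma integrable_continuous:
  fixes f :: "real ^ 'n \<Rightarrow> 'b::{banach, second_countable_topology}"
  assumes fin: "\<And>p r. emeasure \<mu> (ball p r) \<noteq> \<infinity>" and f: "continuous_on UNIV f"
    and supp: "\<And>y. y \<notin> ball p r \<Longrightarrow> f y = 0"
  shows "integrable \<mu> f"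
proof -
  have "compact (f ` cball p r)"
    using f by (intro compact_continuous_image) (auto intro: continuous_on_subset)
  then obtain B where B: "\<And>y. y \<in> cball p r \<Longrightarrow> norm (f y) \<le> B"
    using compact_imp_bounded bounded_iff by (metis image_eqI)
  have bnd: "AE y in \<mu>. y \<in> ball p r \<longrightarrow> norm (f y) \<le> B"
    using B by auto
  have "integrable \<mu> f"
    using fin[of p r] supp
    by (intro integrableI_bounded_set[of "ball p r" \<mu> f B] bnd)
       (auto simp: sets measurable_cong_sets[OF sets refl] less_top
             intro!: borel_measurable_continuous_onI f)
  then show ?thesis .
qed

end

section \<open>Reflection and dilation identities for flat measures\<close>

context flat
begin

definition foot :: "real ^ 'n \<Rightarrow> real ^ 'n" where
  "foot X = closest_point P X"

lemma foot_in: "foot X \<in> P"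
  using closed_affine_hull[of P] affine ne by (simp add: foot_def hull_same closest_point_in_set)

text \<open>The variational inequality of the closest point holds for y and for its reflection
  through the foot; these have opposite signs.\<close>

lemma foot_orthogonal:
  assumes "y \<in> P"
  shows "inner (X - foot X) (y - foot X) = 0"
proof -
  have P: "closed P" "convex P"
    using closed_affine_hull[of P] affine by (auto simp: hull_same affine_imp_convex)
  have le: "inner (X - foot X) (z - foot X) \<le> 0" if "z \<in> P" for z
    using closest_point_dot[OF P(2,1) that, of X] by (simp add: foot_def)
  have "homothety (foot X) (-1) y \<in> P"
    using assms by (simp add: homothety_affine affine foot_in)
  from le[OF this] le[OF assms] show ?thesis
    by (simp add: homothety_def algebra_simps)
qed

lemma norm_foot:
  assumes "y \<in> P"
  shows "(norm (X - y))\<^sup>2 = (norm (X - foot X))\<^sup>2 + (norm (y - foot X))\<^sup>2"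
proof -
  show ?thesis
    using dot_norm_neg[of "X - foot X" "y - foot X"] foot_orthogonal[OF assms, of X] by simp
qed

text \<open>By Pythagoras the squared distance to X is affine in the square of the ratio. So l = -1
  preserves it, and \<open>l = sqrt (1 + h)\<close> changes it linearly in h, which explains the
  parametrisation used for dilations below.\<close>

lemma norm_foot_homothety:
  assumes "y \<in> P" "l \<noteq> 0"
  shows "(norm (X - homothety (foot X) l y))\<^sup>2 = (norm (X - y))\<^sup>2 + (l\<^sup>2 - 1) * (norm (y - foot X))\<^sup>2"
  using norm_foot[of "homothety (foot X) l y" X] norm_foot[OF assms(1), of X] assms
  by (simp add: homothety_affine affine foot_in) (simp add: homothety_def power_mult_distrib left_diff_distrib)

lemma borel_measurable_continuous: "continuous_on UNIV f \<Longrightarrow> f \<in> borel_measurable \<mu>"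
  by (simp add: measurable_cong_sets[OF sets refl] borel_measurable_continuous_onI)

text \<open>The reflection of \<open>P\<close> through the foot of \<open>X\<close> preserves \<open>\<mu>\<close> and the distance to \<open>X\<close>.\<close>

lemma axis_moment:
  fixes g :: "real \<Rightarrow> real"
  assumes g: "continuous_on UNIV g" "\<And>t. t \<ge> R \<Longrightarrow> g t = 0"
  shows "(\<integral>y. g (norm (X - y)) *\<^sub>R (X - y) \<partial>\<mu>) = (\<integral>y. g (norm (X - y)) \<partial>\<mu>) *\<^sub>R (X - foot X)"
proof -
  note gc = continuous_on_compose2[OF g(1)]
  have c1: "continuous_on UNIV (\<lambda>y. g (norm (X - y)) *\<^sub>R (X - y))"
    and c2: "continuous_on UNIV (\<lambda>y. g (norm (X - y)))"
    by (intro continuous_intros gc; simp)+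
  show ?thesis
  proof (cases "\<exists>p r. emeasure \<mu> (ball p r) = \<infinity>")
    case True
    then show ?thesis
      using not_finite_imp_integral_0[OF _ c1] not_finite_imp_integral_0[OF _ c2] by auto
  next
    case False
    then have fin: "\<And>p r. emeasure \<mu> (ball p r) \<noteq> \<infinity>" by auto
    let ?T = "homothety (foot X) (- 1)"
    let ?f = "\<lambda>y. g (norm (X - y)) *\<^sub>R (X - y)"
    have c3: "continuous_on UNIV (\<lambda>y. g (norm (X - y)) *\<^sub>R (X - ?T y))"
      by (intro continuous_intros gc continuous_on_subset[OF homothety_continuous]) auto
    have i1: "integrable \<mu> ?f" and i2: "integrable \<mu> (\<lambda>y. g (norm (X - y)))"
      and i3: "integrable \<mu> (\<lambda>y. g (norm (X - y)) *\<^sub>R (X - ?T y))"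
      using g(2) by (auto intro!: integrable_continuous[OF fin, of _ X R] c1 c2 c3 simp: dist_norm)
    have "(\<integral>y. ?f y \<partial>\<mu>) = (\<integral>y. ?f (?T y) \<partial>\<mu>)"
      using foot_in[of X] c1 by (subst integral_homothety) (auto intro: borel_measurable_continuous_onI)
    also have "\<dots> = (\<integral>y. g (norm (X - y)) *\<^sub>R (X - ?T y) \<partial>\<mu>)"
    proof (rule integral_cong_AE)
      show "AE y in \<mu>. ?f (?T y) = g (norm (X - y)) *\<^sub>R (X - ?T y)"
        using AE_P
      proof eventually_elim
        case (elim y)
        have "(norm (X - ?T y))\<^sup>2 = (norm (X - y))\<^sup>2"
          using norm_foot_homothety[OF elim, of "-1" X] by simp
        then show ?case by simp
      qed
      show "(\<lambda>y. ?f (?T y)) \<in> borel_measurable \<mu>"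
        by (intro borel_measurable_continuous continuous_intros gc continuous_on_subset[OF homothety_continuous]) auto
    qed (intro borel_measurable_continuous c3)
    \<comment> \<open>The integral is added to its reflected copy: (X - y) + (X - ?T y) is the
      constant vector 2 (X - foot X).\<close>
    finally have "2 *\<^sub>R (\<integral>y. ?f y \<partial>\<mu>) = (\<integral>y. ?f y \<partial>\<mu>) + (\<integral>y. g (norm (X - y)) *\<^sub>R (X - ?T y) \<partial>\<mu>)"
      by (simp add: scaleR_2)
    also have "\<dots> = (\<integral>y. g (norm (X - y)) *\<^sub>R (2 *\<^sub>R (X - foot X)) \<partial>\<mu>)"
      using i1 i3 by (subst Bochner_Integration.integral_add[symmetric])
        (auto intro!: Bochner_Integration.integral_cong simp: homothety_def algebra_simps scaleR_2)
    also have "\<dots> = 2 *\<^sub>R ((\<integral>y. g (norm (X - y)) \<partial>\<mu>) *\<^sub>R (X - foot X))"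
      using i2 by simp
    finally show ?thesis by (simp only: scaleR_cancel_left) simp
  qed
qed

text \<open>
  Derivative at \<open>l = 1\<close> of the scaling law \<open>\<integral> f(homothety l y) d\<mu>(y) = l powr (-d) \<integral> f d\<mu>\<close>; this replaces
  the divergence theorem on \<open>P\<close>.
\<close>

lemma dilation_moment:
  fixes E K :: "real \<Rightarrow> real"
  assumes E: "\<And>u. (E has_real_derivative - K u) (at u)" and K: "continuous_on UNIV K"
    and R0: "R \<ge> 0" and supp: "\<And>u. u \<ge> R \<Longrightarrow> E u = 0" "\<And>u. u \<ge> R \<Longrightarrow> K u = 0"
  shows "real d * (\<integral>y. E ((norm (X - y))\<^sup>2) \<partial>\<mu>)
      = 2 * (\<integral>y. ((norm (X - y))\<^sup>2 - (norm (X - foot X))\<^sup>2) * K ((norm (X - y))\<^sup>2) \<partial>\<mu>)"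
proof -
  have Ec: "continuous_on UNIV E"
    using E by (intro continuous_at_imp_continuous_on) (auto intro: DERIV_isCont)
  note Ec' = continuous_on_compose2[OF Ec] and Kc = continuous_on_compose2[OF K]
  let ?q = "\<lambda>y. (norm (X - y))\<^sup>2 - (norm (X - foot X))\<^sup>2"
  have c1: "continuous_on UNIV (\<lambda>y. E ((norm (X - y))\<^sup>2))"
    and c2: "continuous_on UNIV (\<lambda>y. ?q y * K ((norm (X - y))\<^sup>2))"
    by (intro continuous_intros Ec' Kc; simp)+
  have R: "u \<ge> R" if "t \<ge> \<bar>R\<bar> + 1" "u = t\<^sup>2" for u t :: real
  proof -
    have "R \<le> (\<bar>R\<bar> + 1) * 1" by simp
    also have "\<dots> \<le> t * t" using that by (intro mult_mono) auto
    finally show ?thesis using that by (simp add: power2_eq_square)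
  qed
  show ?thesis
  proof (cases "\<exists>p r. emeasure \<mu> (ball p r) = \<infinity>")
    case True
    then show ?thesis
      using not_finite_imp_integral_0[OF _ c1] not_finite_imp_integral_0[OF _ c2] by auto
  next
    case False
    then have fin: "\<And>p r. emeasure \<mu> (ball p r) \<noteq> \<infinity>" by auto
    let ?f = "\<lambda>y. E ((norm (X - y))\<^sup>2)"
    define h where "h n = 1 / real (Suc n)" for n
    have h: "h n > 0" for n by (simp add: h_def)
    have h0: "h \<longlonglongrightarrow> 0" unfolding h_def by (rule LIMSEQ_Suc[OF lim_1_over_n])
    have h0': "filterlim h (at 0) sequentially"
      using h0 h by (auto simp: filterlim_at less_imp_neq[symmetric])
    let ?T = "\<lambda>n. homothety (foot X) (sqrt (1 + h n))"
    let ?D = "\<lambda>n y. (?f (?T n y) - ?f y) / h n"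
    have Tc: "continuous_on UNIV (\<lambda>y. ?f (?T n y))" for n
      by (intro continuous_intros Ec' continuous_on_subset[OF homothety_continuous]) auto
    have T: "?f (?T n y) = E ((norm (X - y))\<^sup>2 + h n * ?q y)" "?q y \<ge> 0" if "y \<in> P" for n y
    proof -
      have 1: "sqrt (1 + h n) \<noteq> 0" "(sqrt (1 + h n))\<^sup>2 = 1 + h n" using h[of n] by auto
      show "?q y \<ge> 0" using norm_foot[OF that, of X] by simp
      show "?f (?T n y) = E ((norm (X - y))\<^sup>2 + h n * ?q y)"
        using norm_foot_homothety[OF that 1(1), of X] norm_foot[OF that, of X] 1 by simp
    qed
    obtain B where B: "\<And>u. u \<ge> 0 \<Longrightarrow> norm (K u) \<le> B"
    proof -
      have "compact (K ` {0..R})" using K by (intro compact_continuous_image) (auto intro: continuous_on_subset)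
      then obtain B where B: "\<And>u. u \<in> {0..R} \<Longrightarrow> norm (K u) \<le> B"
        using compact_imp_bounded bounded_iff by (metis image_eqI)
      have "norm (K u) \<le> max B 0" if "u \<ge> 0" for u
        using B[of u] that supp(2)[of u] by (cases "u \<le> R") auto
      then show ?thesis by (rule that)
    qed
    \<comment> \<open>The sign of \<open>h n\<close> matters: dilations with ratio above 1 move the
      points of P away from X, so where the squared distance is already at least R both values of E
      vanish. The quotients thus live in a fixed ball; there the mean value theorem applies.\<close>
    have Dbound: "norm (?D n y) \<le> B * R * indicator (ball X (\<bar>R\<bar> + 1)) y" if y: "y \<in> P" for n y
    proof (cases "(norm (X - y))\<^sup>2 \<ge> R")
      case True
      have "(norm (X - y))\<^sup>2 + h n * ?q y \<ge> R"
        using True T(2)[OF y] h[of n] by (smt (verit) mult_nonneg_nonneg)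
      then have "?f (?T n y) = 0" "?f y = 0"
        using supp(1)[of "(norm (X - y))\<^sup>2"] supp(1)[of "(norm (X - y))\<^sup>2 + h n * ?q y"] True
        unfolding T(1)[OF y] by blast+
      moreover have "B \<ge> 0" using B[of 0] norm_ge_zero[of "K 0"] by linarith
      ultimately show ?thesis using R0 by simp
    next
      case False
      let ?u = "(norm (X - y))\<^sup>2"
      have "norm (E (?u + h n * ?q y) - E ?u) \<le> B * norm ((?u + h n * ?q y) - ?u)"
      proof (rule field_differentiable_bound[of "{0..}"])
        fix z :: real assume "z \<in> {0..}"
        then show "norm (- K z) \<le> B" using B by simp
        show "(E has_field_derivative - K z) (at z within {0..})" using E has_field_derivative_at_within by blast
      qed (use T(2)[OF y] h[of n] in \<open>auto intro!: add_nonneg_nonneg mult_nonneg_nonneg simp: convex_real_interval\<close>)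
      then have "norm (?D n y) \<le> B * ?q y"
        using T(2)[OF y] h[of n] by (simp add: T(1)[OF y] divide_simps abs_mult mult_ac)
      also have "\<dots> \<le> B * R"
      proof (rule mult_left_mono)
        show "?q y \<le> R" using False zero_le_power2[of "norm (X - foot X)"] by linarith
        show "B \<ge> 0" using B[of 0] norm_ge_zero[of "K 0"] by linarith
      qed
      finally show ?thesis
        using False R[OF _ refl, of "norm (X - y)"] by (auto simp: indicator_def dist_norm)
    qed
    have i1: "integrable \<mu> ?f"
    proof (rule integrable_continuous[OF fin c1, of X "\<bar>R\<bar> + 1"])
      fix y assume "y \<notin> ball X (\<bar>R\<bar> + 1)"
      then show "?f y = 0" by (intro supp R) (auto simp: dist_norm)
    qed
    have i2: "integrable \<mu> (\<lambda>y. ?f (?T n y))" for n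
    \<comment> \<open>Here y is arbitrary and Pythagoras is only available on P; the triangle
      inequality through the foot costs twice the distance of X to it.\<close>
    proof (rule integrable_continuous[OF fin Tc, of X "\<bar>R\<bar> + 1 + 2 * norm (X - foot X)"])
      fix y assume "y \<notin> ball X (\<bar>R\<bar> + 1 + 2 * norm (X - foot X))"
      then have 1: "\<bar>R\<bar> + 1 + 2 * norm (X - foot X) \<le> norm (X - y)" by (simp add: dist_norm)
      have "norm (X - y) \<le> norm (X - foot X) + norm (y - foot X)"
        using norm_triangle_ineq4[of "X - foot X" "y - foot X"] by simp
      moreover have "norm (y - foot X) \<le> sqrt (1 + h n) * norm (y - foot X)"
        using h[of n] by (simp add: mult_le_cancel_right1)
      moreover have "sqrt (1 + h n) * norm (y - foot X) \<le> norm (X - ?T n y) + norm (X - foot X)"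
      proof -
        have "(X - foot X) - (X - ?T n y) = sqrt (1 + h n) *\<^sub>R (y - foot X)" by (simp add: homothety_def)
        then have "norm (sqrt (1 + h n) *\<^sub>R (y - foot X)) \<le> norm (X - foot X) + norm (X - ?T n y)"
          by (metis norm_triangle_ineq4)
        then show ?thesis using h[of n] by simp
      qed
      ultimately have "\<bar>R\<bar> + 1 \<le> norm (X - ?T n y)" using 1 by linarith
      then show "?f (?T n y) = 0" by (intro supp R) auto
    qed
    have lim: "(\<lambda>n. \<integral>y. ?D n y \<partial>\<mu>) \<longlonglongrightarrow> (\<integral>y. - (?q y * K ((norm (X - y))\<^sup>2)) \<partial>\<mu>)"
    proof (rule integral_dominated_convergence)
      show "integrable \<mu> (\<lambda>y. B * R * indicator (ball X (\<bar>R\<bar> + 1)) y)"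
        using fin by (intro integrable_mult_right integrable_real_indicator) (auto simp: sets less_top)
      show "AE y in \<mu>. norm (?D n y) \<le> B * R * indicator (ball X (\<bar>R\<bar> + 1)) y" for n
        using AE_P by eventually_elim (rule Dbound)
      show "AE y in \<mu>. (\<lambda>n. ?D n y) \<longlonglongrightarrow> - (?q y * K ((norm (X - y))\<^sup>2))"
        using AE_P
      proof eventually_elim
        case (elim y)
        let ?u = "(norm (X - y))\<^sup>2"
        have "((\<lambda>t. E (?u + t * ?q y)) has_real_derivative - K (?u + 0 * ?q y) * ?q y) (at 0)"
          by (rule DERIV_chain2[OF E]) (auto intro!: derivative_eq_intros)
        then have "((\<lambda>t. (E (?u + t * ?q y) - E ?u) / t) \<longlongrightarrow> - (?q y * K ?u)) (at 0)"
          by (simp add: DERIV_def mult.commute)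
        from filterlim_compose[OF this h0'] show ?case
          by (simp add: T(1)[OF elim])
      qed
      have "h n \<noteq> 0" for n using h[of n] by simp
      then show "?D n \<in> borel_measurable \<mu>" for n
        by (intro borel_measurable_continuous continuous_intros Tc c1) simp
      show "(\<lambda>y. - (?q y * K ((norm (X - y))\<^sup>2))) \<in> borel_measurable \<mu>"
        by (intro borel_measurable_continuous continuous_on_minus c2)
    qed
    have D: "(\<integral>y. ?D n y \<partial>\<mu>) = ((1 + h n) powr (- real d / 2) - 1) / h n * (\<integral>y. ?f y \<partial>\<mu>)" for n
    proof -
      have s: "1 / \<bar>sqrt (1 + h n)\<bar> ^ d = (1 + h n) powr (- real d / 2)"
      proof -
        have "\<bar>sqrt (1 + h n)\<bar> ^ d = ((1 + h n) powr (1 / 2)) ^ d"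
          using h[of n] by (simp add: powr_half_sqrt)
        also have "\<dots> = (1 + h n) powr (real d / 2)"
          using h[of n] by (simp add: powr_power)
        finally show ?thesis by (simp only: powr_minus_divide minus_divide_left[symmetric])
      qed
      have "(\<integral>y. ?f (?T n y) \<partial>\<mu>) = (1 + h n) powr (- real d / 2) * (\<integral>y. ?f y \<partial>\<mu>)"
        unfolding s[symmetric] using h[of n] c1 foot_in[of X]
        by (subst integral_homothety) (auto intro: borel_measurable_continuous_onI)
      then show ?thesis using i1 i2[of n] by (simp add: algebra_simps diff_divide_distrib)
    qed
    \<comment> \<open>Second evaluation of the same limit, now through the scaling law. Equating it
      with \<open>lim\<close> gives the identity.\<close>
    have "((\<lambda>x. x powr (- real d / 2)) has_real_derivative (- real d / 2) * 1 powr (- real d / 2 - 1)) (at 1)"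
      by (rule has_real_derivative_powr) simp
    then have "((\<lambda>t. ((1 + t) powr (- real d / 2) - 1) / t) \<longlongrightarrow> - real d / 2) (at 0)"
      by (simp add: DERIV_def)
    from filterlim_compose[OF this h0']
    have "(\<lambda>n. \<integral>y. ?D n y \<partial>\<mu>) \<longlonglongrightarrow> - real d / 2 * (\<integral>y. ?f y \<partial>\<mu>)"
      unfolding D by (intro tendsto_mult tendsto_const)
    from LIMSEQ_unique[OF this lim] show ?thesis by simp
  qed
qed

end

section \<open>Test functions\<close>

text \<open>One number L bounds both the Lipschitz constant and the values. At radius 2
  \<open>kern\<close> and \<open>kern_int\<close> of the squared norm vanish, and this radius makes
  a test function at scale s, up to a factor, admissible in the distance of measures at radius
  2s.\<close>

definition bump :: "real \<Rightarrow> ('a::real_normed_vector \<Rightarrow> 'b::real_normed_vector) \<Rightarrow> bool" where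
  "bump L \<Phi> \<longleftrightarrow> L-lipschitz_on UNIV \<Phi> \<and> (\<forall>z. norm (\<Phi> z) \<le> L) \<and> (\<forall>z. norm z \<ge> 2 \<longrightarrow> \<Phi> z = 0)"

lemma bumpD:
  assumes "bump L \<Phi>"
  shows "norm (\<Phi> x - \<Phi> y) \<le> L * norm (x - y)" "norm (\<Phi> z) \<le> L" "norm z \<ge> 2 \<Longrightarrow> \<Phi> z = 0"
    "L \<ge> 0" "continuous_on UNIV \<Phi>"
  using assms lipschitz_onD[of L UNIV \<Phi> x y]
  by (auto simp: bump_def dist_norm lipschitz_on_nonneg intro: lipschitz_on_continuous_on)

lemma bumpI:
  assumes "\<And>x y. norm (\<Phi> x - \<Phi> y) \<le> L * norm (x - y)" "\<And>z. norm (\<Phi> z) \<le> L"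
    "\<And>z. norm z \<ge> 2 \<Longrightarrow> \<Phi> z = 0"
  shows "bump L \<Phi>"
proof -
  have "L \<ge> 0" using assms(2)[of undefined] norm_ge_zero order_trans by blast
  then show ?thesis
    using assms unfolding bump_def by (auto intro!: lipschitz_onI simp: dist_norm)
qed

lemma bump_mono: "bump L \<Phi> \<Longrightarrow> L \<le> L' \<Longrightarrow> bump L' \<Phi>"
  unfolding bump_def by (meson lipschitz_on_le order_trans)

text \<open>\<Psi>, in practice the identity or the norm, is unbounded, so the product is controlled
  through the support of \<phi>: there |\<Psi>| is below 2, and the product rule gives 2L + L. The
  pair of points is ordered so that the first one lies in the support.\<close>

lemma bump_scaleR:
  fixes \<phi> :: "'a::real_normed_vector \<Rightarrow> real" and \<Psi> :: "'a \<Rightarrow> 'b::real_normed_vector"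
  assumes "bump L \<phi>" and \<Psi>: "\<And>x y. norm (\<Psi> x - \<Psi> y) \<le> norm (x - y)" "\<And>x. norm (\<Psi> x) = norm x"
  shows "bump (3 * L) (\<lambda>z. \<phi> z *\<^sub>R \<Psi> z)"
proof (rule bumpI)
  note \<phi> = bumpD[OF assms(1)]
  have one: "norm (\<phi> x *\<^sub>R \<Psi> x - \<phi> y *\<^sub>R \<Psi> y) \<le> 3 * L * norm (x - y)" if "norm x < 2" for x y
  proof -
    have "\<phi> x *\<^sub>R \<Psi> x - \<phi> y *\<^sub>R \<Psi> y = (\<phi> x - \<phi> y) *\<^sub>R \<Psi> x + \<phi> y *\<^sub>R (\<Psi> x - \<Psi> y)"
      by (simp add: algebra_simps)
    then have "norm (\<phi> x *\<^sub>R \<Psi> x - \<phi> y *\<^sub>R \<Psi> y) \<le> \<bar>\<phi> x - \<phi> y\<bar> * norm x + \<bar>\<phi> y\<bar> * norm (\<Psi> x - \<Psi> y)"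
      by (metis norm_scaleR norm_triangle_ineq \<Psi>(2))
    also have "\<dots> \<le> (L * norm (x - y)) * 2 + L * norm (x - y)"
      using \<phi>(1)[of x y] \<phi>(2)[of y] \<phi>(4) that \<Psi>(1)[of x y] by (intro add_mono mult_mono) auto
    finally show ?thesis by simp
  qed
  show "norm (\<phi> x *\<^sub>R \<Psi> x - \<phi> y *\<^sub>R \<Psi> y) \<le> 3 * L * norm (x - y)" for x y
  proof (cases "norm x < 2")
    case False
    show ?thesis
    proof (cases "norm y < 2")
      case True
      then show ?thesis using one[of y x] by (simp add: norm_minus_commute)
    next
      case False
      then show ?thesis using \<open>\<not> norm x < 2\<close> \<phi>(3)[of x] \<phi>(3)[of y] \<phi>(4) by simp
    qed
  qed (rule one)
  show "norm (\<phi> z *\<^sub>R \<Psi> z) \<le> 3 * L" for z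
  proof (cases "norm z < 2")
    case True
    have "norm (\<phi> z *\<^sub>R \<Psi> z) = \<bar>\<phi> z\<bar> * norm z" by (simp add: \<Psi>)
    also have "\<dots> \<le> L * 2" using \<phi>(2)[of z] \<phi>(4) True by (intro mult_mono) auto
    finally show ?thesis using \<phi>(4) by simp
  qed (use \<phi>(3)[of z] \<phi>(4) in simp)
  show "\<phi> z *\<^sub>R \<Psi> z = 0" if "norm z \<ge> 2" for z using \<phi>(3)[OF that] by simp
qed

lemma bump_scaleR_id: "bump L \<phi> \<Longrightarrow> bump (3 * L) (\<lambda>z. \<phi> z *\<^sub>R z)"
  using bump_scaleR[of L \<phi> "\<lambda>z. z"] by simp

lemma bump_norm_power2: "bump L \<phi> \<Longrightarrow> bump (9 * L) (\<lambda>z. (norm z)\<^sup>2 * \<phi> z)"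
  using bump_scaleR[of "3 * L" "\<lambda>z. \<phi> z *\<^sub>R norm z" norm] bump_scaleR[of L \<phi> norm]
  by (simp add: norm_triangle_ineq3 power2_eq_square mult_ac)

lemma bump_inner:
  fixes \<Phi> :: "'a::real_normed_vector \<Rightarrow> 'b::real_inner"
  assumes "bump L \<Phi>" "norm e \<le> 1"
  shows "bump L (\<lambda>z. inner (\<Phi> z) e)"
proof (rule bumpI)
  have le: "norm (inner v e) \<le> norm v" for v
    using Cauchy_Schwarz_ineq2[of v e] mult_left_mono[OF assms(2), of "norm v"] by simp
  show "norm (inner (\<Phi> x) e - inner (\<Phi> y) e) \<le> L * norm (x - y)" for x y
    using le[of "\<Phi> x - \<Phi> y"] bumpD(1)[OF assms(1), of x y] by (simp add: inner_diff_left)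
  show "norm (inner (\<Phi> z) e) \<le> L" for z
    using le bumpD(2)[OF assms(1)] order_trans by blast
qed (simp add: bumpD(3)[OF assms(1)])

lemma bump_double: "bump L \<Phi> \<Longrightarrow> bump (2 * L) (\<lambda>z. \<Phi> (2 *\<^sub>R z))"
proof (rule bumpI)
  assume b: "bump L \<Phi>"
  show "norm (\<Phi> (2 *\<^sub>R x) - \<Phi> (2 *\<^sub>R y)) \<le> 2 * L * norm (x - y)" for x y
    using bumpD(1)[OF b, of "2 *\<^sub>R x" "2 *\<^sub>R y"] by (simp add: scaleR_diff_right[symmetric])
  show "norm (\<Phi> (2 *\<^sub>R z)) \<le> 2 * L" for z
    using bumpD(2)[OF b, of "2 *\<^sub>R z"] bumpD(4)[OF b] by simp
qed (simp add: bumpD(3))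

text \<open>Reference weight. At scales not below the distance to \<Gamma> its moment is bounded
  from below, so one may divide by it.\<close>

definition tent :: "'a::real_normed_vector \<Rightarrow> real" where
  "tent z = max 0 (2 - norm z)"

lemma bump_tent: "bump 2 tent"
proof (rule bumpI)
  show "norm (tent x - tent y) \<le> 2 * norm (x - y)" for x y :: 'a
    using norm_triangle_ineq3[of x y] norm_ge_zero[of "x - y"] unfolding tent_def real_norm_def by linarith
qed (auto simp: tent_def)

text \<open>
  \<open>kern\<close> is a difference of two truncations of \<open>u powr (-q-1)\<close>, so its rescalings by powers of \<open>4\<close>
  telescope to that power; \<open>kern_int\<close> is the antiderivative of \<open>- kern\<close> that vanishes for \<open>u \<ge> 4\<close>.
\<close>

definition kern :: "real \<Rightarrow> real \<Rightarrow> real" where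
  "kern q u = max u 1 powr (- q - 1) - max u 4 powr (- q - 1)"

text \<open>For positive q and S this is the integral of \<open>max v S powr (- q - 1)\<close> over
  v from u to infinity: a power beyond S, and its tangent line at S before.\<close>

definition kern_primitive :: "real \<Rightarrow> real \<Rightarrow> real \<Rightarrow> real" where
  "kern_primitive q S u = max u S powr (- q) / q + (max u S - u) * max u S powr (- q - 1)"

definition kern_int :: "real \<Rightarrow> real \<Rightarrow> real" where
  "kern_int q u = kern_primitive q 1 u - kern_primitive q 4 u"

lemma kern_primitive_deriv:
  assumes q: "q > 0" and S: "S > 0"
  shows "(kern_primitive q S has_real_derivative - (max u S powr (- q - 1))) (at u)"
proof -
  define f where "f u = u powr (- q) / q" for u
  define g where "g u = S powr (- q) / q + (S - u) * S powr (- q - 1)" for u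
  have eq: "kern_primitive q S u = (if u \<in> {S..} then f u else g u)" for u
    by (auto simp: kern_primitive_def f_def g_def max_def)
  have f: "(f has_real_derivative - (u powr (- q - 1))) (at u within A)" if "u > 0" for u A
    using that q unfolding f_def by (auto intro!: derivative_eq_intros)
  have g: "(g has_real_derivative - (S powr (- q - 1))) (at u within A)" for u A
    unfolding g_def by (auto intro!: derivative_eq_intros)
  have fg: "f S = g S" by (simp add: f_def g_def)
  have "((\<lambda>u. if u \<in> {S..} then f u else g u) has_derivative
      (if u \<in> {S..} then (*) (- (u powr (- q - 1))) else (*) (- (S powr (- q - 1)))))
      (at u within {S..} \<union> {..S})"
    by (rule has_derivative_If_within_closures[where f' = "\<lambda>u. (*) (- (u powr (- q - 1)))"
          and g' = "\<lambda>u. (*) (- (S powr (- q - 1)))"])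
       (use S f g fg in \<open>auto simp: has_field_derivative_def\<close>)
  moreover have "{S..} \<union> {..S} = UNIV" by auto
  ultimately show ?thesis
    unfolding has_field_derivative_def eq[abs_def]
    by (cases "S \<le> u") (auto simp: max_def)
qed

lemma kern_int_deriv: "q > 0 \<Longrightarrow> (kern_int q has_real_derivative - kern q u) (at u)"
  unfolding kern_int_def[abs_def] kern_def
  using DERIV_diff[OF kern_primitive_deriv[of q 1 u] kern_primitive_deriv[of q 4 u]] by simp

lemma kern_int_0: "u \<ge> 4 \<Longrightarrow> kern_int q u = 0" and kern_0: "u \<ge> 4 \<Longrightarrow> kern q u = 0"
  by (auto simp: kern_int_def kern_primitive_def kern_def max_def)

lemma continuous_kern: "continuous_on UNIV (kern q)"
  unfolding kern_def by (intro continuous_intros) (auto simp: max_def split: if_splits)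

lemma kern_bounds:
  assumes "q > 0"
  shows "0 \<le> kern q u" "kern q u \<le> 1"
proof -
  have "max u 4 powr (- q - 1) \<le> max u 1 powr (- q - 1)" "max u 1 powr (- q - 1) \<le> 1 powr (- q - 1)"
    using assms by (intro powr_mono2'; simp)+
  then show "0 \<le> kern q u" "kern q u \<le> 1"
    using powr_ge_zero[of "max u 4" "- q - 1"] unfolding kern_def powr_one_eq_one by linarith+
qed

lemma norm_power2_diff_le:
  fixes x y :: "'a::real_normed_vector"
  assumes "norm x \<le> 2" "norm y \<le> 2"
  shows "\<bar>(norm x)\<^sup>2 - (norm y)\<^sup>2\<bar> \<le> 4 * norm (x - y)"
proof -
  have "\<bar>(norm x)\<^sup>2 - (norm y)\<^sup>2\<bar> = \<bar>norm x + norm y\<bar> * \<bar>norm x - norm y\<bar>"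
    by (simp only: abs_mult[symmetric]) (simp add: power2_eq_square algebra_simps)
  also have "\<dots> \<le> 4 * norm (x - y)"
    using assms norm_triangle_ineq3[of x y] by (intro mult_mono) auto
  finally show ?thesis .
qed

text \<open>The squared norm is 4-Lipschitz on the ball of radius 2, and as h vanishes from 4 on,
  norms may be truncated at 2. The bound on the values comes from comparison with
  \<open>h 4 = 0\<close>.\<close>

lemma bump_radialI:
  fixes h :: "real \<Rightarrow> real"
  assumes h: "\<And>u v. u \<in> {0..4} \<Longrightarrow> v \<in> {0..4} \<Longrightarrow> \<bar>h u - h v\<bar> \<le> c * \<bar>u - v\<bar>" and 0: "\<And>u. u \<ge> 4 \<Longrightarrow> h u = 0"
  shows "bump (4 * c) (\<lambda>z::'a::real_normed_vector. h ((norm z)\<^sup>2))"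
proof (rule bumpI)
  have c: "c \<ge> 0" using h[of 0 1] abs_ge_zero[of "h 0 - h 1"] by simp
  have sq: "(norm z)\<^sup>2 \<ge> 4 \<longleftrightarrow> norm z \<ge> 2" for z :: 'a
    using abs_le_square_iff[of 2 "norm z"] by simp
  show "norm (h ((norm x)\<^sup>2) - h ((norm y)\<^sup>2)) \<le> 4 * c * norm (x - y)" for x y :: 'a
  proof -
    let ?u = "min ((norm x)\<^sup>2) 4" and ?v = "min ((norm y)\<^sup>2) 4"
    have "h ((norm z)\<^sup>2) = h (min ((norm z)\<^sup>2) 4)" for z :: 'a by (auto simp: min_def 0)
    then have "norm (h ((norm x)\<^sup>2) - h ((norm y)\<^sup>2)) = \<bar>h ?u - h ?v\<bar>" by simp
    also have "\<dots> \<le> c * \<bar>?u - ?v\<bar>" by (rule h) auto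
    also have "c * \<bar>?u - ?v\<bar> \<le> c * (4 * norm (x - y))"
    proof (rule mult_left_mono[OF _ c])
      have m: "min ((norm z)\<^sup>2) 4 = (min (norm z) 2)\<^sup>2" for z :: 'a
        using sq[of z] power_mono[of "norm z" 2 2] by (cases "norm z \<le> 2") (simp_all add: min_absorb1 min_absorb2)
      have "\<bar>?u - ?v\<bar> \<le> 4 * norm (min (norm x) 2 - min (norm y) 2)"
        using norm_power2_diff_le[of "min (norm x) 2" "min (norm y) 2"] unfolding m by simp
      also have "norm (min (norm x) 2 - min (norm y) 2) \<le> norm (x - y)"
        using norm_triangle_ineq3[of x y] norm_ge_zero[of "x - y"] unfolding real_norm_def by linarith
      finally show "\<bar>?u - ?v\<bar> \<le> 4 * norm (x - y)" by simp
    qed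
    finally show ?thesis by (simp add: mult_ac)
  qed
  show "norm (h ((norm z)\<^sup>2)) \<le> 4 * c" for z :: 'a
  proof (cases "(norm z)\<^sup>2 \<ge> 4")
    case False
    then have "\<bar>h ((norm z)\<^sup>2) - h 4\<bar> \<le> c * \<bar>(norm z)\<^sup>2 - 4\<bar>" by (intro h) auto
    also have "\<dots> \<le> c * 4" using False c by (intro mult_left_mono) auto
    finally show ?thesis using 0[of 4] by simp
  qed (simp add: 0 c)
  show "h ((norm z)\<^sup>2) = 0" if "norm z \<ge> 2" for z :: 'a
    using power_mono[OF that, of 2] by (intro 0) simp
qed

text \<open>On {0..4} the subtracted truncation is constant, and the other one is a power of an
  argument at least 1, with derivative at most q + 1.\<close>

lemma bump_kern:
  assumes "q > 0" shows "bump (4 * (q + 1)) (\<lambda>z::'a::real_normed_vector. kern q ((norm z)\<^sup>2))"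
proof (rule bump_radialI[of "kern q" "q + 1"])
  fix u v :: real assume uv: "u \<in> {0..4}" "v \<in> {0..4}"
  have "norm (max u 1 powr (- q - 1) - max v 1 powr (- q - 1)) \<le> (q + 1) * norm (max u 1 - max v 1)"
  proof (rule field_differentiable_bound[of "{1..}"])
    fix z :: real assume z: "z \<in> {1..}"
    show "((\<lambda>x. x powr (- q - 1)) has_field_derivative (- q - 1) * z powr (- q - 1 - 1)) (at z within {1..})"
      using z by (intro has_field_derivative_at_within[OF has_real_derivative_powr]) auto
    have "z powr (- q - 1 - 1) \<le> 1 powr (- q - 1 - 1)" using z assms by (intro powr_mono2') auto
    then have "(q + 1) * z powr (- q - 1 - 1) \<le> (q + 1) * 1"
      using assms by (intro mult_left_mono) auto
    moreover have "norm ((- q - 1) * z powr (- q - 1 - 1)) = (q + 1) * z powr (- q - 1 - 1)"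
      using assms by (simp add: abs_mult)
    ultimately show "norm ((- q - 1) * z powr (- q - 1 - 1)) \<le> q + 1" by (simp only: mult_1_right)
  qed auto
  also have "\<dots> \<le> (q + 1) * \<bar>u - v\<bar>" using assms by (intro mult_left_mono) auto
  finally show "\<bar>kern q u - kern q v\<bar> \<le> (q + 1) * \<bar>u - v\<bar>"
    using uv by (simp add: kern_def)
qed (rule kern_0)

lemma bump_kern_int:
  assumes "q > 0" shows "bump 4 (\<lambda>z::'a::real_normed_vector. kern_int q ((norm z)\<^sup>2))"
proof -
  have "bump (4 * 1) (\<lambda>z::'a. kern_int q ((norm z)\<^sup>2))"
  proof (rule bump_radialI[of "kern_int q" 1])
    fix u v :: real
    have "norm (kern_int q u - kern_int q v) \<le> 1 * norm (u - v)"
    proof (rule field_differentiable_bound[of UNIV])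
      show "(kern_int q has_field_derivative - kern q z) (at z within UNIV)" for z
        using kern_int_deriv[OF assms] by simp
      show "norm (- kern q z) \<le> 1" for z using kern_bounds[OF assms, of z] by simp
    qed auto
    then show "\<bar>kern_int q u - kern_int q v\<bar> \<le> 1 * \<bar>u - v\<bar>" by simp
  qed (rule kern_int_0)
  then show ?thesis by simp
qed

text \<open>The terms telescope along truncations of the power at the levels (2^j \<delta>)^2.
  Because \<delta>^2 \<le> u the truncation at level j = 0 is inactive, so the sum is the full
  power.\<close>

lemma sums_kern:
  assumes q: "q > 0" and \<delta>: "\<delta> > 0" "\<delta>\<^sup>2 \<le> u"
  shows "(\<lambda>j. ((2 ^ j * \<delta>)\<^sup>2) powr (- q - 1) * kern q (u / (2 ^ j * \<delta>)\<^sup>2)) sums (u powr (- q - 1))" (is "?f sums _")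
proof -
  define g where "g j = max u ((2 ^ j * \<delta>)\<^sup>2) powr (- q - 1)" for j :: nat
  have lim: "g \<longlonglongrightarrow> 0"
  proof -
    have "(\<lambda>j. ((2 ^ j * \<delta>)\<^sup>2) powr (- q - 1)) \<longlonglongrightarrow> 0"
      using \<delta>(1) q by real_asymp
    then show ?thesis
      by (rule tendsto_sandwich[OF _ _ tendsto_const, rotated 2])
         (use q \<delta> in \<open>auto simp: g_def intro!: always_eventually powr_mono2'\<close>)
  qed
  have "?f j = g j - g (Suc j)" for j
  proof -
    let ?S = "(2 ^ j * \<delta>)\<^sup>2"
    have S: "?S > 0" using \<delta> by simp
    have "?S * max (u / ?S) 1 = max u ?S" "?S * max (u / ?S) 4 = max u (4 * ?S)"
      using S by (auto simp: max_def field_simps)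
    moreover have "4 * ?S = (2 ^ Suc j * \<delta>)\<^sup>2" by (simp add: power2_eq_square)
    ultimately show ?thesis
      using S unfolding kern_def g_def by (simp add: right_diff_distrib powr_mult[symmetric])
  qed
  then have "?f sums (g 0 - 0)"
    using telescope_sums'[OF lim] by simp
  then show ?thesis using \<delta> by (simp add: g_def max_def)
qed

lemma sums_kern_int:
  assumes q: "q > 0" and \<delta>: "\<delta> > 0" "\<delta>\<^sup>2 \<le> u"
  shows "(\<lambda>j. ((2 ^ j * \<delta>)\<^sup>2) powr (- q) * kern_int q (u / (2 ^ j * \<delta>)\<^sup>2)) sums (u powr (- q) / q)" (is "?f sums _")
proof -
  define g where "g j = kern_primitive q ((2 ^ j * \<delta>)\<^sup>2) u" for j :: nat
  have lim: "g \<longlonglongrightarrow> 0"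
  proof -
    have "(\<lambda>j. ((2 ^ j * \<delta>)\<^sup>2) powr (- q) / q + ((2 ^ j * \<delta>)\<^sup>2 - u) * ((2 ^ j * \<delta>)\<^sup>2) powr (- q - 1)) \<longlonglongrightarrow> 0"
      using \<delta>(1) q by real_asymp
    \<comment> \<open>Once the level exceeds u only the affine branch of
      \<open>kern_primitive\<close> is left, and it tends to 0.\<close>
    moreover have "eventually (\<lambda>j. (2 ^ j * \<delta>)\<^sup>2 \<ge> u) sequentially"
      using \<delta>(1) by real_asymp
    ultimately show ?thesis
      by (rule Lim_transform_eventually[OF _ eventually_mono])
         (auto simp: g_def kern_primitive_def max_def)
  qed
  have "?f j = g j - g (Suc j)" for j
  proof -
    define T where "T = (2 ^ j * \<delta>)\<^sup>2"
    have T: "T > 0" "4 * T = (2 ^ Suc j * \<delta>)\<^sup>2" using \<delta> by (simp_all add: T_def power2_eq_square)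
    have m: "max (u / T) 1 = max u T / T" "max (u / T) 4 = max u (4 * T) / T"
      using T(1) by (auto simp: max_def field_simps)
    \<comment> \<open>\<open>kern_primitive\<close> is homogeneous: rescaling u and the truncation
      level by T splits off the factor T powr (-q).\<close>
    have p: "T powr (- q) * ((M / T) powr (- q) / q + (M / T - u / T) * (M / T) powr (- q - 1))
        = M powr (- q) / q + (M - u) * M powr (- q - 1)" if M: "M > 0" for M
    proof -
      have 1: "M powr r = T powr r * (M / T) powr r" for r
        using T(1) M by (subst powr_mult[symmetric]) auto
      have 2: "T powr (- q - 1) = T powr (- q) / T"
        using T(1) powr_diff[of T "- q" 1] by simp
      have "(M / T - u / T) = (M - u) / T" by (simp add: diff_divide_distrib)
      then show ?thesis unfolding 1[of "- q"] 1[of "- q - 1"] 2 by (simp add: distrib_left)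
    qed
    show ?thesis
      using T(1) p[of "max u T"] p[of "max u (4 * T)"]
      unfolding kern_int_def kern_primitive_def g_def T(2)[symmetric] T_def[symmetric] m right_diff_distrib by simp
  qed
  then have "?f sums (g 0 - 0)"
    using telescope_sums'[OF lim] by simp
  then show ?thesis using \<delta> by (simp add: g_def max_def kern_primitive_def)
qed

section \<open>Moments and their defects\<close>

text \<open>The normalisation makes the moments of a fixed test function bounded uniformly in s, as
  long as s is not below the distance of X to \<Gamma>.\<close>

definition mom :: "nat \<Rightarrow> (real ^ 'n) measure \<Rightarrow> real ^ 'n \<Rightarrow> real \<Rightarrow>
    (real ^ 'n \<Rightarrow> 'b::{banach, second_countable_topology}) \<Rightarrow> 'b" where
  "mom d M X s \<Phi> = (1 / s ^ d) *\<^sub>R (\<integral>y. \<Phi> ((1 / s) *\<^sub>R (X - y)) \<partial>M)"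

lemma bump_rescaled:
  fixes X :: "'a::real_normed_vector"
  assumes \<Phi>: "bump L \<Phi>" and s: "s > 0"
  shows "continuous_on UNIV (\<lambda>y. \<Phi> ((1 / s) *\<^sub>R (X - y)))"
    "y \<notin> ball X (2 * s) \<Longrightarrow> \<Phi> ((1 / s) *\<^sub>R (X - y)) = 0"
proof -
  show "continuous_on UNIV (\<lambda>y. \<Phi> ((1 / s) *\<^sub>R (X - y)))"
    by (intro continuous_intros continuous_on_compose2[OF bumpD(5)[OF \<Phi>]]) auto
  assume "y \<notin> ball X (2 * s)"
  then have "norm (X - y) / s \<ge> 2"
    using s by (simp add: dist_norm field_simps)
  then have "norm ((1 / s) *\<^sub>R (X - y)) \<ge> 2"
    using s by simp
  then show "\<Phi> ((1 / s) *\<^sub>R (X - y)) = 0" by (rule bumpD(3)[OF \<Phi>])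
qed

text \<open>The function s / L times the rescaled test function is 1-Lipschitz and vanishes outside
  \<open>ball X (2 * s)\<close>. The power of 2 comes from normalising the distance at radius 2s but
  the moment at scale s.\<close>

lemma mom_diff_real:
  fixes \<Phi> :: "real ^ 'n \<Rightarrow> real"
  assumes dist: "dist_measures d X (2 * s) \<mu> \<sigma> < ennreal \<epsilon>" and s: "s > 0" and \<Phi>: "bump L \<Phi>"
  shows "\<bar>mom d \<sigma> X s \<Phi> - mom d \<mu> X s \<Phi>\<bar> \<le> 2 ^ (d + 1) * L * \<epsilon>"
proof (cases "L = 0")
  case True
  then have "\<Phi> = (\<lambda>_. 0)" using bumpD(2)[OF \<Phi>] by auto
  then show ?thesis by (simp add: mom_def True)
next
  case False
  then have L: "L > 0" using bumpD(4)[OF \<Phi>] by simp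
  have \<epsilon>: "\<epsilon> > 0" using dist ennreal_neg[of \<epsilon>] by (cases "\<epsilon> > 0") auto
  let ?F = "\<lambda>y. \<Phi> ((1 / s) *\<^sub>R (X - y))"
  let ?f = "\<lambda>y. s / L * ?F y"
  have "?f \<in> Lip X (2 * s)"
  proof -
    have "\<bar>?f x - ?f y\<bar> \<le> dist x y" for x y
    proof -
      have "\<bar>?f x - ?f y\<bar> = s / L * \<bar>?F x - ?F y\<bar>"
        unfolding right_diff_distrib[symmetric] abs_mult using s L by simp
      also have "\<dots> \<le> s / L * (L * norm ((1 / s) *\<^sub>R (X - x) - (1 / s) *\<^sub>R (X - y)))"
        using bumpD(1)[OF \<Phi>] s L by (intro mult_left_mono) auto
      also have "(1 / s) *\<^sub>R (X - x) - (1 / s) *\<^sub>R (X - y) = (1 / s) *\<^sub>R (y - x)"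
        by (simp add: scaleR_diff_right[symmetric])
      finally show ?thesis using s L by (simp add: dist_norm norm_minus_commute)
    qed
    then show ?thesis
      using bump_rescaled(2)[OF \<Phi> s] by (auto simp: Lip_def dist_real_def intro!: lipschitz_onI)
  qed
  then have "ennreal (1 / (2 * s) ^ (d + 1)) * ennreal \<bar>(\<integral>y. ?f y \<partial>\<sigma>) - (\<integral>y. ?f y \<partial>\<mu>)\<bar> \<le> dist_measures d X (2 * s) \<mu> \<sigma>"
    unfolding dist_measures_def by (intro mult_left_mono SUP_upper) auto
  then have "ennreal (1 / (2 * s) ^ (d + 1) * \<bar>(\<integral>y. ?f y \<partial>\<sigma>) - (\<integral>y. ?f y \<partial>\<mu>)\<bar>) < ennreal \<epsilon>"
    using dist s by (subst ennreal_mult') auto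
  then have lt: "\<bar>(\<integral>y. ?f y \<partial>\<sigma>) - (\<integral>y. ?f y \<partial>\<mu>)\<bar> \<le> \<epsilon> * (2 * s) ^ (d + 1)"
    using \<epsilon> s by (simp add: ennreal_less_iff field_simps del: power_Suc)
  have "(\<integral>y. ?f y \<partial>\<sigma>) - (\<integral>y. ?f y \<partial>\<mu>) = s / L * s ^ d * (mom d \<sigma> X s \<Phi> - mom d \<mu> X s \<Phi>)"
    using s by (simp add: mom_def right_diff_distrib)
  then have "s / L * s ^ d * \<bar>mom d \<sigma> X s \<Phi> - mom d \<mu> X s \<Phi>\<bar> \<le> \<epsilon> * (2 * s) ^ (d + 1)"
    using lt s L by (simp add: abs_mult)
  then show ?thesis
    using s L by (simp add: field_simps power_mult_distrib)
qed

text \<open>The inner product passes through the integral of an integrable function; if \<mu> is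
  infinite on some ball, both sides are 0.\<close>

lemma (in flat) mom_inner:
  fixes \<Phi> :: "real ^ 'n \<Rightarrow> 'b::euclidean_space"
  assumes \<Phi>: "bump L \<Phi>" and s: "s > 0"
  shows "inner (mom d \<mu> X s \<Phi>) e = mom d \<mu> X s (\<lambda>z. inner (\<Phi> z) e)"
proof -
  note c = bump_rescaled(1)[OF \<Phi> s, of X]
  have c': "continuous_on UNIV (\<lambda>y. inner (\<Phi> ((1 / s) *\<^sub>R (X - y))) e)"
    by (intro continuous_intros c)
  show ?thesis
  proof (cases "\<exists>p r. emeasure \<mu> (ball p r) = \<infinity>")
    case True
    then show ?thesis
      using not_finite_imp_integral_0[OF _ c] not_finite_imp_integral_0[OF _ c'] by (auto simp: mom_def)
  next
    case False
    then have "integrable \<mu> (\<lambda>y. \<Phi> ((1 / s) *\<^sub>R (X - y)))"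
      by (intro integrable_continuous[OF _ c bump_rescaled(2)[OF \<Phi> s]]) auto
    then show ?thesis by (simp add: mom_def)
  qed
qed

lemma (in flat) mom_axis:
  fixes g :: "real \<Rightarrow> real"
  assumes g: "continuous_on UNIV g" "\<And>t. t \<ge> 2 \<Longrightarrow> g t = 0" and s: "s > 0"
  shows "mom d \<mu> X s (\<lambda>z. g (norm z) *\<^sub>R z) = mom d \<mu> X s (\<lambda>z. g (norm z)) *\<^sub>R ((1 / s) *\<^sub>R (X - foot X))"
proof -
  have c: "continuous_on UNIV (\<lambda>t. g (t / s))"
    using s by (intro continuous_on_compose2[OF g(1)] continuous_intros) auto
  have "(\<integral>y. g (norm (X - y) / s) *\<^sub>R (X - y) \<partial>\<mu>) = (\<integral>y. g (norm (X - y) / s) \<partial>\<mu>) *\<^sub>R (X - foot X)"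
    using axis_moment[OF c, of "2 * s" X] g(2) s by (simp add: field_simps)
  moreover have "(\<integral>y. g (norm ((1 / s) *\<^sub>R (X - y))) *\<^sub>R ((1 / s) *\<^sub>R (X - y)) \<partial>\<mu>)
      = (1 / s) *\<^sub>R (\<integral>y. g (norm (X - y) / s) *\<^sub>R (X - y) \<partial>\<mu>)"
    using s by (subst integral_scaleR_right[symmetric]) (simp add: mult.commute)
  ultimately show ?thesis
    using s by (simp add: mom_def mult_ac)
qed

text \<open>\<open>dilation_moment\<close> for the pair \<open>kern_int\<close>, \<open>kern\<close>
  rescaled to s. Summed over dyadic scales with q = (d + p) / 2 it becomes (d + p) |v|^2 R(p + 2) =
  p R(p), because \<open>kern_int\<close> sums to the power divided by q.\<close>

lemma (in flat) mom_dilation: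
  assumes q: "q > 0" and s: "s > 0"
  shows "real d * mom d \<mu> X s (\<lambda>z. kern_int q ((norm z)\<^sup>2))
    = 2 * mom d \<mu> X s (\<lambda>z. (norm z)\<^sup>2 * kern q ((norm z)\<^sup>2))
      - 2 * (norm ((1 / s) *\<^sub>R (X - foot X)))\<^sup>2 * mom d \<mu> X s (\<lambda>z. kern q ((norm z)\<^sup>2))"
proof -
  let ?E = "\<lambda>u. kern_int q (u / s\<^sup>2)" and ?K = "\<lambda>u. kern q (u / s\<^sup>2) / s\<^sup>2"
  let ?k = "\<lambda>y. kern q ((norm ((1 / s) *\<^sub>R (X - y)))\<^sup>2)"
  let ?t = "\<lambda>y. (norm ((1 / s) *\<^sub>R (X - y)))\<^sup>2 * kern q ((norm ((1 / s) *\<^sub>R (X - y)))\<^sup>2)"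
  let ?w = "(norm ((1 / s) *\<^sub>R (X - foot X)))\<^sup>2"
  have sq: "(norm ((1 / s) *\<^sub>R v))\<^sup>2 = (norm v)\<^sup>2 / s\<^sup>2" for v :: "real ^ 'n"
    by (simp add: power_divide)
  have "(?E has_real_derivative - ?K u) (at u)" for u
  proof -
    have "(?E has_real_derivative - kern q (u / s\<^sup>2) * (1 / s\<^sup>2)) (at u)"
      by (intro DERIV_chain2[OF kern_int_deriv[OF q]] DERIV_cdivide DERIV_ident)
    then show ?thesis by simp
  qed
  moreover have "continuous_on UNIV ?K"
    using s by (intro continuous_intros continuous_on_compose2[OF continuous_kern]) auto
  moreover have "?E u = 0" "?K u = 0" if "u \<ge> 4 * s\<^sup>2" for u
    using that s kern_int_0[of "u / s\<^sup>2"] kern_0[of "u / s\<^sup>2"] by (auto simp: field_simps)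
  ultimately have "real d * (\<integral>y. ?E ((norm (X - y))\<^sup>2) \<partial>\<mu>)
      = 2 * (\<integral>y. ((norm (X - y))\<^sup>2 - (norm (X - foot X))\<^sup>2) * ?K ((norm (X - y))\<^sup>2) \<partial>\<mu>)"
    by (intro dilation_moment[of ?E ?K "4 * s\<^sup>2"]) auto
  also have "\<dots> = 2 * (\<integral>y. ?t y - ?w * ?k y \<partial>\<mu>)"
    unfolding sq by (simp add: left_diff_distrib diff_divide_distrib)
  also have "(\<integral>y. ?t y - ?w * ?k y \<partial>\<mu>) = (\<integral>y. ?t y \<partial>\<mu>) - ?w * (\<integral>y. ?k y \<partial>\<mu>)"
  proof -
    note bk = bump_kern[OF q, where 'a = "real ^ 'n"]
    note bt = bump_norm_power2[OF bk]
    note c = bump_rescaled(1)[OF bk s, of X] bump_rescaled(1)[OF bt s, of X]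
    have c': "continuous_on UNIV (\<lambda>y. ?t y - ?w * ?k y)"
      by (intro continuous_intros c)
    show ?thesis
    proof (cases "\<exists>p r. emeasure \<mu> (ball p r) = \<infinity>")
      case True
      then show ?thesis
        using not_finite_imp_integral_0[OF _ c(1)] not_finite_imp_integral_0[OF _ c(2)] not_finite_imp_integral_0[OF _ c']
        by auto
    next
      case False
      then have "integrable \<mu> ?k" "integrable \<mu> ?t"
        by (intro integrable_continuous[OF _ c(1) bump_rescaled(2)[OF bk s]]
            integrable_continuous[OF _ c(2) bump_rescaled(2)[OF bt s]]; simp)+
      then show ?thesis by (subst Bochner_Integration.integral_diff) auto
    qed
  qed
  finally have "real d * (\<integral>y. kern_int q ((norm ((1 / s) *\<^sub>R (X - y)))\<^sup>2) \<partial>\<mu>) = 2 * ((\<integral>y. ?t y \<partial>\<mu>) - ?w * (\<integral>y. ?k y \<partial>\<mu>))"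
    unfolding sq .
  then have "(real d * (\<integral>y. kern_int q ((norm ((1 / s) *\<^sub>R (X - y)))\<^sup>2) \<partial>\<mu>)) / s ^ d = (2 * ((\<integral>y. ?t y \<partial>\<mu>) - ?w * (\<integral>y. ?k y \<partial>\<mu>))) / s ^ d"
    by (rule arg_cong)
  then show ?thesis
    by (simp add: mom_def diff_divide_distrib right_diff_distrib mult_ac)
qed

lemma scaleR_diff_le:
  fixes v w :: "'a::real_normed_vector"
  assumes "\<bar>a - b\<bar> \<le> \<eta>" "norm (v - w) \<le> \<eta>'" "norm v \<le> N'" "\<bar>b\<bar> \<le> N"
  shows "norm (a *\<^sub>R v - b *\<^sub>R w) \<le> \<eta> * N' + N * \<eta>'"
proof -
  have "a *\<^sub>R v - b *\<^sub>R w = (a - b) *\<^sub>R v + b *\<^sub>R (v - w)" by (simp add: algebra_simps)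
  then have "norm (a *\<^sub>R v - b *\<^sub>R w) \<le> \<bar>a - b\<bar> * norm v + \<bar>b\<bar> * norm (v - w)"
    by (metis norm_scaleR norm_triangle_ineq)
  also have "\<dots> \<le> \<eta> * N' + N * \<eta>'"
    using assms by (intro add_mono mult_mono) (auto intro: order_trans[OF norm_ge_zero] order_trans[OF abs_ge_zero])
  finally show ?thesis .
qed

text \<open>
  The two identities for flat measures are used with the direction to the plane eliminated through
  the moments of \<^const>\<open>tent\<close>; they become polynomial in moments and hence stable under perturbation.
\<close>

lemma bilinear_defect:
  fixes m1 b1 :: "'a::real_normed_vector"
  assumes "\<bar>m0 - m0'\<bar> \<le> \<eta>" "\<bar>b0 - b0'\<bar> \<le> \<eta>" "norm (m1 - m1') \<le> \<eta>" "norm (b1 - b1') \<le> \<eta>"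
    and "\<bar>m0'\<bar> \<le> N" "\<bar>b0'\<bar> \<le> N" "norm m1 \<le> N" "norm b1 \<le> N"
    and "b0' *\<^sub>R m1' = m0' *\<^sub>R b1'"
  shows "norm (b0 *\<^sub>R m1 - m0 *\<^sub>R b1) \<le> 4 * N * \<eta>"
proof -
  have "norm (b0 *\<^sub>R m1 - b0' *\<^sub>R m1') \<le> \<eta> * N + N * \<eta>" "norm (m0 *\<^sub>R b1 - m0' *\<^sub>R b1') \<le> \<eta> * N + N * \<eta>"
    using scaleR_diff_le[OF assms(2,3,7,6)] scaleR_diff_le[OF assms(1,4,8,5)] .
  moreover have "b0 *\<^sub>R m1 - m0 *\<^sub>R b1 = (b0 *\<^sub>R m1 - b0' *\<^sub>R m1') - (m0 *\<^sub>R b1 - m0' *\<^sub>R b1')"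
    using assms(9) by simp
  ultimately show ?thesis
    using norm_triangle_ineq4[of "b0 *\<^sub>R m1 - b0' *\<^sub>R m1'" "m0 *\<^sub>R b1 - m0' *\<^sub>R b1'"]
    by (simp add: mult_ac)
qed

text \<open>Each summand is a product of three factors of size at most N, so replacing the factors
  one after another costs 3 N^2 \<eta>. The coefficients c, 2 and 2 add up to c + 4.\<close>

lemma trilinear_defect:
  fixes b1 :: "'a::real_inner"
  assumes "\<bar>e - e'\<bar> \<le> \<eta>" "\<bar>t - t'\<bar> \<le> \<eta>" "\<bar>k - k'\<bar> \<le> \<eta>" "\<bar>b0 - b0'\<bar> \<le> \<eta>" "norm (b1 - b1') \<le> \<eta>"
    and "\<bar>e'\<bar> \<le> N" "\<bar>t'\<bar> \<le> N" "\<bar>k'\<bar> \<le> N" "\<bar>b0'\<bar> \<le> N" "norm b1' \<le> N" "\<bar>b0\<bar> \<le> N" "norm b1 \<le> N" "c \<ge> 0"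
    and "(c * e' - 2 * t') * b0'\<^sup>2 + 2 * k' * inner b1' b1' = 0"
  shows "\<bar>(c * e - 2 * t) * b0\<^sup>2 + 2 * k * inner b1 b1\<bar> \<le> 3 * N\<^sup>2 * (c + 4) * \<eta>"
proof -
  have \<eta>: "\<eta> \<ge> 0" and N: "N \<ge> 0" using assms(1,6) by auto
  have sq: "\<bar>b0 * b0 - b0' * b0'\<bar> \<le> \<eta> * N + N * \<eta>"
    using scaleR_diff_le[of b0 b0' \<eta> b0 b0' \<eta> N N] assms(4,9,11) by simp
  have in2: "\<bar>inner b1 b1 - inner b1' b1'\<bar> \<le> \<eta> * N + N * \<eta>"
  proof -
    have "inner b1 b1 - inner b1' b1' = inner (b1 - b1') b1 + inner b1' (b1 - b1')"
      by (simp add: inner_diff_left inner_diff_right)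
    also have "\<bar>\<dots>\<bar> \<le> norm (b1 - b1') * norm b1 + norm b1' * norm (b1 - b1')"
      by (intro order_trans[OF abs_triangle_ineq] add_mono Cauchy_Schwarz_ineq2)
    also have "\<dots> \<le> \<eta> * N + N * \<eta>"
      using assms(5,10,12) \<eta> N by (intro add_mono mult_mono) auto
    finally show ?thesis .
  qed
  have bb: "norm (b0 * b0) \<le> N * N" "norm (inner b1 b1) \<le> N * N"
    using assms(11,12) N mult_mono[of "norm b1" N "norm b1" N] mult_mono[of "\<bar>b0\<bar>" N "\<bar>b0\<bar>" N]
    by (auto simp: abs_mult power2_norm_eq_inner[symmetric] power2_eq_square)
  have one: "\<bar>x * (b0 * b0) - x' * (b0' * b0')\<bar> \<le> 3 * N\<^sup>2 * \<eta>" if "\<bar>x - x'\<bar> \<le> \<eta>" "\<bar>x'\<bar> \<le> N" for x x'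
    using scaleR_diff_le[of x x' \<eta> "b0 * b0" "b0' * b0'" "\<eta> * N + N * \<eta>" "N * N" N] that sq bb
    by (simp add: algebra_simps power2_eq_square)
  have two: "\<bar>k * inner b1 b1 - k' * inner b1' b1'\<bar> \<le> 3 * N\<^sup>2 * \<eta>"
    using scaleR_diff_le[of k k' \<eta> "inner b1 b1" "inner b1' b1'" "\<eta> * N + N * \<eta>" "N * N" N] assms(3,8) in2 bb
    by (simp add: algebra_simps power2_eq_square)
  have "(c * e - 2 * t) * b0\<^sup>2 + 2 * k * inner b1 b1
      = c * (e * (b0 * b0) - e' * (b0' * b0')) - 2 * (t * (b0 * b0) - t' * (b0' * b0')) + 2 * (k * inner b1 b1 - k' * inner b1' b1')"
    using arg_cong[OF assms(14), of "\<lambda>x. (c * e - 2 * t) * b0\<^sup>2 + 2 * k * inner b1 b1 - x"]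
    by (simp add: algebra_simps power2_eq_square)
  also have "\<bar>\<dots>\<bar> \<le> c * \<bar>e * (b0 * b0) - e' * (b0' * b0')\<bar> + 2 * \<bar>t * (b0 * b0) - t' * (b0' * b0')\<bar>
      + 2 * \<bar>k * inner b1 b1 - k' * inner b1' b1'\<bar>"
  proof -
    have "\<bar>c * x\<bar> = c * \<bar>x\<bar>" for x using \<open>c \<ge> 0\<close> by (simp add: abs_mult)
    then show ?thesis by (smt (verit, best))
  qed
  also have "\<dots> \<le> c * (3 * N\<^sup>2 * \<eta>) + 2 * (3 * N\<^sup>2 * \<eta>) + 2 * (3 * N\<^sup>2 * \<eta>)"
    using one[OF assms(1,6)] one[OF assms(2,7)] two \<open>c \<ge> 0\<close> by (intro add_mono mult_left_mono) auto
  finally show ?thesis by (simp add: algebra_simps)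
qed

text \<open>The radius 2s is that of the supports of test functions at scale s. Truncation makes the
  number real; where it acts, trivial bounds on the moments suffice.\<close>

definition alpha_trunc :: "nat \<Rightarrow> (real ^ 'n) measure \<Rightarrow> real ^ 'n \<Rightarrow> real \<Rightarrow> real" where
  "alpha_trunc d \<sigma> X s = enn2real (min 1 (alpha_number d \<sigma> X (2 * s)))"

lemma alpha_trunc_bounds: "0 \<le> alpha_trunc d \<sigma> X s" "alpha_trunc d \<sigma> X s \<le> 1"
proof -
  show "0 \<le> alpha_trunc d \<sigma> X s" by (simp add: alpha_trunc_def)
  have "enn2real (min 1 (alpha_number d \<sigma> X (2 * s))) \<le> enn2real 1"
    by (intro enn2real_mono) auto
  then show "alpha_trunc d \<sigma> X s \<le> 1" by (simp add: alpha_trunc_def)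
qed

text \<open>If the \<alpha>-number is at least 1, the trivial bound B does. Otherwise the first
  bound is used with \<epsilon> decreasing to the \<alpha>-number; the limit is taken because the
  infimum over flat measures may not be attained.\<close>

lemma le_alpha_truncI:
  assumes eps: "\<And>\<epsilon>. alpha_number d \<sigma> X (2 * s) < ennreal \<epsilon> \<Longrightarrow> 0 < \<epsilon> \<Longrightarrow> \<epsilon> \<le> 1 \<Longrightarrow> x \<le> A * \<epsilon>"
    and "x \<le> B" "A \<ge> 0" "B \<ge> 0"
  shows "x \<le> (A + B) * alpha_trunc d \<sigma> X s"
proof (cases "alpha_number d \<sigma> X (2 * s) < 1")
  case False
  then have "alpha_trunc d \<sigma> X s = 1" by (simp add: alpha_trunc_def min_absorb1 not_less)
  then show ?thesis using assms by simp
next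
  case True
  define a where "a = enn2real (alpha_number d \<sigma> X (2 * s))"
  have a: "alpha_number d \<sigma> X (2 * s) = ennreal a" "a \<ge> 0"
    using True by (auto simp: a_def less_top order.strict_trans)
  then have a1: "a < 1" using True by (metis ennreal_less_one_iff)
  have at: "alpha_trunc d \<sigma> X s = a"
    using True by (simp add: alpha_trunc_def a_def min_absorb2 less_imp_le)
  have "x \<le> A * a + A * \<eta>" if "\<eta> > 0" for \<eta>
  proof -
    have "x \<le> A * min 1 (a + \<eta>)"
      using a a1 that by (intro eps) (auto simp: ennreal_less_iff)
    also have "\<dots> \<le> A * (a + \<eta>)" using assms by (intro mult_left_mono) auto
    finally show ?thesis by (simp add: algebra_simps)
  qed
  note \<eta> = this
  have "x \<le> A * a + e" if "e > 0" for e
  proof (cases "A = 0")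
    case True
    then show ?thesis using \<eta>[of 1] that by simp
  next
    case False
    then show ?thesis using \<eta>[of "e / A"] that \<open>A \<ge> 0\<close> by simp
  qed
  then have "x \<le> A * a" by (rule field_le_epsilon)
  then show ?thesis using assms a at by (simp add: distrib_right add_increasing2)
qed

lemma exists_flat:
  assumes "alpha_number d \<sigma> X r < ennreal \<epsilon>" "d > 0"
  obtains \<mu> c P where "flat d \<mu> c P" "dist_measures d X r \<mu> \<sigma> < ennreal \<epsilon>"
proof -
  obtain \<mu> where \<mu>: "\<mu> \<in> flat_measures d" "dist_measures d X r \<mu> \<sigma> < ennreal \<epsilon>"
    using assms unfolding alpha_number_def INF_less_iff by auto

  from \<mu>(1) have "\<exists>c P. flat d \<mu> c P"
    unfolding flat_measures_def
  proof (elim CollectE conjE exE)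
    fix c P assume "sets \<mu> = sets borel" "affine P" "aff_dim P = int d"
      and "\<forall>A\<in>sets borel. emeasure \<mu> A = ennreal c * hausdorff_outer_measure d (A \<inter> P)"
    \<comment> \<open>P is nonempty since its dimension is d, while the empty set has dimension
      -1.\<close>
    then have "flat d \<mu> c P"
      using assms(2) by unfold_locales (auto simp: aff_dim_empty)
    then show ?thesis by blast
  qed
  then show ?thesis using that \<mu> by blast
qed

section \<open>Moments of an Ahlfors regular measure and their deviation from flatness\<close>

locale ahlfors =
  fixes d :: nat and C :: real and \<Gamma> :: "(real ^ 'n) set" and \<sigma> :: "(real ^ 'n) measure"
  assumes d: "d > 0" and reg: "ahlfors_regular d C \<Gamma> \<sigma>" and ne: "\<Gamma> \<noteq> {}"
begin

lemma closed: "closed \<Gamma>" and sets [measurable_cong]: "sets \<sigma> = sets borel"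
  and null: "emeasure \<sigma> (- \<Gamma>) = 0" and C: "C > 0"
  and lower: "x \<in> \<Gamma> \<Longrightarrow> r > 0 \<Longrightarrow> ennreal (r ^ d / C) \<le> emeasure \<sigma> (ball x r)"
  and upper: "x \<in> \<Gamma> \<Longrightarrow> r > 0 \<Longrightarrow> emeasure \<sigma> (ball x r) \<le> ennreal (C * r ^ d)"
  using reg unfolding ahlfors_regular_def by auto

lemma space: "space \<sigma> = UNIV"
  using sets by (metis sets_eq_imp_space_eq space_borel)

lemma AE_support: "AE y in \<sigma>. y \<in> \<Gamma>"
  using null closed by (intro AE_I[of _ _ "- \<Gamma>"]) (auto simp: sets)

lemma nearest: obtains x where "x \<in> \<Gamma>" "dist X x = infdist X \<Gamma>"
  using infdist_attains_inf[OF closed ne] by metis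

lemma infdist_pos: "X \<notin> \<Gamma> \<Longrightarrow> infdist X \<Gamma> > 0"
  using infdist_pos_not_in_closed[OF closed ne] by auto

lemma borel_measurable_continuous: "continuous_on UNIV f \<Longrightarrow> f \<in> borel_measurable \<sigma>"
  by (simp add: measurable_cong_sets[OF sets refl] borel_measurable_continuous_onI)

lemma emeasure_ball_le:
  assumes "infdist X \<Gamma> \<le> s" "s > 0"
  shows "emeasure \<sigma> (ball X (2 * s)) \<le> ennreal (C * (3 * s) ^ d)"
proof -
  obtain x where x: "x \<in> \<Gamma>" "dist X x = infdist X \<Gamma>" by (rule nearest)
  have "ball X (2 * s) \<subseteq> ball x (3 * s)"
  proof
    fix y assume "y \<in> ball X (2 * s)"
    then show "y \<in> ball x (3 * s)"
      using dist_triangle[of x y X] x assms by (simp add: dist_commute)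
  qed
  then have "emeasure \<sigma> (ball X (2 * s)) \<le> emeasure \<sigma> (ball x (3 * s))"
    by (intro emeasure_mono) (auto simp: sets)
  also have "\<dots> \<le> ennreal (C * (3 * s) ^ d)" using x assms by (intro upper) auto
  finally show ?thesis .
qed

lemma integrable_bump:
  fixes \<Phi> :: "real ^ 'n \<Rightarrow> 'b::{banach, second_countable_topology}"
  assumes \<Phi>: "bump L \<Phi>" and s: "s > 0" "infdist X \<Gamma> \<le> s"
  shows "integrable \<sigma> (\<lambda>y. \<Phi> ((1 / s) *\<^sub>R (X - y)))"
    and "(\<integral>y. norm (\<Phi> ((1 / s) *\<^sub>R (X - y))) \<partial>\<sigma>) \<le> L * (C * (3 * s) ^ d)"
proof -
  let ?F = "\<lambda>y. \<Phi> ((1 / s) *\<^sub>R (X - y))"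
  note c = bump_rescaled(1)[OF \<Phi> s(1), of X]
  have fin: "emeasure \<sigma> (ball X (2 * s)) < \<infinity>"
    using emeasure_ball_le[OF s(2,1)] by (auto simp: top_unique less_top intro: le_less_trans)
  show int: "integrable \<sigma> ?F"
    by (rule integrableI_bounded_set[of "ball X (2 * s)" _ _ L])
       (use fin c bump_rescaled(2)[OF \<Phi> s(1)] bumpD(2)[OF \<Phi>] in \<open>auto simp: sets intro!: borel_measurable_continuous\<close>)
  have "(\<integral>y. norm (?F y) \<partial>\<sigma>) \<le> (\<integral>y. L * indicator (ball X (2 * s)) y \<partial>\<sigma>)"
  proof (rule integral_mono)
    show "integrable \<sigma> (\<lambda>y. L * indicator (ball X (2 * s)) y)"
      using fin by (intro integrable_mult_right integrable_real_indicator) (auto simp: sets)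
    show "norm (?F y) \<le> L * indicator (ball X (2 * s)) y" for y
    proof (cases "y \<in> ball X (2 * s)")
      case True
      then show ?thesis using bumpD(2)[OF \<Phi>] by simp
    next
      case False
      then show ?thesis using bump_rescaled(2)[OF \<Phi> s(1) False] by simp
    qed
  qed (use int in simp)
  also have "\<dots> = L * measure \<sigma> (ball X (2 * s))"
    by (simp add: space)
  also have "measure \<sigma> (ball X (2 * s)) \<le> C * (3 * s) ^ d"
    unfolding measure_def using emeasure_ball_le[OF s(2,1)] C s
    by (intro enn2real_leI) auto
  finally show "(\<integral>y. norm (?F y) \<partial>\<sigma>) \<le> L * (C * (3 * s) ^ d)"
    using bumpD(4)[OF \<Phi>] by (simp add: mult_left_mono)
qed

lemma norm_mom_le:
  fixes \<Phi> :: "real ^ 'n \<Rightarrow> 'b::{banach, second_countable_topology}"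
  assumes \<Phi>: "bump L \<Phi>" and s: "s > 0" "infdist X \<Gamma> \<le> s"
  shows "norm (mom d \<sigma> X s \<Phi>) \<le> L * (C * 3 ^ d)"
proof -
  have "norm (mom d \<sigma> X s \<Phi>) \<le> 1 / s ^ d * (\<integral>y. norm (\<Phi> ((1 / s) *\<^sub>R (X - y))) \<partial>\<sigma>)"
    using s by (simp add: mom_def divide_right_mono)
  also have "\<dots> \<le> 1 / s ^ d * (L * (C * (3 * s) ^ d))"
    using integrable_bump(2)[OF \<Phi> s] s by (intro mult_left_mono) auto
  finally show ?thesis using s by (simp add: power_mult_distrib)
qed

text \<open>Let x be a nearest point of \<Gamma>. On \<open>ball x (s / 2)\<close> the rescaled
  argument has norm at most 3/2, so the tent is at least 1/2 there, and lower regularity gives that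
  ball measure at least (s / 2)^d / C.\<close>

lemma mom_tent_ge:
  assumes s: "s > 0" "infdist X \<Gamma> \<le> s"
  shows "mom d \<sigma> X s tent \<ge> 1 / (2 ^ (d + 1) * C)"
proof -
  obtain x where x: "x \<in> \<Gamma>" "dist X x = infdist X \<Gamma>" by (rule nearest)
  let ?F = "\<lambda>y. tent ((1 / s) *\<^sub>R (X - y))"
  have fin: "emeasure \<sigma> (ball x (s / 2)) < \<infinity>"
    using upper[OF x(1), of "s / 2"] s by (auto simp: top_unique less_top intro: le_less_trans)
  have "enn2real (ennreal ((s / 2) ^ d / C)) \<le> enn2real (emeasure \<sigma> (ball x (s / 2)))"
    using lower[OF x(1), of "s / 2"] s fin by (intro enn2real_mono) auto
  then have "(s / 2) ^ d / C \<le> measure \<sigma> (ball x (s / 2))"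
    using s C by (simp add: measure_def)
  then have "1 / 2 * ((s / 2) ^ d / C) \<le> 1 / 2 * measure \<sigma> (ball x (s / 2))" by simp
  also have "\<dots> = (\<integral>y. 1 / 2 * indicator (ball x (s / 2)) y \<partial>\<sigma>)"
    by (simp add: space)
  also have "\<dots> \<le> (\<integral>y. ?F y \<partial>\<sigma>)"
  proof (rule integral_mono)
    show "integrable \<sigma> (\<lambda>y. 1 / 2 * indicator (ball x (s / 2)) y :: real)"
      using fin by (intro integrable_mult_right integrable_real_indicator) (auto simp: sets)
    show "1 / 2 * indicator (ball x (s / 2)) y \<le> ?F y" for y
    proof (cases "y \<in> ball x (s / 2)")
      case True
      have "norm (X - y) \<le> 3 / 2 * s"
        using dist_triangle[of X y x] True x s by (simp add: dist_norm[symmetric])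
      then have "norm (X - y) / s \<le> 3 / 2" using s by (simp add: field_simps)
      then have "norm ((1 / s) *\<^sub>R (X - y)) \<le> 3 / 2" using s by simp
      then have "tent ((1 / s) *\<^sub>R (X - y)) \<ge> 1 / 2" unfolding tent_def by (intro max.coboundedI2) simp
      then show ?thesis using True by simp
    qed (simp add: tent_def)
  qed (rule integrable_bump(1)[OF bump_tent s])
  finally show ?thesis
    using s C by (simp add: mom_def field_simps power_divide)
qed

text \<open>Testing against the unit vector in the direction of the difference reduces to real test
  functions without a factor depending on the dimension.\<close>

lemma mom_diff:
  fixes \<Phi> :: "real ^ 'n \<Rightarrow> 'b::euclidean_space"
  assumes flat: "flat d \<mu> c P" and dist: "dist_measures d X (2 * s) \<mu> \<sigma> < ennreal \<epsilon>"
    and s: "s > 0" "infdist X \<Gamma> \<le> s" and \<Phi>: "bump L \<Phi>"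
  shows "norm (mom d \<sigma> X s \<Phi> - mom d \<mu> X s \<Phi>) \<le> 2 ^ (d + 1) * L * \<epsilon>"
proof (cases "mom d \<sigma> X s \<Phi> = mom d \<mu> X s \<Phi>")
  case True
  have "\<epsilon> > 0" using dist ennreal_neg[of \<epsilon>] by (cases "\<epsilon> > 0") auto
  then show ?thesis using True bumpD(4)[OF \<Phi>] by simp
next
  case False
  let ?D = "mom d \<sigma> X s \<Phi> - mom d \<mu> X s \<Phi>"
  define e where "e = (1 / norm ?D) *\<^sub>R ?D"
  have e: "norm e \<le> 1" "inner ?D e = norm ?D"
    using False by (auto simp: e_def power2_norm_eq_inner[symmetric] power2_eq_square)
  have \<sigma>: "inner (mom d \<sigma> X s \<Phi>) e = mom d \<sigma> X s (\<lambda>z. inner (\<Phi> z) e)"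
    using integrable_bump(1)[OF \<Phi> s] by (simp add: mom_def)
  have "norm ?D = mom d \<sigma> X s (\<lambda>z. inner (\<Phi> z) e) - mom d \<mu> X s (\<lambda>z. inner (\<Phi> z) e)"
    using e(2) flat.mom_inner[OF flat \<Phi> s(1), of X e] \<sigma> by (simp add: inner_diff_left)
  also have "\<dots> \<le> 2 ^ (d + 1) * L * \<epsilon>"
    using mom_diff_real[OF dist s(1) bump_inner[OF \<Phi> e(1)]] by simp
  finally show ?thesis .
qed

text \<open>Common size of the moments of \<sigma>, which are at most L C 3^d, and of a flat measure
  at distance below \<epsilon> \<le> 1, which differ from them by at most 2^(d+1) L.\<close>

definition bnd :: "real \<Rightarrow> real" where
  "bnd L = L * (C * 3 ^ d + 2 ^ (d + 1))"

lemma mom_bnd: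
  fixes \<Phi> :: "real ^ 'n \<Rightarrow> 'b::euclidean_space"
  assumes flat: "flat d \<mu> c P" and dist: "dist_measures d X (2 * s) \<mu> \<sigma> < ennreal \<epsilon>" "\<epsilon> \<le> 1"
    and s: "s > 0" "infdist X \<Gamma> \<le> s" and \<Phi>: "bump L \<Phi>"
  shows "norm (mom d \<mu> X s \<Phi>) \<le> bnd L"
proof -
  have "norm (mom d \<mu> X s \<Phi>) \<le> norm (mom d \<sigma> X s \<Phi>) + norm (mom d \<sigma> X s \<Phi> - mom d \<mu> X s \<Phi>)"
    using norm_triangle_ineq4[of "mom d \<sigma> X s \<Phi>" "mom d \<sigma> X s \<Phi> - mom d \<mu> X s \<Phi>"] by simp
  also have "\<dots> \<le> L * (C * 3 ^ d) + 2 ^ (d + 1) * L * \<epsilon>"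
    by (intro add_mono norm_mom_le[OF \<Phi> s] mom_diff[OF flat dist(1) s \<Phi>])
  also have "\<dots> \<le> L * (C * 3 ^ d) + 2 ^ (d + 1) * L * 1"
    using bumpD(4)[OF \<Phi>] dist(2) by (intro add_left_mono mult_left_mono) auto
  finally show ?thesis by (simp add: bnd_def algebra_simps)
qed

lemma mom_bnd':
  fixes \<Phi> :: "real ^ 'n \<Rightarrow> 'b::euclidean_space"
  assumes \<Phi>: "bump L \<Phi>" and s: "s > 0" "infdist X \<Gamma> \<le> s"
  shows "norm (mom d \<sigma> X s \<Phi>) \<le> bnd L"
proof -
  have "norm (mom d \<sigma> X s \<Phi>) \<le> L * (C * 3 ^ d)" by (rule norm_mom_le[OF \<Phi> s])
  then show ?thesis using bumpD(4)[OF \<Phi>] by (simp add: bnd_def distrib_left add_increasing2)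
qed

text \<open>The first summand is \<open>bilinear_defect\<close> with \<eta> = 2^(d+1) L \<epsilon>;
  the second is the trivial bound for an \<alpha>-number at least 1. \<open>dilation_const\<close>
  is built in the same way.\<close>

definition axis_const :: "real \<Rightarrow> real" where
  "axis_const L = 4 * bnd L * (2 ^ (d + 1) * L) + 2 * (bnd L)\<^sup>2"

text \<open>For a flat measure both vector moments are their scalar moments times the same vector (X
  - foot X) / s, so the cross difference vanishes. L' is a bump constant common to the four test
  functions; 6 = 3 * 2 comes from \<open>tent z *\<^sub>R z\<close>.\<close>

lemma axis_defect:
  fixes g :: "real \<Rightarrow> real"
  assumes g: "continuous_on UNIV g" "\<And>t. t \<ge> 2 \<Longrightarrow> g t = 0"
    and L: "bump L (\<lambda>z::real ^ 'n. g (norm z))" "L' \<ge> 3 * L" "L' \<ge> 6"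
    and s: "s > 0" "infdist X \<Gamma> \<le> s"
  shows "norm (mom d \<sigma> X s tent *\<^sub>R mom d \<sigma> X s (\<lambda>z. g (norm z) *\<^sub>R z)
      - mom d \<sigma> X s (\<lambda>z. g (norm z)) *\<^sub>R mom d \<sigma> X s (\<lambda>z. tent z *\<^sub>R z)) \<le> axis_const L' * alpha_trunc d \<sigma> X s"
  unfolding axis_const_def
proof (rule le_alpha_truncI)
  have L0: "L \<ge> 0" using bumpD(4)[OF L(1)] .
  have b0: "bump L' (tent :: real ^ 'n \<Rightarrow> real)" and b1: "bump L' (\<lambda>z::real ^ 'n. tent z *\<^sub>R z)"
    and m0: "bump L' (\<lambda>z::real ^ 'n. g (norm z))" and m1: "bump L' (\<lambda>z::real ^ 'n. g (norm z) *\<^sub>R z)"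
    using L L0 bump_scaleR_id[OF bump_tent, where 'a = "real ^ 'n"] bump_scaleR_id[OF L(1)]
    by (auto intro: bump_mono[OF bump_tent] bump_mono)
  note bs = mom_bnd'[OF b0 s] mom_bnd'[OF b1 s] mom_bnd'[OF m0 s] mom_bnd'[OF m1 s]
  show bnd0: "4 * bnd L' * (2 ^ (d + 1) * L') \<ge> 0"
    using L C by (auto simp: bnd_def)
  show "2 * (bnd L')\<^sup>2 \<ge> 0" by simp
  have N: "bnd L' \<ge> 0" using L C by (auto simp: bnd_def)
  let ?v = "mom d \<sigma> X s tent *\<^sub>R mom d \<sigma> X s (\<lambda>z. g (norm z) *\<^sub>R z)
      - mom d \<sigma> X s (\<lambda>z. g (norm z)) *\<^sub>R mom d \<sigma> X s (\<lambda>z. tent z *\<^sub>R z)"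
  show "norm ?v \<le> 2 * (bnd L')\<^sup>2"
  proof -
    have "norm ?v \<le> norm (mom d \<sigma> X s tent) * norm (mom d \<sigma> X s (\<lambda>z. g (norm z) *\<^sub>R z))
      + norm (mom d \<sigma> X s (\<lambda>z. g (norm z))) * norm (mom d \<sigma> X s (\<lambda>z. tent z *\<^sub>R z))"
      by (rule order_trans[OF norm_triangle_ineq4]) simp
    also have "\<dots> \<le> bnd L' * bnd L' + bnd L' * bnd L'"
      using bs N by (intro add_mono mult_mono) auto
    finally show ?thesis by (simp add: power2_eq_square)
  qed
  fix \<epsilon> assume \<epsilon>: "alpha_number d \<sigma> X (2 * s) < ennreal \<epsilon>" "0 < \<epsilon>" "\<epsilon> \<le> 1"
  obtain \<mu> c P where flat: "flat d \<mu> c P" and dist: "dist_measures d X (2 * s) \<mu> \<sigma> < ennreal \<epsilon>"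
    by (rule exists_flat[OF \<epsilon>(1) d])
  note df = mom_diff[OF flat dist s b0] mom_diff[OF flat dist s b1] mom_diff[OF flat dist s m0] mom_diff[OF flat dist s m1]
  note bm = mom_bnd[OF flat dist \<epsilon>(3) s b0] mom_bnd[OF flat dist \<epsilon>(3) s m0]
  have tent: "(tent :: real ^ 'n \<Rightarrow> real) = (\<lambda>z. (\<lambda>t. max 0 (2 - t)) (norm z))" by (auto simp: tent_def)
  have t: "mom d \<mu> X s (\<lambda>z. tent z *\<^sub>R z) = mom d \<mu> X s tent *\<^sub>R ((1 / s) *\<^sub>R (X - flat.foot P X))"
    unfolding tent by (rule flat.mom_axis[OF flat _ _ s(1)]) (auto intro!: continuous_intros)
  have "norm ?v \<le> 4 * bnd L' * (2 ^ (d + 1) * L' * \<epsilon>)"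
  proof (rule bilinear_defect)
    show "mom d \<mu> X s tent *\<^sub>R mom d \<mu> X s (\<lambda>z. g (norm z) *\<^sub>R z)
      = mom d \<mu> X s (\<lambda>z. g (norm z)) *\<^sub>R mom d \<mu> X s (\<lambda>z. tent z *\<^sub>R z)"
    proof -
      have "mom d \<mu> X s (\<lambda>z. g (norm z) *\<^sub>R z) = mom d \<mu> X s (\<lambda>z. g (norm z)) *\<^sub>R ((1 / s) *\<^sub>R (X - flat.foot P X))"
        by (rule flat.mom_axis[OF flat g s(1)])
      then show ?thesis unfolding t by (simp add: mult_ac)
    qed
  qed (use df bm bs in simp_all)
  then show "norm ?v \<le> 4 * bnd L' * (2 ^ (d + 1) * L') * \<epsilon>" by (simp add: mult_ac)
qed

definition dilation_const :: "real \<Rightarrow> real" where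
  "dilation_const L = 3 * (bnd L)\<^sup>2 * (d + 4) * (2 ^ (d + 1) * L) + (d + 4) * (bnd L)^3"

text \<open>This is \<open>mom_dilation\<close> multiplied by the squared moment of the tent, which
  turns the squared distance to the plane into the squared vector moment. Among the test functions
  \<open>(norm z)\<^sup>2 * kern q ((norm z)\<^sup>2)\<close> has the largest constant, 9 * 4 (q +
  1); the 6 serves the vector tent.\<close>

lemma dilation_defect:
  assumes q: "q > 0" and L: "L \<ge> 36 * (q + 1) + 6" and s: "s > 0" "infdist X \<Gamma> \<le> s"
  shows "\<bar>(real d * mom d \<sigma> X s (\<lambda>z. kern_int q ((norm z)\<^sup>2))
       - 2 * mom d \<sigma> X s (\<lambda>z. (norm z)\<^sup>2 * kern q ((norm z)\<^sup>2))) * (mom d \<sigma> X s tent)\<^sup>2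
      + 2 * mom d \<sigma> X s (\<lambda>z. kern q ((norm z)\<^sup>2))
        * inner (mom d \<sigma> X s (\<lambda>z. tent z *\<^sub>R z)) (mom d \<sigma> X s (\<lambda>z. tent z *\<^sub>R z))\<bar>
    \<le> dilation_const L * alpha_trunc d \<sigma> X s"
  unfolding dilation_const_def
proof (rule le_alpha_truncI)
  have b0: "bump L (tent :: real ^ 'n \<Rightarrow> real)" and b1: "bump L (\<lambda>z::real ^ 'n. tent z *\<^sub>R z)"
    and k: "bump L (\<lambda>z::real ^ 'n. kern q ((norm z)\<^sup>2))"
    and t: "bump L (\<lambda>z::real ^ 'n. (norm z)\<^sup>2 * kern q ((norm z)\<^sup>2))"
    and e: "bump L (\<lambda>z::real ^ 'n. kern_int q ((norm z)\<^sup>2))"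
    using L q bump_scaleR_id[OF bump_tent, where 'a = "real ^ 'n"]
    by (auto intro: bump_mono[OF bump_tent] bump_mono[OF bump_kern] bump_mono[OF bump_kern_int]
        bump_mono[OF bump_norm_power2[OF bump_kern]] bump_mono)
  note bs = mom_bnd'[OF b0 s] mom_bnd'[OF b1 s] mom_bnd'[OF k s] mom_bnd'[OF t s] mom_bnd'[OF e s]
  have L0: "L \<ge> 0" using L q by simp
  then have N: "bnd L \<ge> 0" using C by (auto simp: bnd_def)
  show "3 * (bnd L)\<^sup>2 * (d + 4) * (2 ^ (d + 1) * L) \<ge> 0" "(d + 4) * (bnd L) ^ 3 \<ge> 0"
    using L0 N by auto
  let ?b0 = "mom d \<sigma> X s tent" and ?b1 = "mom d \<sigma> X s (\<lambda>z. tent z *\<^sub>R z)"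
  let ?k = "mom d \<sigma> X s (\<lambda>z. kern q ((norm z)\<^sup>2))"
  let ?t = "mom d \<sigma> X s (\<lambda>z. (norm z)\<^sup>2 * kern q ((norm z)\<^sup>2))"
  let ?e = "mom d \<sigma> X s (\<lambda>z. kern_int q ((norm z)\<^sup>2))"
  let ?x = "(real d * ?e - 2 * ?t) * ?b0\<^sup>2 + 2 * ?k * inner ?b1 ?b1"
  show "\<bar>?x\<bar> \<le> (d + 4) * (bnd L) ^ 3"
  proof -
    have sq: "?b0\<^sup>2 \<le> (bnd L)\<^sup>2" "inner ?b1 ?b1 \<le> (bnd L)\<^sup>2"
      using bs N power_mono[of "norm ?b1" "bnd L" 2] power_mono[of "norm ?b0" "bnd L" 2]
      by (auto simp: power2_norm_eq_inner)
    have "\<bar>?x\<bar> \<le> (real d * \<bar>?e\<bar> + 2 * \<bar>?t\<bar>) * ?b0\<^sup>2 + 2 * \<bar>?k\<bar> * inner ?b1 ?b1"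
    proof -
      have "\<bar>?x\<bar> \<le> \<bar>real d * ?e - 2 * ?t\<bar> * ?b0\<^sup>2 + 2 * \<bar>?k\<bar> * inner ?b1 ?b1"
        by (rule order_trans[OF abs_triangle_ineq]) (simp add: abs_mult)
      also have "\<bar>real d * ?e - 2 * ?t\<bar> \<le> real d * \<bar>?e\<bar> + 2 * \<bar>?t\<bar>"
        by (rule order_trans[OF abs_triangle_ineq4]) (simp add: abs_mult)
      finally show ?thesis by (simp add: mult_right_mono)
    qed
    also have "\<dots> \<le> (real d * bnd L + 2 * bnd L) * (bnd L)\<^sup>2 + 2 * bnd L * (bnd L)\<^sup>2"
      using bs sq N by (intro add_mono mult_mono mult_left_mono) auto
    finally show ?thesis by (simp add: algebra_simps power3_eq_cube power2_eq_square)
  qed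
  fix \<epsilon> assume \<epsilon>: "alpha_number d \<sigma> X (2 * s) < ennreal \<epsilon>" "0 < \<epsilon>" "\<epsilon> \<le> 1"
  obtain \<mu> c P where flat: "flat d \<mu> c P" and dist: "dist_measures d X (2 * s) \<mu> \<sigma> < ennreal \<epsilon>"
    by (rule exists_flat[OF \<epsilon>(1) d])
  note df = mom_diff[OF flat dist s b0] mom_diff[OF flat dist s b1] mom_diff[OF flat dist s k]
    mom_diff[OF flat dist s t] mom_diff[OF flat dist s e]
  note bm = mom_bnd[OF flat dist \<epsilon>(3) s b0] mom_bnd[OF flat dist \<epsilon>(3) s b1] mom_bnd[OF flat dist \<epsilon>(3) s k]
    mom_bnd[OF flat dist \<epsilon>(3) s t] mom_bnd[OF flat dist \<epsilon>(3) s e]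
  have tent: "(tent :: real ^ 'n \<Rightarrow> real) = (\<lambda>z. (\<lambda>t. max 0 (2 - t)) (norm z))" by (auto simp: tent_def)
  let ?w = "(1 / s) *\<^sub>R (X - flat.foot P X)"
  have tw: "mom d \<mu> X s (\<lambda>z. tent z *\<^sub>R z) = mom d \<mu> X s tent *\<^sub>R ?w"
    unfolding tent by (rule flat.mom_axis[OF flat _ _ s(1)]) (auto intro!: continuous_intros)
  have "(real d * mom d \<mu> X s (\<lambda>z. kern_int q ((norm z)\<^sup>2))
       - 2 * mom d \<mu> X s (\<lambda>z. (norm z)\<^sup>2 * kern q ((norm z)\<^sup>2))) * (mom d \<mu> X s tent)\<^sup>2
      + 2 * mom d \<mu> X s (\<lambda>z. kern q ((norm z)\<^sup>2))
        * inner (mom d \<mu> X s (\<lambda>z. tent z *\<^sub>R z)) (mom d \<mu> X s (\<lambda>z. tent z *\<^sub>R z)) = 0"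
  proof -
      have "inner (mom d \<mu> X s tent *\<^sub>R ?w) (mom d \<mu> X s tent *\<^sub>R ?w) = (norm ?w)\<^sup>2 * (mom d \<mu> X s tent)\<^sup>2"
        by (simp only: inner_scaleR_left inner_scaleR_right power2_norm_eq_inner) (simp add: power2_eq_square)
      then show ?thesis
        unfolding tw flat.mom_dilation[OF flat q s(1)] by (simp add: algebra_simps)
  qed
  note trilinear_defect[OF df(5,4,3,1)[unfolded real_norm_def] df(2) bm(5,4,3,1)[unfolded real_norm_def] bm(2)
      bs(1)[unfolded real_norm_def] bs(2) of_nat_0_le_iff this]
  then show "\<bar>?x\<bar> \<le> 3 * (bnd L)\<^sup>2 * (d + 4) * (2 ^ (d + 1) * L) * \<epsilon>" by (simp add: mult_ac)
qed

end

section \<open>Summation over the scales\<close>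

text \<open>Error accumulated up to scale \<open>j\<close> by comparing the directions at consecutive scales.\<close>

definition smear :: "(nat \<Rightarrow> real) \<Rightarrow> nat \<Rightarrow> real" where
  "smear a j = (\<Sum>i\<le>j. (1 / 2) ^ (j - i) * a i)"

lemma smear_0: "smear a 0 = a 0"
  by (simp add: smear_def)

lemma smear_Suc: "smear a (Suc j) = a (Suc j) + smear a j / 2"
proof -
  have "(\<Sum>i\<le>j. (1 / 2) ^ (Suc j - i) * a i) = (\<Sum>i\<le>j. (1 / 2) ^ (j - i) * a i / 2)"
    by (intro sum.cong) (auto simp: Suc_diff_le)
  then show ?thesis by (simp add: smear_def sum_divide_distrib)
qed

lemma smear_bounds:
  assumes "\<And>i. 0 \<le> a i" "\<And>i. a i \<le> 1"
  shows "a j \<le> smear a j" "0 \<le> smear a j" "smear a j \<le> 2"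
proof -
  show 0: "0 \<le> smear a j" for j
    using assms by (induction j) (auto simp: smear_0 smear_Suc)
  show "a j \<le> smear a j"
    using 0[of "j - 1"] by (cases j) (auto simp: smear_0 smear_Suc)
  show "smear a j \<le> 2"
  proof (induction j)
    case (Suc j)
    then show ?case using assms(2)[of "Suc j"] by (simp add: smear_Suc)
  qed (use assms(2)[of 0] in \<open>simp add: smear_0\<close>)
qed

section \<open>Riesz potentials as sums of moments over dyadic scales\<close>

context ahlfors
begin

definition riesz :: "real \<Rightarrow> real ^ 'n \<Rightarrow> real" where
  "riesz p X = (\<integral>y. norm (X - y) powr (- real d - p) \<partial>\<sigma>)"

text \<open>Up to the factor -(d + p) this is the gradient of \<open>riesz p\<close>.\<close>

definition riesz_vec :: "real \<Rightarrow> real ^ 'n \<Rightarrow> real ^ 'n" where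
  "riesz_vec p X = (\<integral>y. (norm (X - y) powr (- real d - p - 2)) *\<^sub>R (X - y) \<partial>\<sigma>)"

definition scale :: "real ^ 'n \<Rightarrow> nat \<Rightarrow> real" where
  "scale X j = 2 ^ j * infdist X \<Gamma>"

lemma scale:
  assumes "X \<notin> \<Gamma>"
  shows "scale X j > 0" "infdist X \<Gamma> \<le> scale X j"
  using infdist_pos[OF assms] by (auto simp: scale_def mult_le_cancel_right1)

lemma scale_powr: "scale X j powr e = infdist X \<Gamma> powr e * (2 powr e) ^ j"
proof -
  have "((2::real) ^ j) powr e = (2 powr e) ^ j"
    by (simp add: powr_realpow[symmetric] powr_powr mult.commute)
  then show ?thesis by (simp add: scale_def powr_mult infdist_nonneg mult.commute)
qed

lemma summable_scale:
  assumes "e > 0" "\<And>j. \<bar>c j\<bar> \<le> B"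
  shows "summable (\<lambda>j. scale X j powr (- e) * c j)" "summable (\<lambda>j. (2 powr (- e)) ^ j * c j)"
proof -
  have "norm (2 powr (- e) :: real) < 1" using assms(1) by (simp add: powr_less_one)
  then have g: "summable (\<lambda>j. (2 powr (- e)) ^ j * B)"
    by (intro summable_mult2 summable_geometric)
  show 2: "summable (\<lambda>j. (2 powr (- e)) ^ j * c j)"
    by (rule summable_comparison_test'[OF g, of 0]) (simp add: abs_mult mult_left_mono assms(2))
  show "summable (\<lambda>j. scale X j powr (- e) * c j)"
    using summable_mult[OF 2, of "infdist X \<Gamma> powr (- e)"] by (simp add: scale_powr mult.assoc)
qed

text \<open>Sum and integral may be exchanged: the j-th term is supported in a ball of
  \<sigma>-measure at most C (3 scale)^d, so its L1 norm is of order scale^(-e), which is geometric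
  in j. Knowing F on \<Gamma> is enough because \<sigma> lives there.\<close>

lemma sums_mom:
  fixes \<Phi> :: "real ^ 'n \<Rightarrow> 'b::euclidean_space"
  assumes X: "X \<notin> \<Gamma>" and \<Phi>: "bump L \<Phi>" and e: "e > 0"
    and F: "\<And>y. y \<in> \<Gamma> \<Longrightarrow> (\<lambda>j. scale X j powr (- real d - e) *\<^sub>R \<Phi> ((1 / scale X j) *\<^sub>R (X - y))) sums F y"
    and [measurable]: "F \<in> borel_measurable borel"
  shows "integrable \<sigma> F" "(\<lambda>j. scale X j powr (- e) *\<^sub>R mom d \<sigma> X (scale X j) \<Phi>) sums (\<integral>y. F y \<partial>\<sigma>)"
proof -
  let ?f = "\<lambda>j y. scale X j powr (- real d - e) *\<^sub>R \<Phi> ((1 / scale X j) *\<^sub>R (X - y))"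
  note s = scale[OF X]
  have L: "L \<ge> 0" by (rule bumpD(4)[OF \<Phi>])
  have sp: "scale X j powr (- real d - e) * scale X j ^ d = scale X j powr (- e)" for j
    using s(1)[of j] by (simp add: powr_realpow[symmetric] powr_add[symmetric])
  have int: "integrable \<sigma> (?f j)" for j
    using integrable_bump(1)[OF \<Phi> s] by simp
  have sm: "AE y in \<sigma>. summable (\<lambda>j. norm (?f j y))"
  proof (rule AE_I2)
    fix y
    show "summable (\<lambda>j. norm (?f j y))"
    proof (rule summable_comparison_test'[OF summable_scale(1)[of "real d + e" "\<lambda>_. L" L X], of 0])
      show "norm (norm (?f j y)) \<le> scale X j powr - (real d + e) * L" for j
        using bumpD(2)[OF \<Phi>] by (simp add: mult_left_mono)
    qed (use e L in auto)
  qed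
  have si: "summable (\<lambda>j. \<integral>y. norm (?f j y) \<partial>\<sigma>)"
  proof (rule summable_comparison_test'[OF summable_scale(1)[of e "\<lambda>_. L * (C * 3 ^ d)" "L * (C * 3 ^ d)" X], of 0])
    fix j
    have "(\<integral>y. norm (?f j y) \<partial>\<sigma>) = scale X j powr (- real d - e) * (\<integral>y. norm (\<Phi> ((1 / scale X j) *\<^sub>R (X - y))) \<partial>\<sigma>)"
      by simp
    also have "\<dots> \<le> scale X j powr (- real d - e) * (L * (C * (3 * scale X j) ^ d))"
      by (intro mult_left_mono integrable_bump(2)[OF \<Phi> s]) auto
    also have "\<dots> = scale X j powr (- e) * (L * (C * 3 ^ d))"
      unfolding sp[symmetric] by (simp add: power_mult_distrib)
    finally show "norm (\<integral>y. norm (?f j y) \<partial>\<sigma>) \<le> scale X j powr (- e) * (L * (C * 3 ^ d))"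
      by simp
  qed (use e L C in auto)
  have eq: "AE y in \<sigma>. (\<Sum>j. ?f j y) = F y"
    using AE_support by eventually_elim (rule sums_unique[OF F, symmetric])
  have m: "F \<in> borel_measurable \<sigma>" by (simp add: measurable_cong_sets[OF sets refl])
  have i: "integrable \<sigma> (\<lambda>y. \<Sum>j. ?f j y)" by (rule integrable_suminf[OF int sm si])
  show "integrable \<sigma> F"
    by (rule integrable_cong_AE_imp[OF i m eq])
  have "(\<lambda>j. \<integral>y. ?f j y \<partial>\<sigma>) sums (\<integral>y. (\<Sum>j. ?f j y) \<partial>\<sigma>)" by (rule sums_integral[OF int sm si])
  moreover have "(\<integral>y. (\<Sum>j. ?f j y) \<partial>\<sigma>) = (\<integral>y. F y \<partial>\<sigma>)"
    using i eq m by (intro integral_cong_AE) auto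
  moreover have "(\<integral>y. ?f j y \<partial>\<sigma>) = scale X j powr (- e) *\<^sub>R mom d \<sigma> X (scale X j) \<Phi>" for j
    unfolding sp[symmetric] using s(1)[of j] by (simp add: mom_def)
  ultimately show "(\<lambda>j. scale X j powr (- e) *\<^sub>R mom d \<sigma> X (scale X j) \<Phi>) sums (\<integral>y. F y \<partial>\<sigma>)" by simp
qed

lemma powr_square: "x \<ge> 0 \<Longrightarrow> (x\<^sup>2) powr e = x powr (2 * e)" for x :: real
  using powr_powr[of x 2 e] by simp

lemma norm_ge_infdist: "y \<in> \<Gamma> \<Longrightarrow> infdist X \<Gamma> \<le> norm (X - y)"
  using infdist_le[of y \<Gamma> X] by (simp add: dist_norm)

text \<open>q is half of d + p because the kernels take squared distances. The condition \<delta>^2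
  \<le> u of the telescoping sums says that no point of \<Gamma> is closer to X than
  \<delta>.\<close>

lemma sums_kern_scale:
  assumes X: "X \<notin> \<Gamma>" and p: "p > 0" and y: "y \<in> \<Gamma>" and q: "q = (real d + p) / 2"
  shows "(\<lambda>j. scale X j powr (- real d - p - 2) * kern q ((norm ((1 / scale X j) *\<^sub>R (X - y)))\<^sup>2))
      sums (norm (X - y) powr (- real d - p - 2))"
    and "(\<lambda>j. scale X j powr (- real d - p) * kern_int q ((norm ((1 / scale X j) *\<^sub>R (X - y)))\<^sup>2))
      sums (norm (X - y) powr (- real d - p) / q)"
proof -
  have q0: "q > 0" using p q by simp
  have e: "2 * (- q - 1) = - real d - p - 2" "2 * - q = - real d - p" using q by (simp_all add: field_simps)
  have \<delta>: "infdist X \<Gamma> > 0" "(infdist X \<Gamma>)\<^sup>2 \<le> (norm (X - y))\<^sup>2"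
    using infdist_pos[OF X] norm_ge_infdist[OF y, of X] by (auto intro: power_mono)
  have n: "(norm ((1 / s) *\<^sub>R v))\<^sup>2 = (norm v)\<^sup>2 / s\<^sup>2" for v :: "real ^ 'n" and s
    by (simp add: power_divide)
  have s0: "0 \<le> scale X j" for j by (rule less_imp_le[OF scale(1)[OF X]])
  show "(\<lambda>j. scale X j powr (- real d - p - 2) * kern q ((norm ((1 / scale X j) *\<^sub>R (X - y)))\<^sup>2))
      sums (norm (X - y) powr (- real d - p - 2))"
    using sums_kern[OF q0 \<delta>] unfolding n scale_def[symmetric] powr_square[OF s0] powr_square[OF norm_ge_zero] e .
  show "(\<lambda>j. scale X j powr (- real d - p) * kern_int q ((norm ((1 / scale X j) *\<^sub>R (X - y)))\<^sup>2))
      sums (norm (X - y) powr (- real d - p) / q)"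
    using sums_kern_int[OF q0 \<delta>] unfolding n scale_def[symmetric] powr_square[OF s0] powr_square[OF norm_ge_zero] e .
qed

context
  fixes X :: "real ^ 'n" and p q :: real
  assumes X: "X \<notin> \<Gamma>" and p: "p > 0" and q: "q = (real d + p) / 2"
begin

lemma q_pos: "q > 0"
  using p q by simp

lemma riesz_series_kern:
  "integrable \<sigma> (\<lambda>y. norm (X - y) powr (- real d - (p + 2)))"
  "(\<lambda>j. scale X j powr (- (p + 2)) * mom d \<sigma> X (scale X j) (\<lambda>z. kern q ((norm z)\<^sup>2))) sums riesz (p + 2) X"
proof -
  have e: "- real d - (p + 2) = - real d - p - 2" by simp
  note sums_mom[OF X bump_kern[OF q_pos], of "p + 2" "\<lambda>y. norm (X - y) powr (- real d - (p + 2))"]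
  from this[unfolded real_scaleR_def e, OF _ sums_kern_scale(1)[OF X p _ q]] p
  show "integrable \<sigma> (\<lambda>y. norm (X - y) powr (- real d - (p + 2)))"
  "(\<lambda>j. scale X j powr (- (p + 2)) * mom d \<sigma> X (scale X j) (\<lambda>z. kern q ((norm z)\<^sup>2))) sums riesz (p + 2) X"
    unfolding riesz_def e by auto
qed

lemma riesz_vec_series:
  "integrable \<sigma> (\<lambda>y. (norm (X - y) powr (- real d - p - 2)) *\<^sub>R (X - y))"
  "(\<lambda>j. scale X j powr (- (p + 1)) *\<^sub>R mom d \<sigma> X (scale X j) (\<lambda>z. kern q ((norm z)\<^sup>2) *\<^sub>R z)) sums riesz_vec p X"
proof -
  have "(\<lambda>j. scale X j powr (- real d - (p + 1)) *\<^sub>R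
        (kern q ((norm ((1 / scale X j) *\<^sub>R (X - y)))\<^sup>2) *\<^sub>R ((1 / scale X j) *\<^sub>R (X - y))))
      sums ((norm (X - y) powr (- real d - p - 2)) *\<^sub>R (X - y))" if y: "y \<in> \<Gamma>" for y
  proof -
    have "scale X j powr (- real d - (p + 1)) * (1 / scale X j) = scale X j powr (- real d - p - 2)" for j
      using scale(1)[OF X, of j] powr_diff[of "scale X j" "- real d - (p + 1)" 1] by (simp add: algebra_simps)
    then have eq: "scale X j powr (- real d - (p + 1)) *\<^sub>R (k *\<^sub>R ((1 / scale X j) *\<^sub>R v))
       = (scale X j powr (- real d - p - 2) * k) *\<^sub>R v" for j k and v :: "real ^ 'n"
      by (metis (no_types) mult.commute mult.assoc scaleR_scaleR)
    show ?thesis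
      unfolding eq by (rule sums_scaleR_left[OF sums_kern_scale(1)[OF X p y q]])
  qed
  from sums_mom[OF X bump_scaleR_id[OF bump_kern[OF q_pos]] _ this] p
  show "integrable \<sigma> (\<lambda>y. (norm (X - y) powr (- real d - p - 2)) *\<^sub>R (X - y))"
    "(\<lambda>j. scale X j powr (- (p + 1)) *\<^sub>R mom d \<sigma> X (scale X j) (\<lambda>z. kern q ((norm z)\<^sup>2) *\<^sub>R z)) sums riesz_vec p X"
    unfolding riesz_vec_def by auto
qed

lemma riesz_series_norm_kern:
  "integrable \<sigma> (\<lambda>y. norm (X - y) powr (- real d - p))"
  "(\<lambda>j. scale X j powr (- p) * mom d \<sigma> X (scale X j) (\<lambda>z. (norm z)\<^sup>2 * kern q ((norm z)\<^sup>2))) sums riesz p X"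
proof -
  have pw: "t powr (- real d - p) * (1 / t)\<^sup>2 = t powr (- real d - p - 2)" if "t > 0" for t :: real
    using that powr_diff[of t "- real d - p" 2] by (simp add: power_divide)
  have "(\<lambda>j. scale X j powr (- real d - p) *\<^sub>R
        ((norm ((1 / scale X j) *\<^sub>R (X - y)))\<^sup>2 * kern q ((norm ((1 / scale X j) *\<^sub>R (X - y)))\<^sup>2)))
      sums (norm (X - y) powr (- real d - p))" if y: "y \<in> \<Gamma>" for y
  proof -
    have n: "norm (X - y) > 0" using norm_ge_infdist[OF y, of X] infdist_pos[OF X] by linarith
    have 1: "scale X j powr (- real d - p) *\<^sub>R ((norm ((1 / scale X j) *\<^sub>R (X - y)))\<^sup>2 * k)
      = (norm (X - y))\<^sup>2 * (scale X j powr (- real d - p - 2) * k)" for j k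
      unfolding pw[OF scale(1)[OF X], symmetric] by (simp add: power_mult_distrib power_divide)
    have 2: "norm (X - y) powr (- real d - p) = (norm (X - y))\<^sup>2 * norm (X - y) powr (- real d - p - 2)"
      using pw[OF n] n by (simp add: field_simps)
    show ?thesis unfolding 1 2
      by (intro sums_mult sums_kern_scale(1)[OF X p y q])
  qed
  from sums_mom[OF X bump_norm_power2[OF bump_kern[OF q_pos]] p this]
  show "integrable \<sigma> (\<lambda>y. norm (X - y) powr (- real d - p))"
    "(\<lambda>j. scale X j powr (- p) * mom d \<sigma> X (scale X j) (\<lambda>z. (norm z)\<^sup>2 * kern q ((norm z)\<^sup>2))) sums riesz p X"
    unfolding riesz_def by auto
qed

text \<open>A second expansion of \<open>riesz p\<close>, besides
  \<open>riesz_series_norm_kern\<close>. With both, the dilation identity of the moments becomes a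
  relation between \<open>riesz p\<close> and \<open>riesz (p + 2)\<close> alone.\<close>

lemma riesz_series_kern_int:
  "(\<lambda>j. scale X j powr (- p) * mom d \<sigma> X (scale X j) (\<lambda>z. kern_int q ((norm z)\<^sup>2))) sums (riesz p X / q)"
proof -
  note sums_mom(2)[OF X bump_kern_int[OF q_pos] p, of "\<lambda>y. norm (X - y) powr (- real d - p) / q"]
  from this[unfolded real_scaleR_def, OF sums_kern_scale(2)[OF X p _ q]]
  show ?thesis unfolding riesz_def by simp
qed

end

end

lemma norm_sums_le:
  fixes f :: "nat \<Rightarrow> 'a::banach"
  assumes "f sums S" "\<And>j. norm (f j) \<le> g j" "summable g"
  shows "norm S \<le> suminf g"
  using assms norm_suminf_le[of f g] by (simp add: sums_iff)

text \<open>A moment at scale s is a moment at scale 2s of a contracted test function, so moments at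
  consecutive scales can be tested against one flat measure.\<close>

lemma mom_double:
  assumes "s > 0"
  shows "mom d M X (2 * s) (\<lambda>z. \<Phi> (2 *\<^sub>R z)) = (1 / 2 ^ d) *\<^sub>R mom d M X s \<Phi>"
proof -
  have "2 *\<^sub>R ((1 / (2 * s)) *\<^sub>R v) = (1 / s) *\<^sub>R v" for v :: "real ^ 'n" by simp
  then show ?thesis by (simp only: mom_def) (simp add: power_mult_distrib)
qed

section \<open>Comparison of the directions across scales\<close>

context ahlfors
begin

definition inv_c :: real where
  "inv_c = 2 ^ (d + 1) * C"

definition slope_bd :: real where
  "slope_bd = bnd 6 * inv_c"

text \<open>The contracted tent has bump constant 4, and multiplication by z triples it to 12; 2^d
  is the factor in \<open>mom_double\<close>.\<close>

definition drift :: real where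
  "drift = 2 ^ d * axis_const 12 * inv_c\<^sup>2"

text \<open>The threshold of \<open>dilation_defect\<close> at q = (d + p) / 2, so that one constant
  serves all test functions for the exponent p.\<close>

definition lip_bd :: "real \<Rightarrow> real" where
  "lip_bd p = 36 * ((real d + p) / 2 + 1) + 6"

definition vec_err :: "real \<Rightarrow> real" where
  "vec_err p = axis_const (lip_bd p) * inv_c + bnd (lip_bd p) * drift"

definition scal_err :: "real \<Rightarrow> real" where
  "scal_err p = dilation_const (lip_bd p) * inv_c\<^sup>2 / 2 + bnd (lip_bd p) * (drift * (2 * slope_bd))"

definition up_c :: "real \<Rightarrow> real" where
  "up_c p = bnd (lip_bd p) / (1 - 2 powr (- p))"

definition low_c :: "real \<Rightarrow> real" where
  "low_c p = 2 powr (- real d - p) / (2 * inv_c)"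

text \<open>For a flat measure with nonzero tent moment this is (X - foot X) / scale X j, which
  halves from one scale to the next; \<delta> times \<open>slope X 0\<close> takes the place of the
  vector v from X to the plane.\<close>

definition slope :: "real ^ 'n \<Rightarrow> nat \<Rightarrow> real ^ 'n" where
  "slope X j = (1 / mom d \<sigma> X (scale X j) tent) *\<^sub>R mom d \<sigma> X (scale X j) (\<lambda>z. tent z *\<^sub>R z)"

definition alphas :: "real ^ 'n \<Rightarrow> nat \<Rightarrow> real" where
  "alphas X j = alpha_trunc d \<sigma> X (scale X j)"

definition alpha_sum :: "real \<Rightarrow> real ^ 'n \<Rightarrow> real" where
  "alpha_sum p X = (\<Sum>j. (2 powr (- p)) ^ j * smear (alphas X) j)"

lemma const_pos: "inv_c > 0" "L \<ge> 0 \<Longrightarrow> bnd L \<ge> 0" "L \<ge> 0 \<Longrightarrow> axis_const L \<ge> 0" "L \<ge> 0 \<Longrightarrow> dilation_const L \<ge> 0"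
  "slope_bd \<ge> 0" "drift \<ge> 0"
proof -
  show i: "inv_c > 0" using C by (simp add: inv_c_def)
  show b: "bnd L \<ge> 0" if "L \<ge> 0" for L using C that by (simp add: bnd_def)
  show a: "axis_const L \<ge> 0" if "L \<ge> 0" for L using b[OF that] that by (simp add: axis_const_def)
  show "dilation_const L \<ge> 0" if "L \<ge> 0" for L using b[OF that] that by (simp add: dilation_const_def)
  show "slope_bd \<ge> 0" using b[of 6] i by (simp add: slope_bd_def)
  show "drift \<ge> 0" using a[of 12] by (simp add: drift_def)
qed

lemma lip_bd:
  assumes "p > 0"
  shows "lip_bd p \<ge> 6" "lip_bd p \<ge> 0" "lip_bd p \<ge> 3 * (4 * ((real d + p) / 2 + 1))"
    "lip_bd p \<ge> 36 * ((real d + p) / 2 + 1) + 6" "bnd (lip_bd p) \<ge> 0"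
proof -
  define t where "t = (real d + p) / 2 + 1"
  have t: "t \<ge> 0" using assms by (simp add: t_def)
  show "lip_bd p \<ge> 6" "lip_bd p \<ge> 0" "lip_bd p \<ge> 3 * (4 * ((real d + p) / 2 + 1))"
    "lip_bd p \<ge> 36 * ((real d + p) / 2 + 1) + 6"
    using t unfolding lip_bd_def t_def[symmetric] by linarith+
  then show "bnd (lip_bd p) \<ge> 0" by (intro const_pos(2)) simp
qed

lemma err_nonneg:
  assumes "p > 0" shows "vec_err p \<ge> 0" "scal_err p \<ge> 0"
  using const_pos(1,5,6) const_pos(2-4)[OF lip_bd(2)[OF assms]] by (auto simp: vec_err_def scal_err_def)

lemma smear_alphas: "alphas X j \<le> smear (alphas X) j" "0 \<le> smear (alphas X) j" "smear (alphas X) j \<le> 2"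
proof -
  have "0 \<le> alphas X i" "alphas X i \<le> 1" for i
    using alpha_trunc_bounds by (auto simp: alphas_def)
  then show "alphas X j \<le> smear (alphas X) j" "0 \<le> smear (alphas X) j" "smear (alphas X) j \<le> 2"
    by (rule smear_bounds)+
qed

lemma alpha_sum_summable: "p > 0 \<Longrightarrow> summable (\<lambda>j. (2 powr (- p)) ^ j * smear (alphas X) j)"
  using smear_alphas by (intro summable_scale(2)[of _ _ 2]) auto

context
  fixes X :: "real ^ 'n"
  assumes X: "X \<notin> \<Gamma>"
begin

abbreviation "m0 j \<equiv> mom d \<sigma> X (scale X j) tent"
abbreviation "m1 j \<equiv> mom d \<sigma> X (scale X j) (\<lambda>z. tent z *\<^sub>R z)"

lemma inverse_m0: "m0 j > 0" "1 / m0 j \<le> inv_c"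
proof -
  have "1 / inv_c \<le> m0 j"
    using mom_tent_ge[OF scale[OF X], of j] by (simp add: inv_c_def)
  moreover have "1 / inv_c > 0" using const_pos(1) by simp
  ultimately show *: "m0 j > 0" by linarith
  then show "1 / m0 j \<le> inv_c"
    using \<open>1 / inv_c \<le> m0 j\<close> const_pos(1) by (simp add: field_simps)
qed

lemma m1_eq: "m1 j = m0 j *\<^sub>R slope X j"
  using inverse_m0(1)[of j] by (simp add: slope_def)

lemma norm_slope: "norm (slope X j) \<le> slope_bd"
proof -
  have "norm (m1 j) \<le> bnd 6"
    using mom_bnd'[OF bump_scaleR_id[OF bump_tent] scale[OF X], of j] by simp
  then have "1 / m0 j * norm (m1 j) \<le> inv_c * bnd 6"
    using inverse_m0[of j] const_pos(1) by (intro mult_mono) auto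
  then show ?thesis using inverse_m0(1)[of j] by (simp add: slope_def slope_bd_def mult.commute)
qed

text \<open>\<open>axis_defect\<close> at scale j + 1, where g is the tent of scale j contracted by
  2. The slopes appear after dividing by the two tent moments, which costs
  \<open>inv_c\<^sup>2\<close>.\<close>

lemma slope_step: "norm (slope X (Suc j) - (1 / 2) *\<^sub>R slope X j) \<le> drift * alphas X (Suc j)"
proof -
  let ?s = "scale X j"
  have s2: "scale X (Suc j) = 2 * ?s" by (simp add: scale_def)
  note s = scale[OF X, of "Suc j", unfolded s2]
  let ?g = "\<lambda>t::real. max 0 (2 - 2 * t)"
  have g: "tent (2 *\<^sub>R z) = ?g (norm z)" for z :: "real ^ 'n" by (simp add: tent_def)
  have "norm (mom d \<sigma> X (2 * ?s) tent *\<^sub>R mom d \<sigma> X (2 * ?s) (\<lambda>z. ?g (norm z) *\<^sub>R z)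
      - mom d \<sigma> X (2 * ?s) (\<lambda>z. ?g (norm z)) *\<^sub>R mom d \<sigma> X (2 * ?s) (\<lambda>z. tent z *\<^sub>R z))
      \<le> axis_const 12 * alpha_trunc d \<sigma> X (2 * ?s)"
    using bump_double[OF bump_tent, where 'a = "real ^ 'n"] unfolding g
    by (intro axis_defect[of ?g 4 12] s) (auto intro!: continuous_intros)
  moreover have "mom d \<sigma> X (2 * ?s) (\<lambda>z. ?g (norm z)) = (1 / 2 ^ d) * m0 j"
    using mom_double[OF scale(1)[OF X], of d \<sigma> X j tent] unfolding g by simp
  moreover have "mom d \<sigma> X (2 * ?s) (\<lambda>z. ?g (norm z) *\<^sub>R z) = (1 / 2 ^ d) *\<^sub>R (1 / 2) *\<^sub>R m1 j"
  proof -
    have "mom d \<sigma> X (2 * ?s) (\<lambda>z. ?g (norm z) *\<^sub>R z)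
      = mom d \<sigma> X (2 * ?s) (\<lambda>z. (1 / 2) *\<^sub>R (tent (2 *\<^sub>R z) *\<^sub>R (2 *\<^sub>R z)))"
      unfolding g by (simp add: mult.commute)
    also have "\<dots> = (1 / 2) *\<^sub>R mom d \<sigma> X (2 * ?s) (\<lambda>z. tent (2 *\<^sub>R z) *\<^sub>R (2 *\<^sub>R z))"
      unfolding mom_def integral_scaleR_right by simp
    also have "\<dots> = (1 / 2 ^ d) *\<^sub>R (1 / 2) *\<^sub>R m1 j"
      unfolding mom_double[OF scale(1)[OF X], of d \<sigma> X j "\<lambda>z. tent z *\<^sub>R z"] by simp
    finally show ?thesis .
  qed
  ultimately have *: "norm (m0 (Suc j) *\<^sub>R ((1 / 2 ^ d) *\<^sub>R (1 / 2) *\<^sub>R m1 j) - ((1 / 2 ^ d) * m0 j) *\<^sub>R m1 (Suc j))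
      \<le> axis_const 12 * alphas X (Suc j)"
    unfolding alphas_def s2 by simp
  have "m0 (Suc j) *\<^sub>R ((1 / 2 ^ d) *\<^sub>R (1 / 2) *\<^sub>R m1 j) - ((1 / 2 ^ d) * m0 j) *\<^sub>R m1 (Suc j)
      = - (m0 (Suc j) * m0 j / 2 ^ d) *\<^sub>R (slope X (Suc j) - (1 / 2) *\<^sub>R slope X j)"
    unfolding m1_eq by (simp add: scaleR_diff_right mult_ac)
  with * have "(m0 (Suc j) * m0 j / 2 ^ d) * norm (slope X (Suc j) - (1 / 2) *\<^sub>R slope X j)
      \<le> axis_const 12 * alphas X (Suc j)"
    using inverse_m0(1)[of j] inverse_m0(1)[of "Suc j"] by (simp add: abs_mult)
  then have "norm (slope X (Suc j) - (1 / 2) *\<^sub>R slope X j)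
      \<le> (1 / m0 (Suc j)) * (1 / m0 j) * (2 ^ d * (axis_const 12 * alphas X (Suc j)))"
    using inverse_m0(1)[of j] inverse_m0(1)[of "Suc j"] by (simp add: field_simps)
  also have "\<dots> \<le> inv_c * inv_c * (2 ^ d * (axis_const 12 * alphas X (Suc j)))"
    using inverse_m0 const_pos(1) const_pos(3)[of 12] alpha_trunc_bounds
    by (intro mult_right_mono mult_mono) (auto intro!: mult_nonneg_nonneg simp: less_imp_le alphas_def)
  finally show ?thesis by (simp add: drift_def power2_eq_square mult_ac)
qed

lemma slope_drift: "norm (slope X j - (1 / 2 ^ j) *\<^sub>R slope X 0) \<le> drift * smear (alphas X) j"
proof (induction j)
  case 0
  show ?case using const_pos(6) smear_alphas(2)[of X 0] by simp
next
  case (Suc j)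
  have "slope X (Suc j) - (1 / 2 ^ Suc j) *\<^sub>R slope X 0
      = (slope X (Suc j) - (1 / 2) *\<^sub>R slope X j) + (1 / 2) *\<^sub>R (slope X j - (1 / 2 ^ j) *\<^sub>R slope X 0)"
    by (simp add: scaleR_diff_right)
  then have "norm (slope X (Suc j) - (1 / 2 ^ Suc j) *\<^sub>R slope X 0)
      \<le> norm (slope X (Suc j) - (1 / 2) *\<^sub>R slope X j) + 1 / 2 * norm (slope X j - (1 / 2 ^ j) *\<^sub>R slope X 0)"
    by (metis norm_triangle_ineq norm_scaleR abs_of_pos half_gt_zero zero_less_one)
  also have "\<dots> \<le> drift * alphas X (Suc j) + 1 / 2 * (drift * smear (alphas X) j)"
    using Suc slope_step by (intro add_mono mult_left_mono) auto
  finally show ?case by (simp add: smear_Suc distrib_left)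
qed

section \<open>Defects of the flat identities for Riesz potentials\<close>

context
  fixes p q :: real
  assumes p: "p > 0" and q: "q = (real d + p) / 2"
begin

abbreviation "mk j \<equiv> mom d \<sigma> X (scale X j) (\<lambda>z. kern q ((norm z)\<^sup>2))"
abbreviation "mkz j \<equiv> mom d \<sigma> X (scale X j) (\<lambda>z. kern q ((norm z)\<^sup>2) *\<^sub>R z)"
abbreviation "mt j \<equiv> mom d \<sigma> X (scale X j) (\<lambda>z. (norm z)\<^sup>2 * kern q ((norm z)\<^sup>2))"
abbreviation "me j \<equiv> mom d \<sigma> X (scale X j) (\<lambda>z. kern_int q ((norm z)\<^sup>2))"

lemma q0: "q > 0" using p q by simp

lemma lip_bd_q: "4 * (q + 1) \<le> lip_bd p" "9 * (4 * (q + 1)) \<le> lip_bd p" "3 * (4 * (q + 1)) \<le> lip_bd p"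
  "36 * (q + 1) + 6 \<le> lip_bd p"
proof -
  have "lip_bd p = 36 * (q + 1) + 6" by (simp only: lip_bd_def q)
  then show "4 * (q + 1) \<le> lip_bd p" "9 * (4 * (q + 1)) \<le> lip_bd p" "3 * (4 * (q + 1)) \<le> lip_bd p"
    "36 * (q + 1) + 6 \<le> lip_bd p"
    using q0 by auto
qed

lemma mk_bound: "\<bar>mk j\<bar> \<le> bnd (lip_bd p)"
  using mom_bnd'[OF bump_mono[OF bump_kern[OF q0] lip_bd_q(1)] scale[OF X], of j] by simp

text \<open>Two errors: non-flatness at scale j itself, and the drift of the slope between the
  scales 0 and j. They are the two summands of \<open>vec_err\<close>.\<close>

lemma mkz_defect: "norm (mkz j - mk j *\<^sub>R ((1 / 2 ^ j) *\<^sub>R slope X 0)) \<le> vec_err p * smear (alphas X) j"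
proof -
  have "norm (m0 j *\<^sub>R mkz j - mk j *\<^sub>R m1 j) \<le> axis_const (lip_bd p) * alphas X j"
    unfolding alphas_def
  proof (rule axis_defect[of "\<lambda>t. kern q (t\<^sup>2)" "4 * (q + 1)", OF _ _ bump_kern[OF q0] lip_bd_q(3) lip_bd(1)[OF p] scale[OF X]])
    show "continuous_on UNIV (\<lambda>t. kern q (t\<^sup>2))"
      by (intro continuous_on_compose2[OF continuous_kern] continuous_intros) auto
    show "kern q (t\<^sup>2) = 0" if "t \<ge> 2" for t
      using power_mono[OF that, of 2] by (intro kern_0) simp
  qed
  also have "m0 j *\<^sub>R mkz j - mk j *\<^sub>R m1 j = m0 j *\<^sub>R (mkz j - mk j *\<^sub>R slope X j)"
    unfolding m1_eq by (simp add: scaleR_diff_right mult.commute)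
  finally have "norm (mkz j - mk j *\<^sub>R slope X j) \<le> (1 / m0 j) * (axis_const (lip_bd p) * alphas X j)"
    using inverse_m0(1)[of j] by (simp add: pos_le_divide_eq mult.commute)
  also have "\<dots> \<le> inv_c * (axis_const (lip_bd p) * smear (alphas X) j)"
    using inverse_m0[of j] const_pos(1) const_pos(3)[OF lip_bd(2)[OF p]] alpha_trunc_bounds smear_alphas[of X j]
    by (intro mult_mono) (auto simp: alphas_def)
  finally have 1: "norm (mkz j - mk j *\<^sub>R slope X j) \<le> inv_c * (axis_const (lip_bd p) * smear (alphas X) j)" .
  have 2: "norm (mk j *\<^sub>R (slope X j - (1 / 2 ^ j) *\<^sub>R slope X 0)) \<le> bnd (lip_bd p) * (drift * smear (alphas X) j)"
    using mk_bound[of j] slope_drift[of j] lip_bd(5)[OF p] by (simp only: norm_scaleR) (intro mult_mono; simp)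
  have "mkz j - mk j *\<^sub>R ((1 / 2 ^ j) *\<^sub>R slope X 0)
      = (mkz j - mk j *\<^sub>R slope X j) + mk j *\<^sub>R (slope X j - (1 / 2 ^ j) *\<^sub>R slope X 0)"
    by (simp add: scaleR_diff_right)
  also have "norm \<dots> \<le> inv_c * (axis_const (lip_bd p) * smear (alphas X) j) + bnd (lip_bd p) * (drift * smear (alphas X) j)"
    by (rule norm_triangle_le[OF add_mono[OF 1 2]])
  finally show ?thesis by (simp add: vec_err_def algebra_simps)
qed

text \<open>After division by twice the squared tent moment, \<open>dilation_defect\<close> gives
  the relation with \<open>slope X j\<close>. Passing to \<open>slope X 0\<close> changes a squared
  norm, whence the difference of norms times their sum, at most \<open>2 * slope_bd\<close>.\<close>

lemma mt_defect:
  "\<bar>mt j - real d / 2 * me j - (norm ((1 / 2 ^ j) *\<^sub>R slope X 0))\<^sup>2 * mk j\<bar> \<le> scal_err p * smear (alphas X) j"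
proof -
  let ?w = "(1 / 2 ^ j) *\<^sub>R slope X 0" and ?v = "slope X j"
  have "\<bar>(real d * me j - 2 * mt j) * (m0 j)\<^sup>2 + 2 * mk j * inner (m1 j) (m1 j)\<bar> \<le> dilation_const (lip_bd p) * alphas X j"
    unfolding alphas_def by (rule dilation_defect[OF q0 lip_bd_q(4) scale[OF X]])
  also have "(real d * me j - 2 * mt j) * (m0 j)\<^sup>2 + 2 * mk j * inner (m1 j) (m1 j)
      = - (2 * (m0 j)\<^sup>2) * (mt j - real d / 2 * me j - (norm ?v)\<^sup>2 * mk j)"
    unfolding m1_eq power2_norm_eq_inner by (simp add: algebra_simps power2_eq_square)
  finally have "(2 * (m0 j)\<^sup>2) * \<bar>mt j - real d / 2 * me j - (norm ?v)\<^sup>2 * mk j\<bar> \<le> dilation_const (lip_bd p) * alphas X j"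
    by (simp only: abs_mult abs_minus_cancel) simp
  then have "\<bar>mt j - real d / 2 * me j - (norm ?v)\<^sup>2 * mk j\<bar> \<le> (1 / m0 j)\<^sup>2 / 2 * (dilation_const (lip_bd p) * alphas X j)"
    using inverse_m0(1)[of j] by (simp add: field_simps)
  also have "\<dots> \<le> inv_c\<^sup>2 / 2 * (dilation_const (lip_bd p) * smear (alphas X) j)"
    using inverse_m0[of j] const_pos(1) const_pos(4)[OF lip_bd(2)[OF p]] alpha_trunc_bounds smear_alphas[of X j]
    by (intro mult_mono divide_right_mono power_mono) (auto simp: alphas_def)
  finally have 1: "\<bar>mt j - real d / 2 * me j - (norm ?v)\<^sup>2 * mk j\<bar> \<le> inv_c\<^sup>2 / 2 * (dilation_const (lip_bd p) * smear (alphas X) j)" .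
  have "\<bar>(norm ?v)\<^sup>2 - (norm ?w)\<^sup>2\<bar> \<le> drift * smear (alphas X) j * (2 * slope_bd)"
  proof -
    have "norm ?w = (1 / 2 ^ j) * norm (slope X 0)" by simp
    also have "\<dots> \<le> 1 * norm (slope X 0)" by (intro mult_right_mono) auto
    finally have "norm ?w \<le> norm (slope X 0)" by simp
    then have "norm ?v + norm ?w \<le> 2 * slope_bd" using norm_slope[of j] norm_slope[of 0] by linarith
    moreover have "\<bar>norm ?v - norm ?w\<bar> \<le> drift * smear (alphas X) j"
      using slope_drift[of j] norm_triangle_ineq3 order_trans by blast
    ultimately have "\<bar>norm ?v - norm ?w\<bar> * \<bar>norm ?v + norm ?w\<bar> \<le> drift * smear (alphas X) j * (2 * slope_bd)"
      by (intro mult_mono) (auto intro: order_trans[OF abs_ge_zero])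
    then show ?thesis by (simp only: abs_mult[symmetric]) (simp add: power2_eq_square algebra_simps)
  qed
  then have 2: "\<bar>((norm ?v)\<^sup>2 - (norm ?w)\<^sup>2) * mk j\<bar> \<le> drift * smear (alphas X) j * (2 * slope_bd) * bnd (lip_bd p)"
    unfolding abs_mult using mk_bound[of j] const_pos(5,6) smear_alphas(2)[of X j]
    by (intro mult_mono) (auto intro!: mult_nonneg_nonneg)
  have "mt j - real d / 2 * me j - (norm ?w)\<^sup>2 * mk j
      = (mt j - real d / 2 * me j - (norm ?v)\<^sup>2 * mk j) + ((norm ?v)\<^sup>2 - (norm ?w)\<^sup>2) * mk j"
    by (simp add: algebra_simps)
  also have "\<bar>\<dots>\<bar> \<le> inv_c\<^sup>2 / 2 * (dilation_const (lip_bd p) * smear (alphas X) j)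
      + drift * smear (alphas X) j * (2 * slope_bd) * bnd (lip_bd p)"
    using 1 2 by linarith
  finally show ?thesis by (simp add: scal_err_def algebra_simps)
qed

abbreviation "\<delta> \<equiv> infdist X \<Gamma>"

lemma riesz_vec_defect:
  "norm (riesz_vec p X - riesz (p + 2) X *\<^sub>R (\<delta> *\<^sub>R slope X 0)) \<le> \<delta> powr (- (p + 1)) * (vec_err p * alpha_sum p X)"
proof -
  let ?w = "\<delta> *\<^sub>R slope X 0"
  let ?f = "\<lambda>j. scale X j powr (- (p + 1)) *\<^sub>R (mkz j - mk j *\<^sub>R ((1 / 2 ^ j) *\<^sub>R slope X 0))"
  let ?g = "\<lambda>j. \<delta> powr (- (p + 1)) * (vec_err p * ((2 powr (- p)) ^ j * smear (alphas X) j))"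
  \<comment> \<open>Since scale X j / 2^j = \<delta>, the same vector ?w can be taken out of the sum
    over all scales.\<close>
  have s: "(scale X j powr (- (p + 2)) * mk j) *\<^sub>R ?w
      = scale X j powr (- (p + 1)) *\<^sub>R (mk j *\<^sub>R ((1 / 2 ^ j) *\<^sub>R slope X 0))" for j
  proof -
    have "scale X j powr (- (p + 2)) = scale X j powr (- (p + 1)) / scale X j"
    proof -
      have "- (p + 2) = - (p + 1) - 1" by simp
      then show ?thesis using scale(1)[OF X, of j] by (simp only: powr_diff) simp
    qed
    then show ?thesis using infdist_pos[OF X] by (simp add: scale_def mult_ac)
  qed
  have "?f sums (riesz_vec p X - riesz (p + 2) X *\<^sub>R ?w)"
    using sums_diff[OF riesz_vec_series(2)[OF X p q] sums_scaleR_left[OF riesz_series_kern(2)[OF X p q], of ?w]]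
    unfolding s by (simp add: scaleR_diff_right)
  moreover have "norm (?f j) \<le> ?g j" for j
  proof -
    \<comment> \<open>The extra decay 2^(-j) is given up, so that both defects are bounded by the
      same \<open>alpha_sum p X\<close>.\<close>
    have "(2 powr (- (p + 1))) ^ j \<le> (2 powr (- p) :: real) ^ j"
      by (intro power_mono) auto
    then have "norm (?f j) \<le> (\<delta> powr (- (p + 1)) * (2 powr (- p)) ^ j) * (vec_err p * smear (alphas X) j)"
      unfolding norm_scaleR scale_powr abs_of_nonneg[OF mult_nonneg_nonneg[OF powr_ge_zero zero_le_power[OF powr_ge_zero]]]
      by (intro mult_mono mult_left_mono mkz_defect) auto
    then show ?thesis by (simp add: mult_ac)
  qed
  moreover have "summable ?g" by (intro summable_mult alpha_sum_summable p)
  ultimately have "norm (riesz_vec p X - riesz (p + 2) X *\<^sub>R ?w) \<le> suminf ?g" by (rule norm_sums_le)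
  also have "suminf ?g = \<delta> powr (- (p + 1)) * (vec_err p * alpha_sum p X)"
    unfolding alpha_sum_def by (simp only: suminf_mult[OF summable_mult[OF alpha_sum_summable[OF p]]] suminf_mult[OF alpha_sum_summable[OF p]])
  finally show ?thesis .
qed

lemma riesz_defect:
  "\<bar>p / (real d + p) * riesz p X - (norm (\<delta> *\<^sub>R slope X 0))\<^sup>2 * riesz (p + 2) X\<bar> \<le> \<delta> powr (- p) * (scal_err p * alpha_sum p X)"
proof -
  let ?w = "\<delta> *\<^sub>R slope X 0"
  let ?f = "\<lambda>j. scale X j powr (- p) * (mt j - real d / 2 * me j - (norm ((1 / 2 ^ j) *\<^sub>R slope X 0))\<^sup>2 * mk j)"
  let ?g = "\<lambda>j. \<delta> powr (- p) * (scal_err p * ((2 powr (- p)) ^ j * smear (alphas X) j))"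
  have s: "(norm ?w)\<^sup>2 * (scale X j powr (- (p + 2)) * mk j)
      = scale X j powr (- p) * ((norm ((1 / 2 ^ j) *\<^sub>R slope X 0))\<^sup>2 * mk j)" for j
  proof -
    have "scale X j powr (- (p + 2)) = scale X j powr (- p) / (scale X j)\<^sup>2"
    proof -
      have "- (p + 2) = - p - 2" by simp
      then show ?thesis using scale(1)[OF X, of j] by (simp only: powr_diff) simp
    qed
    then show ?thesis using infdist_pos[OF X] by (simp add: scale_def power_mult_distrib power_divide mult_ac)
  qed
  \<comment> \<open>The weight is 1 - (d / 2) / q with q = (d + p) / 2, matching the two expansions
    of \<open>riesz p\<close>.\<close>
  have r: "p / (real d + p) * riesz p X = riesz p X - real d / 2 * (riesz p X / q)"
    using p unfolding q by (simp add: field_simps)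
  have "?f sums (p / (real d + p) * riesz p X - (norm ?w)\<^sup>2 * riesz (p + 2) X)"
    using sums_diff[OF sums_diff[OF riesz_series_norm_kern(2)[OF X p q] sums_mult[OF riesz_series_kern_int[OF X p q], of "real d / 2"]]
      sums_mult[OF riesz_series_kern(2)[OF X p q], of "(norm ?w)\<^sup>2"]]
    unfolding s r by (simp add: right_diff_distrib mult_ac)
  moreover have "norm (?f j) \<le> ?g j" for j
  proof -
    have n: "\<bar>scale X j powr (- p)\<bar> = \<delta> powr (- p) * (2 powr (- p)) ^ j"
      by (simp add: scale_powr abs_mult)
    have "norm (?f j) \<le> (\<delta> powr (- p) * (2 powr (- p)) ^ j) * (scal_err p * smear (alphas X) j)"
      unfolding real_norm_def abs_mult[of "scale X j powr (- p)"] n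
      by (intro mult_left_mono mt_defect) auto
    then show ?thesis by (simp add: mult_ac)
  qed
  moreover have "summable ?g" by (intro summable_mult alpha_sum_summable p)
  ultimately have "norm (p / (real d + p) * riesz p X - (norm ?w)\<^sup>2 * riesz (p + 2) X) \<le> suminf ?g" by (rule norm_sums_le)
  also have "suminf ?g = \<delta> powr (- p) * (scal_err p * alpha_sum p X)"
    unfolding alpha_sum_def by (simp only: suminf_mult[OF summable_mult[OF alpha_sum_summable[OF p]]] suminf_mult[OF alpha_sum_summable[OF p]])
  finally show ?thesis by simp
qed

lemma riesz_upper: "riesz p X \<le> \<delta> powr (- p) * up_c p"
proof -
  have g: "(\<lambda>j. (2 powr (- p)) ^ j) sums (1 / (1 - 2 powr (- p) :: real))"
    using p by (intro geometric_sums) (simp add: powr_less_one)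
  have mt: "\<bar>mt j\<bar> \<le> bnd (lip_bd p)" for j
    using mom_bnd'[OF bump_mono[OF bump_norm_power2[OF bump_kern[OF q0]] lip_bd_q(2)] scale[OF X], of j] by simp
  have "norm (riesz p X) \<le> (\<Sum>j. \<delta> powr (- p) * bnd (lip_bd p) * (2 powr (- p)) ^ j)"
  proof (rule norm_sums_le[OF riesz_series_norm_kern(2)[OF X p q]])
    show "norm (scale X j powr (- p) * mt j) \<le> \<delta> powr (- p) * bnd (lip_bd p) * (2 powr (- p)) ^ j" for j
      using mult_left_mono[OF mt[of j], of "\<delta> powr (- p) * (2 powr (- p)) ^ j"]
      by (simp add: scale_powr abs_mult mult_ac)
    show "summable (\<lambda>j. \<delta> powr (- p) * bnd (lip_bd p) * (2 powr (- p)) ^ j)"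
      using g by (intro summable_mult) (simp add: sums_iff)
  qed
  also have "\<dots> = \<delta> powr (- p) * up_c p"
    using sums_mult[OF g, of "\<delta> powr (- p) * bnd (lip_bd p)"] by (simp add: sums_iff up_c_def)
  finally show ?thesis by simp
qed

text \<open>On its support, |X - y| < 2 \<delta>, the tent is at most 2, so the integrand dominates
  half of (2 \<delta>)^(-d-p) times the tent.\<close>

lemma riesz_lower: "riesz p X \<ge> \<delta> powr (- p) * low_c p"
proof -
  have \<delta>: "\<delta> > 0" by (rule infdist_pos[OF X])
  have "1 / inv_c \<le> m0 0" using inverse_m0[of 0] const_pos(1) by (simp add: field_simps)
  then have "\<delta> powr (- p) * low_c p \<le> \<delta> powr (- p) * (2 powr (- real d - p) / 2 * m0 0)"
  proof -
    have "low_c p = 2 powr (- real d - p) / 2 * (1 / inv_c)" by (simp add: low_c_def)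
    then show ?thesis using \<open>1 / inv_c \<le> m0 0\<close> by (simp only:) (intro mult_left_mono; simp)
  qed
  also have "\<dots> = (2 * \<delta>) powr (- real d - p) / 2 * (\<integral>y. tent ((1 / \<delta>) *\<^sub>R (X - y)) \<partial>\<sigma>)"
  proof -
    have "\<delta> powr (- real d - p) * \<delta> ^ d = \<delta> powr (- p)"
      using \<delta> by (simp add: powr_realpow[symmetric] powr_add[symmetric])
    then show ?thesis using \<delta> by (simp add: mom_def scale_def powr_mult field_simps)
  qed
  also have "\<dots> = (\<integral>y. (2 * \<delta>) powr (- real d - p) / 2 * tent ((1 / \<delta>) *\<^sub>R (X - y)) \<partial>\<sigma>)"
    by simp
  also have "\<dots> \<le> riesz p X"
    unfolding riesz_def
  proof (rule integral_mono_AE)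
    show "integrable \<sigma> (\<lambda>y. (2 * \<delta>) powr (- real d - p) / 2 * tent ((1 / \<delta>) *\<^sub>R (X - y)))"
      using integrable_bump(1)[OF bump_tent \<delta>] by simp
    show "AE y in \<sigma>. (2 * \<delta>) powr (- real d - p) / 2 * tent ((1 / \<delta>) *\<^sub>R (X - y)) \<le> norm (X - y) powr (- real d - p)"
      using AE_support
    proof eventually_elim
      case (elim y)
      show ?case
      proof (cases "y \<in> ball X (2 * \<delta>)")
        case True
        have "norm (X - y) > 0" using norm_ge_infdist[OF elim, of X] \<delta> by linarith
        then have "(2 * \<delta>) powr (- real d - p) \<le> norm (X - y) powr (- real d - p)"
          using True p by (intro powr_mono2') (auto simp: dist_norm)
        moreover have "tent ((1 / \<delta>) *\<^sub>R (X - y)) \<le> 2" "tent ((1 / \<delta>) *\<^sub>R (X - y)) \<ge> 0" by (auto simp: tent_def)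
        ultimately show ?thesis
          using mult_mono[of "(2 * \<delta>) powr (- real d - p)" "norm (X - y) powr (- real d - p)" "tent ((1 / \<delta>) *\<^sub>R (X - y))" 2] by simp
      qed (simp add: bump_rescaled(2)[OF bump_tent \<delta>])
    qed
  qed (rule riesz_series_norm_kern(1)[OF X p q])
  finally show ?thesis .
qed

end

end

end

section \<open>The gradient of the quotient\<close>

text \<open>In the application x is the squared norm of w, so x ra \<approx> 1 \<approx> x rb should
  force ra \<approx> rb; but x has no lower bound, and dividing by it is avoided.\<close>

lemma combine_fields:
  fixes va vb w :: "'a::real_normed_vector"
  assumes va: "norm (va - ra *\<^sub>R w) \<le> ea" and vb: "norm (vb - rb *\<^sub>R w) \<le> eb"
    and ra: "0 \<le> ra" "ra \<le> R" and rb: "0 \<le> rb" "rb \<le> R"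
    and fa: "\<bar>x * ra - 1\<bar> \<le> fa" and fb: "\<bar>x * rb - 1\<bar> \<le> fb" and W: "norm w \<le> W"
  shows "norm (vb - va) \<le> ea + eb + R * (2 * fa + fb) * W"
proof -
  have "\<bar>rb - ra\<bar> \<le> R * (2 * fa + fb)"
  proof -
    \<comment> \<open>The difference is split as (1 - x ra) + x ra times itself: the first factor is
      small, and x (rb - ra) is the difference of the two defects.\<close>
    have "rb - ra = (rb - ra) * (1 - x * ra) + ra * ((x * rb - 1) - (x * ra - 1))" by (simp add: algebra_simps)
    also have "\<bar>\<dots>\<bar> \<le> \<bar>rb - ra\<bar> * \<bar>1 - x * ra\<bar> + ra * \<bar>(x * rb - 1) - (x * ra - 1)\<bar>"
      using ra by (intro order_trans[OF abs_triangle_ineq]) (simp add: abs_mult)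
    also have "\<dots> \<le> R * fa + R * (fb + fa)"
      using ra rb fa fb by (intro add_mono mult_mono) auto
    finally show ?thesis by (simp add: algebra_simps)
  qed
  then have "norm ((rb - ra) *\<^sub>R w) \<le> R * (2 * fa + fb) * W"
    unfolding norm_scaleR using W by (intro mult_mono) auto
  moreover have eq: "vb - va = (vb - rb *\<^sub>R w) - (va - ra *\<^sub>R w) + (rb - ra) *\<^sub>R w" by (simp add: algebra_simps)
  ultimately show ?thesis
    unfolding eq using norm_triangle_ineq[of "(vb - rb *\<^sub>R w) - (va - ra *\<^sub>R w)" "(rb - ra) *\<^sub>R w"]
      norm_triangle_ineq4[of "vb - rb *\<^sub>R w" "va - ra *\<^sub>R w"] va vb by linarith
qed

text \<open>Two applications of the mean value inequality, to the derivative and then to the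
  function minus its linear part. Everything stays in {u / 4..}, where the second derivative is
  bounded by its value at u / 4.\<close>

lemma powr_taylor2:
  fixes u v :: real
  assumes q: "q > 0" and u: "u > 0" "v \<ge> u / 4"
  shows "\<bar>v powr (- q) - u powr (- q) + q * u powr (- q - 1) * (v - u)\<bar> \<le> q * (q + 1) * (u / 4) powr (- q - 2) * (v - u)\<^sup>2"
proof -
  define M where "M = (q + 1) * (u / 4) powr (- q - 2)"
  have d1: "\<bar>\<xi> powr (- q - 1) - u powr (- q - 1)\<bar> \<le> M * \<bar>\<xi> - u\<bar>" if "\<xi> \<ge> u / 4" for \<xi>
  proof -
    have "norm (\<xi> powr (- q - 1) - u powr (- q - 1)) \<le> M * norm (\<xi> - u)"
    proof (rule field_differentiable_bound[of "{u / 4..}"])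
      fix z assume z: "z \<in> {u / 4..}"
      then have z0: "z > 0" using u by simp
      show "((\<lambda>x. x powr (- q - 1)) has_field_derivative (- q - 1) * z powr (- q - 1 - 1)) (at z within {u / 4..})"
        using z0 by (rule has_field_derivative_at_within[OF has_real_derivative_powr])
      have "(q + 1) * z powr (- q - 2) \<le> M"
        unfolding M_def using z u q by (intro mult_left_mono powr_mono2') auto
      moreover have "norm ((- q - 1) * z powr (- q - 1 - 1)) = (q + 1) * z powr (- q - 2)"
      proof -
        have "- q - 1 = - (q + 1)" "- (q + 1) - 1 = - q - 2" by simp_all
        then show ?thesis using q by (simp only: real_norm_def abs_mult abs_minus_cancel) simp
      qed
      ultimately show "norm ((- q - 1) * z powr (- q - 1 - 1)) \<le> M" by simp
    qed (use that u in auto)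
    then show ?thesis by simp
  qed
  let ?f = "\<lambda>x. x powr (- q) + q * u powr (- q - 1) * x"
  have "norm (?f v - ?f u) \<le> q * (M * \<bar>v - u\<bar>) * norm (v - u)"
  proof (rule field_differentiable_bound[of "{min u v..max u v}"])
    fix z assume z: "z \<in> {min u v..max u v}"
    then have z': "z \<ge> u / 4" "z > 0" "\<bar>z - u\<bar> \<le> \<bar>v - u\<bar>" using u by auto
    show "(?f has_field_derivative (- q * z powr (- q - 1) + q * u powr (- q - 1))) (at z within {min u v..max u v})"
      using z' by (auto intro!: derivative_eq_intros)
    have "- q * z powr (- q - 1) + q * u powr (- q - 1) = - q * (z powr (- q - 1) - u powr (- q - 1))"
      by (simp add: algebra_simps)
    then have "norm (- q * z powr (- q - 1) + q * u powr (- q - 1)) = q * \<bar>z powr (- q - 1) - u powr (- q - 1)\<bar>"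
      using q by (simp only: real_norm_def abs_mult)
    also have "\<dots> \<le> q * (M * \<bar>v - u\<bar>)"
    proof (rule mult_left_mono)
      have "M \<ge> 0" using q by (simp add: M_def)
      from order_trans[OF d1[OF z'(1)] mult_left_mono[OF z'(3) this]]
      show "\<bar>z powr (- q - 1) - u powr (- q - 1)\<bar> \<le> M * \<bar>v - u\<bar>" .
    qed (use q in simp)
    finally show "norm (- q * z powr (- q - 1) + q * u powr (- q - 1)) \<le> q * (M * \<bar>v - u\<bar>)" .
  qed auto
  moreover have "?f v - ?f u = v powr (- q) - u powr (- q) + q * u powr (- q - 1) * (v - u)" by (simp add: algebra_simps)
  moreover have "q * (M * \<bar>v - u\<bar>) * norm (v - u) = q * (q + 1) * (u / 4) powr (- q - 2) * (v - u)\<^sup>2"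
  proof -
    have "\<bar>v - u\<bar> * \<bar>v - u\<bar> = (v - u)\<^sup>2" by (simp only: abs_mult_self_eq power2_eq_square)
    then show ?thesis by (simp only: M_def real_norm_def mult.assoc)
  qed
  ultimately show ?thesis by (simp only: real_norm_def)
qed

text \<open>\<open>powr_taylor2\<close> for the squared norms of x and x + h. The bound on h gives v
  \<ge> u / 4 and |v - u| \<le> 3 |h| |x|, whose square is the origin of the 9; q |h|^2 comes from
  the quadratic part of v - u.\<close>

lemma norm_powr_taylor2:
  fixes x h :: "'a::real_inner"
  assumes e: "e > 0" and h: "norm h \<le> norm x / 2" and x: "x \<noteq> 0"
  shows "\<bar>norm (x + h) powr (- e) - norm x powr (- e) + e * norm x powr (- e - 2) * inner x h\<bar>
    \<le> (e / 2 + 9 * (e / 2 * (e / 2 + 1)) * 4 powr (e / 2 + 2)) * (norm h)\<^sup>2 * norm x powr (- e - 2)"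
proof -
  define q where "q = e / 2"
  define u v where "u = (norm x)\<^sup>2" and "v = (norm (x + h))\<^sup>2"
  have q: "q > 0" using e by (simp add: q_def)
  have n: "norm x > 0" and u: "u > 0" using x by (auto simp: u_def)
  have "norm x / 2 \<le> norm (x + h)" using norm_triangle_ineq2[of x "- h"] h by simp
  then have "(norm x / 2)\<^sup>2 \<le> v" unfolding v_def by (intro power_mono) auto
  then have v: "v \<ge> u / 4" by (simp add: u_def power_divide)
  have vu: "v - u = 2 * inner x h + (norm h)\<^sup>2"
    unfolding u_def v_def power2_norm_eq_inner by (simp add: inner_add_left inner_add_right inner_commute)
  have pw: "norm y powr (- e) = ((norm y)\<^sup>2) powr (- q)" "norm y powr (- e - 2) = ((norm y)\<^sup>2) powr (- q - 1)" for y :: 'a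
    using powr_powr[of "norm y" 2 "- q"] powr_powr[of "norm y" 2 "- q - 1"] by (simp_all add: q_def)
  have sq: "(v - u)\<^sup>2 \<le> 9 * (norm h)\<^sup>2 * u"
  proof -
    have "\<bar>v - u\<bar> \<le> 2 * (norm x * norm h) + norm h * norm h"
      unfolding vu power2_eq_square
      using Cauchy_Schwarz_ineq2[of x h] abs_triangle_ineq[of "2 * inner x h" "norm h * norm h"] by (simp add: abs_mult)
    also have "norm h * norm h \<le> norm x * norm h" using h norm_ge_zero[of x] norm_ge_zero[of h] by (intro mult_right_mono) linarith+
    finally have "\<bar>v - u\<bar> \<le> 3 * norm h * norm x" by (simp add: mult_ac)
    then have "\<bar>v - u\<bar>\<^sup>2 \<le> (3 * norm h * norm x)\<^sup>2" by (intro power_mono) auto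
    then show ?thesis by (simp add: u_def power_mult_distrib)
  qed
  have u2: "(u / 4) powr (- q - 2) * u = 4 powr (q + 2) * u powr (- q - 1)"
  proof -
    have "(u / 4) powr (- q - 2) = 4 powr (q + 2) * u powr (- q - 2)"
      using u powr_minus_divide[of 4 "q + 2"] by (simp add: powr_divide)
    moreover have "u powr (- q - 2) * u = u powr (- q - 1)"
    proof -
      have "- q - 1 = (- q - 2) + 1" by simp
      then show ?thesis using u by (simp only: powr_add) simp
    qed
    ultimately show ?thesis by simp
  qed
  have "v powr (- q) - u powr (- q) + e * u powr (- q - 1) * inner x h
      = (v powr (- q) - u powr (- q) + q * u powr (- q - 1) * (v - u)) - q * u powr (- q - 1) * (norm h)\<^sup>2"
    unfolding vu q_def by (simp add: algebra_simps)
  also have "\<bar>\<dots>\<bar> \<le> q * (q + 1) * (u / 4) powr (- q - 2) * (v - u)\<^sup>2 + q * u powr (- q - 1) * (norm h)\<^sup>2"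
    using powr_taylor2[OF q u v] q by (intro order_trans[OF abs_triangle_ineq4] add_mono) (auto simp: abs_mult)
  also have "\<dots> \<le> q * (q + 1) * (u / 4) powr (- q - 2) * (9 * (norm h)\<^sup>2 * u) + q * u powr (- q - 1) * (norm h)\<^sup>2"
    using sq q by (intro add_right_mono mult_left_mono) auto
  also have "\<dots> = q * (q + 1) * 9 * (norm h)\<^sup>2 * ((u / 4) powr (- q - 2) * u) + q * u powr (- q - 1) * (norm h)\<^sup>2"
    by (simp add: mult_ac)
  also have "\<dots> = (q + 9 * (q * (q + 1)) * 4 powr (q + 2)) * (norm h)\<^sup>2 * u powr (- q - 1)"
    unfolding u2 by (simp add: algebra_simps)
  finally show ?thesis
    unfolding pw u_def[symmetric] v_def[symmetric] q_def[symmetric] .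
qed

lemma gradient_eq:
  assumes "GDERIV f X :> G"
  shows "gradient f X = G"
  unfolding gradient_def
proof (rule the_equality)
  show "GDERIV f X :> G" by (rule assms)
  fix G' assume "GDERIV f X :> G'"
  then have "(\<lambda>h. inner h G') = (\<lambda>h. inner h G)"
    using assms has_derivative_unique unfolding gderiv_def by blast
  then show "G' = G" by (metis vector_eq_ldot)
qed

section \<open>Logarithmic gradients for two exponents\<close>

context ahlfors
begin

text \<open>\<open>field p\<close> is \<open>\<nabla> D / D\<close> for \<open>D = D_dist d \<Gamma> \<sigma> p\<close>; for a flat measure it does not depend on \<open>p\<close>.\<close>

definition field :: "real \<Rightarrow> real ^ 'n \<Rightarrow> real ^ 'n" where
  "field p X = ((real d + p) / (p * riesz p X)) *\<^sub>R riesz_vec p X"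

definition ratio_c :: "real \<Rightarrow> real" where
  "ratio_c p = (real d + p) / (p * low_c p)"

definition field_c :: "real \<Rightarrow> real \<Rightarrow> real" where
  "field_c p p' = (ratio_c p * vec_err p + ratio_c p' * vec_err p'
     + (ratio_c p * up_c (p + 2) + ratio_c p' * up_c (p' + 2)) * (2 * (ratio_c p * scal_err p) + 2 * (ratio_c p' * scal_err p')) * slope_bd)"

lemma low_c_pos: "low_c p > 0"
  using const_pos(1) by (simp add: low_c_def)

lemma ratio_c_nonneg: "p > 0 \<Longrightarrow> ratio_c p \<ge> 0"
  using low_c_pos[of p] by (simp add: ratio_c_def)

lemma up_c_nonneg: "p > 0 \<Longrightarrow> up_c p \<ge> 0"
  using lip_bd(5)[of p] by (auto simp: up_c_def powr_less_one less_imp_le intro!: divide_nonneg_nonneg)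

lemma alpha_sum_nonneg: "p > 0 \<Longrightarrow> alpha_sum p X \<ge> 0"
  unfolding alpha_sum_def using alpha_sum_summable smear_alphas by (intro suminf_nonneg) auto

context
  fixes X :: "real ^ 'n"
  assumes X: "X \<notin> \<Gamma>"
begin

lemma riesz_pos: "p > 0 \<Longrightarrow> riesz p X > 0"
proof -
  assume p: "p > 0"
  have "\<delta> X powr (- p) * low_c p > 0"
    using low_c_pos[of p] infdist_pos[OF X] by (intro mult_pos_pos) auto
  then show ?thesis using riesz_lower[OF X p refl] by linarith
qed

lemma riesz_ratio:
  assumes p: "p > 0"
  shows "(real d + p) / (p * riesz p X) * \<delta> X powr (- p) \<le> ratio_c p"
proof -
  have \<delta>: "\<delta> X powr (- p) > 0" using infdist_pos[OF X] by simp
  have "(real d + p) / (p * riesz p X) \<le> (real d + p) / (p * (\<delta> X powr (- p) * low_c p))"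
    using p \<delta> low_c_pos[of p] riesz_lower[OF X p refl] riesz_pos[OF p] by (intro divide_left_mono mult_left_mono mult_pos_pos) auto
  then have "(real d + p) / (p * riesz p X) * \<delta> X powr (- p) \<le> (real d + p) / (p * (\<delta> X powr (- p) * low_c p)) * \<delta> X powr (- p)"
    using \<delta> by (intro mult_right_mono) auto
  also have "\<dots> = ratio_c p" using \<delta> by (simp add: ratio_c_def)
  finally show ?thesis .
qed

lemma delta_powr: "\<delta> X * \<delta> X powr (- (p + 1)) = \<delta> X powr (- p)" "(\<delta> X)\<^sup>2 * \<delta> X powr (- (p + 2)) = \<delta> X powr (- p)"
  using infdist_pos[OF X] powr_add[of "\<delta> X" 1 "- (p + 1)"] powr_add[of "\<delta> X" 2 "- (p + 2)"] by simp_all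

text \<open>For a flat measure the errors vanish: \<delta> times the field is \<rho> times the slope
  w at scale 0, with \<rho> |w|^2 = 1, so it equals w / |w|^2 whatever p is. The third bound keeps
  \<rho> under control when w is small.\<close>

lemma field_defect:
  assumes p: "p > 0"
  defines "\<rho> \<equiv> (real d + p) / (p * riesz p X) * riesz (p + 2) X * (\<delta> X)\<^sup>2"
  shows "norm (\<delta> X *\<^sub>R field p X - \<rho> *\<^sub>R slope X 0) \<le> ratio_c p * vec_err p * alpha_sum p X"
    "0 \<le> \<rho>" "\<rho> \<le> ratio_c p * up_c (p + 2)"
    "\<bar>(norm (slope X 0))\<^sup>2 * \<rho> - 1\<bar> \<le> ratio_c p * scal_err p * alpha_sum p X"
proof -
  let ?k = "(real d + p) / (p * riesz p X)"
  have k: "?k \<ge> 0" using p riesz_pos[OF p] by simp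
  have \<delta>: "\<delta> X > 0" using infdist_pos[OF X] .
  have A: "alpha_sum p X \<ge> 0" by (rule alpha_sum_nonneg[OF p])
  have "\<delta> X *\<^sub>R field p X - \<rho> *\<^sub>R slope X 0
      = (?k * \<delta> X) *\<^sub>R (riesz_vec p X - riesz (p + 2) X *\<^sub>R (\<delta> X *\<^sub>R slope X 0))"
    unfolding \<rho>_def field_def by (simp add: scaleR_diff_right power2_eq_square mult_ac)
  then have "norm (\<delta> X *\<^sub>R field p X - \<rho> *\<^sub>R slope X 0)
      = ?k * \<delta> X * norm (riesz_vec p X - riesz (p + 2) X *\<^sub>R (\<delta> X *\<^sub>R slope X 0))"
    unfolding norm_scaleR using abs_of_nonneg[OF mult_nonneg_nonneg[OF k less_imp_le[OF \<delta>]]] by simp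
  also have "\<dots> \<le> ?k * \<delta> X * (\<delta> X powr (- (p + 1)) * (vec_err p * alpha_sum p X))"
    using k \<delta> by (intro mult_left_mono riesz_vec_defect[OF X p refl] mult_nonneg_nonneg) auto
  also have "\<dots> = (?k * \<delta> X powr (- p)) * (vec_err p * alpha_sum p X)"
    unfolding delta_powr(1)[of p, symmetric] by (simp add: mult_ac)
  also have "\<dots> \<le> ratio_c p * (vec_err p * alpha_sum p X)"
    using A err_nonneg[OF p] by (intro mult_right_mono riesz_ratio[OF p]) auto
  finally show "norm (\<delta> X *\<^sub>R field p X - \<rho> *\<^sub>R slope X 0) \<le> ratio_c p * vec_err p * alpha_sum p X"
    by (simp add: mult.assoc)
  have p2: "p + 2 > 0" using p by simp
  show "0 \<le> \<rho>" unfolding \<rho>_def using k riesz_pos[OF p2] by (intro mult_nonneg_nonneg) auto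
  have "\<rho> \<le> ?k * (\<delta> X powr (- (p + 2)) * up_c (p + 2)) * (\<delta> X)\<^sup>2"
    unfolding \<rho>_def using k by (intro mult_right_mono mult_left_mono riesz_upper[OF X p2 refl]) auto
  also have "\<dots> = (?k * \<delta> X powr (- p)) * up_c (p + 2)"
    unfolding delta_powr(2)[of p, symmetric] by (simp add: mult_ac)
  also have "\<dots> \<le> ratio_c p * up_c (p + 2)"
    using up_c_nonneg[OF p2] by (intro mult_right_mono riesz_ratio[OF p])
  finally show "\<rho> \<le> ratio_c p * up_c (p + 2)" .
  have "(norm (slope X 0))\<^sup>2 * \<rho> - 1
      = - ?k * (p / (real d + p) * riesz p X - (norm (\<delta> X *\<^sub>R slope X 0))\<^sup>2 * riesz (p + 2) X)"
    unfolding \<rho>_def using p riesz_pos[OF p] \<delta> by (simp add: right_diff_distrib power_mult_distrib mult_ac)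
  also have "\<bar>\<dots>\<bar> = ?k * \<bar>p / (real d + p) * riesz p X - (norm (\<delta> X *\<^sub>R slope X 0))\<^sup>2 * riesz (p + 2) X\<bar>"
    using k by (simp only: abs_mult abs_minus_cancel abs_of_nonneg)
  also have "\<dots> \<le> ?k * (\<delta> X powr (- p) * (scal_err p * alpha_sum p X))"
    using k by (intro mult_left_mono riesz_defect[OF X p refl])
  also have "\<dots> = (?k * \<delta> X powr (- p)) * (scal_err p * alpha_sum p X)" by (simp add: mult_ac)
  also have "\<dots> \<le> ratio_c p * (scal_err p * alpha_sum p X)"
    using A err_nonneg[OF p] by (intro mult_right_mono riesz_ratio[OF p]) auto
  finally show "\<bar>(norm (slope X 0))\<^sup>2 * \<rho> - 1\<bar> \<le> ratio_c p * scal_err p * alpha_sum p X"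
    by (simp add: mult.assoc)
qed

lemma field_diff:
  assumes p: "p > 0" and p': "p' > 0"
  shows "norm (\<delta> X *\<^sub>R (field p' X - field p X)) \<le> field_c p p' * (alpha_sum p X + alpha_sum p' X)"
proof -
  define S where "S = alpha_sum p X + alpha_sum p' X"
  let ?R = "ratio_c p * up_c (p + 2) + ratio_c p' * up_c (p' + 2)"
  have S: "alpha_sum p X \<le> S" "alpha_sum p' X \<le> S" "S \<ge> 0"
    using alpha_sum_nonneg[OF p, of X] alpha_sum_nonneg[OF p', of X] by (auto simp: S_def)
  have R: "ratio_c p * up_c (p + 2) \<ge> 0" "ratio_c p' * up_c (p' + 2) \<ge> 0"
    using ratio_c_nonneg[OF p] ratio_c_nonneg[OF p'] up_c_nonneg[of "p + 2"] up_c_nonneg[of "p' + 2"] p p' by auto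
  note f = field_defect[OF p] and f' = field_defect[OF p']
  note e = err_nonneg[OF p] err_nonneg[OF p'] ratio_c_nonneg[OF p] ratio_c_nonneg[OF p'] const_pos(5)
  have "norm (\<delta> X *\<^sub>R field p' X - \<delta> X *\<^sub>R field p X)
      \<le> ratio_c p * vec_err p * alpha_sum p X + ratio_c p' * vec_err p' * alpha_sum p' X
        + ?R * (2 * (ratio_c p * scal_err p * alpha_sum p X) + ratio_c p' * scal_err p' * alpha_sum p' X) * slope_bd"
    using f(3) f'(3) R by (intro combine_fields[OF f(1) f'(1) f(2) _ f'(2) _ f(4) f'(4) norm_slope[OF X]]) auto
  also have "\<dots> \<le> ratio_c p * vec_err p * S + ratio_c p' * vec_err p' * S
        + ?R * (2 * (ratio_c p * scal_err p * S) + 2 * (ratio_c p' * scal_err p' * S)) * slope_bd"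
  proof -
    have "ratio_c p' * scal_err p' * alpha_sum p' X \<le> ratio_c p' * scal_err p' * S"
      using S e by (intro mult_left_mono) auto
    moreover have "ratio_c p' * scal_err p' * S \<ge> 0" using S e by auto
    ultimately have "ratio_c p' * scal_err p' * alpha_sum p' X \<le> 2 * (ratio_c p' * scal_err p' * S)" by linarith
    then show ?thesis
      using S e R by (intro add_mono mult_right_mono mult_left_mono) auto
  qed
  also have "\<dots> = field_c p p' * S"
    by (simp add: field_c_def algebra_simps)
  finally show ?thesis by (simp add: S_def scaleR_diff_right)
qed

text \<open>For |h| < \<delta> / 2 the Taylor bound holds at every y in \<Gamma> with one constant
  M, so the remainder integrates to at most M |h|^2 times \<open>riesz (p + 2) X\<close>.\<close>

lemma riesz_gderiv:
  assumes p: "p > 0"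
  shows "GDERIV (riesz p) X :> - (real d + p) *\<^sub>R riesz_vec p X"
  unfolding gderiv_def
proof (rule has_derivativeI_sandwich)
  let ?e = "real d + p"
  define M where "M = ?e / 2 + 9 * (?e / 2 * (?e / 2 + 1)) * 4 powr (?e / 2 + 2)"
  have e: "?e > 0" using p by simp
  have ex: "- ?e = - real d - p" "- ?e - 2 = - real d - p - 2" "- real d - (p + 2) = - real d - p - 2" by simp_all
  show "\<delta> X / 2 > 0" using infdist_pos[OF X] by simp
  show "bounded_linear (\<lambda>h. inner h (- ?e *\<^sub>R riesz_vec p X))" by (rule bounded_linear_inner_left)
  show "((\<lambda>Y. M * riesz (p + 2) X * norm (Y - X)) \<longlongrightarrow> 0) (at X within UNIV)"
    by (rule tendsto_eq_intros refl | simp)+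
  fix Y assume Y: "Y \<noteq> X" "dist Y X < \<delta> X / 2"
  let ?h = "Y - X"
  have Yg: "Y \<notin> \<Gamma>"
    using Y(2) infdist_le[of Y \<Gamma> X] infdist_pos[OF X] by (auto simp: dist_commute)
  note i1 = riesz_series_norm_kern(1)[OF Yg p refl] and i2 = riesz_series_norm_kern(1)[OF X p refl]
    and i3 = riesz_vec_series(1)[OF X p refl] and i4 = riesz_series_kern(1)[OF X p refl]
  let ?g = "\<lambda>y. norm (Y - y) powr (- real d - p) - norm (X - y) powr (- real d - p)
      + ?e * inner ?h ((norm (X - y) powr (- real d - p - 2)) *\<^sub>R (X - y))"
  have ig: "integrable \<sigma> ?g"
    using i1 i2 i3 by (intro Bochner_Integration.integrable_add Bochner_Integration.integrable_diff
        integrable_mult_right integrable_inner_right) auto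
  have eq: "riesz p Y - riesz p X - inner ?h (- ?e *\<^sub>R riesz_vec p X) = (\<integral>y. ?g y \<partial>\<sigma>)"
  proof -
    define A where "A y = norm (Y - y) powr (- real d - p)" for y
    define B where "B y = norm (X - y) powr (- real d - p)" for y
    define V where "V y = (norm (X - y) powr (- real d - p - 2)) *\<^sub>R (X - y)" for y
    have "integrable \<sigma> A" "integrable \<sigma> B" "integrable \<sigma> V"
      using i1 i2 i3 unfolding A_def B_def V_def .
    then have "(\<integral>y. A y - B y + ?e * inner ?h (V y) \<partial>\<sigma>) = (\<integral>y. A y \<partial>\<sigma>) - (\<integral>y. B y \<partial>\<sigma>) + ?e * inner ?h (\<integral>y. V y \<partial>\<sigma>)"
      by simp
    then have "(\<integral>y. ?g y \<partial>\<sigma>) = riesz p Y - riesz p X + ?e * inner ?h (riesz_vec p X)"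
      unfolding A_def B_def V_def riesz_def riesz_vec_def .
    then show ?thesis by (simp add: algebra_simps)
  qed
  have le: "norm (\<integral>y. ?g y \<partial>\<sigma>) \<le> (\<integral>y. M * (norm ?h)\<^sup>2 * norm (X - y) powr (- real d - (p + 2)) \<partial>\<sigma>)"
  proof -
    have "AE y in \<sigma>. norm (?g y) \<le> M * (norm ?h)\<^sup>2 * norm (X - y) powr (- real d - (p + 2))"
      using AE_support
    proof eventually_elim
      case (elim y)
      have n: "\<delta> X \<le> norm (X - y)" by (rule norm_ge_infdist[OF elim])
      then have "norm ?h \<le> norm (X - y) / 2" "X - y \<noteq> 0" using Y(2) infdist_pos[OF X] by (auto simp: dist_norm)
      from norm_powr_taylor2[OF e this] show ?case
        unfolding M_def ex by (simp add: inner_commute mult_ac)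
    qed
    then have "(\<integral>y. norm (?g y) \<partial>\<sigma>) \<le> (\<integral>y. M * (norm ?h)\<^sup>2 * norm (X - y) powr (- real d - (p + 2)) \<partial>\<sigma>)"
      by (intro integral_mono_AE integrable_norm ig integrable_mult_right i4)
    then show ?thesis by (rule order_trans[OF integral_norm_bound])

  qed
  have "norm (riesz p Y - riesz p X - inner ?h (- ?e *\<^sub>R riesz_vec p X)) \<le> M * (norm ?h)\<^sup>2 * riesz (p + 2) X"
    unfolding eq using le by (simp only: riesz_def integral_mult_right_zero)
  also have "M * (norm ?h)\<^sup>2 * riesz (p + 2) X = M * riesz (p + 2) X * norm ?h * norm ?h"
    by (simp only: power2_eq_square mult_ac)
  finally show "norm (riesz p Y - riesz p X - inner ?h (- ?e *\<^sub>R riesz_vec p X)) / norm ?h \<le> M * riesz (p + 2) X * norm ?h"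
    using Y(1) by (subst pos_divide_le_eq) auto
qed

end

end

text \<open>Cauchy-Schwarz with each weight split into two square roots; the total weight is 1 / (1
  - t).\<close>

lemma weighted_square_sum:
  fixes t :: real and a :: "nat \<Rightarrow> real"
  assumes t: "0 \<le> t" "t < 1" and a: "\<And>j. 0 \<le> a j" "\<And>j. a j \<le> 1"
  shows "(\<Sum>j. t ^ j * a j)\<^sup>2 \<le> 1 / (1 - t) * (\<Sum>j. t ^ j * (a j)\<^sup>2)"
proof -
  have g: "(\<lambda>j. t ^ j) sums (1 / (1 - t))" using t by (intro geometric_sums) auto
  have s1: "summable (\<lambda>j. t ^ j * a j)"
    by (rule summable_comparison_test'[OF sums_summable[OF g], of 0])
       (use t a in \<open>auto simp: abs_mult intro!: mult_left_le\<close>)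
  have s2: "summable (\<lambda>j. t ^ j * (a j)\<^sup>2)"
    by (rule summable_comparison_test'[OF sums_summable[OF g], of 0])
       (use t a in \<open>auto simp: abs_mult intro!: mult_left_le power_le_one\<close>)
  have fin: "(\<Sum>j<n. t ^ j * a j)\<^sup>2 \<le> (\<Sum>j<n. t ^ j) * (\<Sum>j<n. t ^ j * (a j)\<^sup>2)" for n
  proof -
    have "(\<Sum>j<n. sqrt (t ^ j) * (sqrt (t ^ j) * a j))\<^sup>2
        \<le> (\<Sum>j<n. (sqrt (t ^ j))\<^sup>2) * (\<Sum>j<n. (sqrt (t ^ j) * a j)\<^sup>2)"
      by (rule Cauchy_Schwarz_ineq_sum)
    then show ?thesis using t by (simp add: power_mult_distrib mult.assoc[symmetric])
  qed
  show ?thesis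
  proof (rule LIMSEQ_le)
    show "(\<lambda>n. (\<Sum>j<n. t ^ j * a j)\<^sup>2) \<longlonglongrightarrow> (\<Sum>j. t ^ j * a j)\<^sup>2"
      by (intro tendsto_power summable_LIMSEQ s1)
    show "(\<lambda>n. (\<Sum>j<n. t ^ j) * (\<Sum>j<n. t ^ j * (a j)\<^sup>2)) \<longlonglongrightarrow> 1 / (1 - t) * (\<Sum>j. t ^ j * (a j)\<^sup>2)"
      using g by (intro tendsto_mult summable_LIMSEQ s2) (simp add: sums_def)
  qed (use fin in blast)
qed

text \<open>The recursion of \<open>smear\<close> gives S = A + (t / 2) S for the two sums, and t <
  1.\<close>

lemma smear_sum:
  fixes t :: real and a :: "nat \<Rightarrow> real"
  assumes t: "0 \<le> t" "t < 1" and a: "\<And>j. 0 \<le> a j" "\<And>j. a j \<le> 1"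
  shows "(\<Sum>j. t ^ j * smear a j) \<le> 2 * (\<Sum>j. t ^ j * a j)"
proof -
  note sm = smear_bounds[OF a]
  have g: "(\<lambda>j. t ^ j) sums (1 / (1 - t))" using t by (intro geometric_sums) auto
  have s1: "summable (\<lambda>j. t ^ j * a j)"
    by (rule summable_comparison_test'[OF sums_summable[OF g], of 0])
       (use t a in \<open>auto simp: abs_mult intro!: mult_left_le\<close>)
  have s2: "summable (\<lambda>j. t ^ j * smear a j)"
    by (rule summable_comparison_test'[OF summable_mult2[OF sums_summable[OF g], of 2], of 0])
       (use t sm in \<open>auto simp: abs_mult intro!: mult_left_mono\<close>)
  define S where "S = (\<Sum>j. t ^ j * smear a j)"
  have S0: "S \<ge> 0" unfolding S_def using t sm by (intro suminf_nonneg s2) auto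
  have s1': "summable (\<lambda>j. t ^ Suc j * a (Suc j))" using s1 by (subst summable_Suc_iff)
  have "S = smear a 0 + (\<Sum>j. t ^ Suc j * smear a (Suc j))"
    unfolding S_def using suminf_split_head[OF s2] by simp
  also have "(\<Sum>j. t ^ Suc j * smear a (Suc j)) = (\<Sum>j. t ^ Suc j * a (Suc j) + t / 2 * (t ^ j * smear a j))"
    by (simp add: smear_Suc algebra_simps)
  also have "\<dots> = (\<Sum>j. t ^ Suc j * a (Suc j)) + t / 2 * S"
    unfolding S_def by (subst suminf_add[symmetric], rule s1', rule summable_mult[OF s2]) (simp only: suminf_mult[OF s2])
  also have "(\<Sum>j. t ^ Suc j * a (Suc j)) = (\<Sum>j. t ^ j * a j) - a 0"
    using suminf_split_head[OF s1] by simp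
  finally have "S = (\<Sum>j. t ^ j * a j) + t / 2 * S" by (simp add: smear_0)
  moreover have "t / 2 * S \<le> 1 / 2 * S" using t S0 by (intro mult_right_mono) auto
  ultimately show ?thesis unfolding S_def by linarith
qed

section \<open>Pointwise bound of the gradient by squares of \<alpha>-numbers\<close>

context ahlfors
begin

lemma D_dist_eq: "D_dist d \<Gamma> \<sigma> p X = riesz p X powr (- 1 / p)"
proof -
  have [measurable]: "\<Gamma> \<in> sets borel" using closed by auto
  have "(LINT y:\<Gamma>|\<sigma>. norm (X - y) powr (- real d - p)) = riesz p X"
    unfolding set_lebesgue_integral_def riesz_def
  proof (rule integral_cong_AE)
    show "AE y in \<sigma>. indicator \<Gamma> y *\<^sub>R norm (X - y) powr (- real d - p) = norm (X - y) powr (- real d - p)"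
      using AE_support by eventually_elim simp
  qed measurable
  then show ?thesis by (simp add: D_dist_def)
qed

definition quot :: "real \<Rightarrow> real \<Rightarrow> real ^ 'n \<Rightarrow> real" where
  "quot p p' X = riesz p X powr (- 1 / p) * riesz p' X powr (1 / p')"

lemma D_dist_quot: "D_dist d \<Gamma> \<sigma> p X / D_dist d \<Gamma> \<sigma> p' X = quot p p' X"
  unfolding D_dist_eq quot_def using powr_minus_divide[of "riesz p' X" "1 / p'"] by simp

definition quot_c :: "real \<Rightarrow> real \<Rightarrow> real" where
  "quot_c p p' = low_c p powr (- 1 / p) * up_c p' powr (1 / p')"

text \<open>\<open>riesz p\<close> is comparable to \<delta>^(-p), hence each regularised distance
  to \<delta>, and \<delta> cancels in the quotient.\<close>

lemma quot_bounds:
  assumes X: "X \<notin> \<Gamma>" and p: "p > 0" "p' > 0"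
  shows "0 \<le> quot p p' X" "quot p p' X \<le> quot_c p p'"
proof -
  let ?\<delta> = "infdist X \<Gamma>"
  have \<delta>: "?\<delta> > 0" by (rule infdist_pos[OF X])
  show "0 \<le> quot p p' X" by (simp add: quot_def)
  have "quot p p' X \<le> (?\<delta> powr (- p) * low_c p) powr (- 1 / p) * (?\<delta> powr (- p') * up_c p') powr (1 / p')"
    unfolding quot_def
    using p \<delta> low_c_pos[of p] riesz_lower[OF X p(1) refl] riesz_upper[OF X p(2) refl] riesz_pos[OF X p(2)]
    by (intro mult_mono powr_mono2' powr_mono2) auto
  also have "\<dots> = quot_c p p'"
  proof -
    have "(?\<delta> powr (- p) * low_c p) powr (- 1 / p) = ?\<delta> * low_c p powr (- 1 / p)"
      using p(1) \<delta> low_c_pos[of p] by (subst powr_mult) (auto simp: powr_powr)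
    moreover have "(?\<delta> powr (- p') * up_c p') powr (1 / p') = 1 / ?\<delta> * up_c p' powr (1 / p')"
    proof -
      have "(?\<delta> powr (- p')) powr (1 / p') = 1 / ?\<delta>"
        using p(2) \<delta> powr_minus_divide[of ?\<delta> 1] by (simp add: powr_powr del: powr_minus)
      then show ?thesis using up_c_nonneg[OF p(2)] by (subst powr_mult) auto
    qed
    ultimately show ?thesis using \<delta> by (simp add: quot_c_def)
  qed
  finally show "quot p p' X \<le> quot_c p p'" .
qed

text \<open>With exponent e / p the logarithmic gradient is -e times \<open>field p\<close>. The
  case e = -1 is the regularised distance and e = 1 its reciprocal.\<close>

lemma riesz_powr_gderiv:
  assumes X: "X \<notin> \<Gamma>" and p: "p > 0"
  shows "GDERIV (\<lambda>Y. riesz p Y powr (e / p)) X :> - (e * riesz p X powr (e / p)) *\<^sub>R field p X"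
proof (rule GDERIV_subst[OF GDERIV_DERIV_compose[OF riesz_gderiv[OF X p]]])
  have r: "riesz p X > 0" by (rule riesz_pos[OF X p])
  show "DERIV (\<lambda>x. x powr (e / p)) (riesz p X) :> (e / p) * riesz p X powr (e / p - 1)"
    by (rule has_real_derivative_powr[OF r])
  show "((e / p) * riesz p X powr (e / p - 1)) *\<^sub>R (- (real d + p) *\<^sub>R riesz_vec p X)
      = - (e * riesz p X powr (e / p)) *\<^sub>R field p X"
  proof -
    have eq: "((e / p) * riesz p X powr (e / p - 1)) * - (real d + p)
        = - (e * riesz p X powr (e / p)) * ((real d + p) / (p * riesz p X))"
    proof -
      have "riesz p X powr (e / p - 1) = riesz p X powr (e / p) / riesz p X" using r by (simp only: powr_diff) simp
      then show ?thesis using r p by (simp only:) (simp add: field_simps)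
    qed
    show ?thesis unfolding field_def scaleR_scaleR eq ..
  qed
qed

lemma quot_gderiv:
  assumes X: "X \<notin> \<Gamma>" and p: "p > 0" "p' > 0"
  shows "GDERIV (quot p p') X :> quot p p' X *\<^sub>R (field p X - field p' X)"
  unfolding quot_def[abs_def]
  by (rule GDERIV_subst[OF GDERIV_mult[OF riesz_powr_gderiv[OF X p(1), of "-1"] riesz_powr_gderiv[OF X p(2), of 1]]])
     (simp add: scaleR_diff_right mult_ac)

lemma gradient_quot:
  assumes "X \<notin> \<Gamma>" "p > 0" "p' > 0"
  shows "gradient (\<lambda>Y. D_dist d \<Gamma> \<sigma> p Y / D_dist d \<Gamma> \<sigma> p' Y) X = quot p p' X *\<^sub>R (field p X - field p' X)"
  unfolding D_dist_quot by (rule gradient_eq[OF quot_gderiv[OF assms]])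

definition square_sum :: "real \<Rightarrow> real ^ 'n \<Rightarrow> real" where
  "square_sum p X = (\<Sum>j. (2 powr (- p)) ^ j * (alphas X j)\<^sup>2)"

definition geo_c :: "real \<Rightarrow> real" where
  "geo_c p = 1 / (1 - 2 powr (- p))"

lemma geo_c_pos: "p > 0 \<Longrightarrow> geo_c p > 0"
  by (simp add: geo_c_def powr_less_one)

lemma alphas_bounds: "0 \<le> alphas X j" "alphas X j \<le> 1"
  by (auto simp: alphas_def alpha_trunc_bounds)

lemma square_sum_summable: "p > 0 \<Longrightarrow> summable (\<lambda>j. (2 powr (- p)) ^ j * (alphas X j)\<^sup>2)"
  using alphas_bounds[of X] by (intro summable_scale(2)[of _ _ 1]) (auto intro!: power_le_one)

lemma square_sum_bounds:
  assumes p: "p > 0"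
  shows "0 \<le> square_sum p X" "square_sum p X \<le> geo_c p"
proof -
  have g: "(\<lambda>j. (2 powr (- p)) ^ j) sums geo_c p"
    unfolding geo_c_def using p by (intro geometric_sums) (simp add: powr_less_one)
  show "0 \<le> square_sum p X"
    unfolding square_sum_def by (intro suminf_nonneg square_sum_summable p) auto
  have "square_sum p X \<le> (\<Sum>j. (2 powr (- p)) ^ j)"
    unfolding square_sum_def
    using alphas_bounds[of X] by (intro suminf_le square_sum_summable p sums_summable[OF g] mult_left_le power_le_one) auto
  then show "square_sum p X \<le> geo_c p" using g by (simp add: sums_iff)
qed

lemma alpha_sum_square:
  assumes p: "p > 0"
  shows "(alpha_sum p X)\<^sup>2 \<le> 4 * geo_c p * square_sum p X"
proof -
  let ?t = "2 powr (- p) :: real"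
  have t: "0 \<le> ?t" "?t < 1" using p by (auto simp: powr_less_one)
  have "alpha_sum p X \<le> 2 * (\<Sum>j. ?t ^ j * alphas X j)"
    unfolding alpha_sum_def by (rule smear_sum[OF t alphas_bounds])
  then have "(alpha_sum p X)\<^sup>2 \<le> (2 * (\<Sum>j. ?t ^ j * alphas X j))\<^sup>2"
    using alpha_sum_nonneg[OF p] by (intro power_mono) auto
  also have "\<dots> = 4 * (\<Sum>j. ?t ^ j * alphas X j)\<^sup>2" by (simp add: power_mult_distrib)
  also have "\<dots> \<le> 4 * (geo_c p * square_sum p X)"
    unfolding square_sum_def geo_c_def by (intro mult_left_mono weighted_square_sum t alphas_bounds) simp
  finally show ?thesis by simp
qed

definition grad_c :: "real \<Rightarrow> real \<Rightarrow> real" where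
  "grad_c p p' = (quot_c p p' * field_c p' p)\<^sup>2 * (8 * (geo_c p + geo_c p'))"

lemma grad_c_nonneg: "p > 0 \<Longrightarrow> p' > 0 \<Longrightarrow> grad_c p p' \<ge> 0"
  using geo_c_pos[of p] geo_c_pos[of p'] by (simp add: grad_c_def)

abbreviation ratio_field :: "real \<Rightarrow> real \<Rightarrow> real ^ 'n \<Rightarrow> real ^ 'n" where
  "ratio_field p p' X \<equiv> infdist X \<Gamma> *\<^sub>R gradient (\<lambda>Y. D_dist d \<Gamma> \<sigma> p Y / D_dist d \<Gamma> \<sigma> p' Y) X"

lemma gradient_square_le:
  assumes X: "X \<notin> \<Gamma>" and p: "p > 0" "p' > 0"
  shows "(norm (ratio_field p p' X))\<^sup>2
    \<le> grad_c p p' * (square_sum p X + square_sum p' X)"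
proof -
  let ?A = "alpha_sum p X" and ?B = "alpha_sum p' X"
  have AB: "?A \<ge> 0" "?B \<ge> 0" using alpha_sum_nonneg p by auto
  have "norm (ratio_field p p' X)
      = quot p p' X * norm (infdist X \<Gamma> *\<^sub>R (field p X - field p' X))"
    unfolding gradient_quot[OF X p] using quot_bounds(1)[OF X p]
    by (simp only: norm_scaleR abs_of_nonneg mult_ac)
  \<comment> \<open>\<open>field_diff\<close> bounds the field of its second exponent minus that of
    its first, hence the exchanged order in \<open>field_c p' p\<close>.\<close>
  also have "\<dots> \<le> quot_c p p' * (field_c p' p * (?B + ?A))"
    using quot_bounds[OF X p] field_diff[OF X p(2,1)] by (intro mult_mono) auto
  finally have "(norm (ratio_field p p' X))\<^sup>2
      \<le> (quot_c p p' * (field_c p' p * (?B + ?A)))\<^sup>2"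
    by (intro power_mono) auto
  also have "\<dots> = (quot_c p p' * field_c p' p)\<^sup>2 * (?A + ?B)\<^sup>2"
    by (simp add: power_mult_distrib add.commute)
  also have "\<dots> \<le> (quot_c p p' * field_c p' p)\<^sup>2 * (8 * (geo_c p + geo_c p') * (square_sum p X + square_sum p' X))"
  proof (rule mult_left_mono)
    have "(?A + ?B)\<^sup>2 \<le> 2 * ?A\<^sup>2 + 2 * ?B\<^sup>2"
      using zero_le_power2[of "?A - ?B"] by (simp add: power2_sum power2_diff)
    also have "\<dots> \<le> 2 * (4 * geo_c p * square_sum p X) + 2 * (4 * geo_c p' * square_sum p' X)"
      using alpha_sum_square[OF p(1), of X] alpha_sum_square[OF p(2), of X] by simp
    also have "\<dots> \<le> 8 * (geo_c p + geo_c p') * (square_sum p X + square_sum p' X)"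
    proof -
      have "geo_c p * square_sum p' X \<ge> 0" "geo_c p' * square_sum p X \<ge> 0"
        using geo_c_pos[OF p(1)] geo_c_pos[OF p(2)] square_sum_bounds(1)[OF p(1), of X] square_sum_bounds(1)[OF p(2), of X] by auto
      then show ?thesis by (simp add: algebra_simps)
    qed
    finally show "(?A + ?B)\<^sup>2 \<le> 8 * (geo_c p + geo_c p') * (square_sum p X + square_sum p' X)" .
  qed simp
  finally show ?thesis by (simp add: grad_c_def mult.assoc)
qed

lemma sigma_finite: "sigma_finite_measure \<sigma>"
proof
  obtain x where x: "x \<in> \<Gamma>" using ne by auto
  have "emeasure \<sigma> (ball x (real (Suc n))) \<noteq> \<infinity>" for n
    using upper[OF x, of "real (Suc n)"] by (auto simp: top_unique)
  moreover have "\<exists>n. y \<in> ball x (real (Suc n))" for y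
    using reals_Archimedean2[of "dist x y"] by (metis less_trans lessI mem_ball of_nat_less_iff)
  ultimately show "\<exists>A. countable A \<and> A \<subseteq> sets \<sigma> \<and> \<Union> A = space \<sigma> \<and> (\<forall>a\<in>A. emeasure \<sigma> a \<noteq> \<infinity>)"
    by (intro exI[of _ "range (\<lambda>n. ball x (real (Suc n)))"]) (auto simp: sets space)
qed

lemma riesz_measurable: "riesz p \<in> borel_measurable borel" "riesz_vec p \<in> borel_measurable borel"
proof -
  interpret sigma_finite_measure \<sigma> by (rule sigma_finite)
  show "riesz p \<in> borel_measurable borel" "riesz_vec p \<in> borel_measurable borel"
    unfolding riesz_def[abs_def] riesz_vec_def[abs_def]
    by (intro borel_measurable_lebesgue_integral; measurable)+
qed

text \<open>\<open>gradient\<close> is a definite description, so measurability goes through the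
  explicit formula off \<Gamma>, a Borel function on the whole space.\<close>

lemma gradient_measurable:
  assumes p: "p > 0" "p' > 0"
  shows "(ratio_field p p')
    \<in> borel_measurable (lebesgue_on (- \<Gamma>))"
proof -
  note [measurable] = riesz_measurable
  have "(\<lambda>X. infdist X \<Gamma>) \<in> borel_measurable borel"
    by (intro borel_measurable_continuous_onI continuous_intros)
  then have "(\<lambda>X. infdist X \<Gamma> *\<^sub>R (quot p p' X *\<^sub>R (field p X - field p' X))) \<in> borel_measurable borel"
    unfolding quot_def field_def by measurable
  then have "(\<lambda>X. infdist X \<Gamma> *\<^sub>R (quot p p' X *\<^sub>R (field p X - field p' X))) \<in> borel_measurable (lebesgue_on (- \<Gamma>))"
    by (intro measurable_restrict_space1 measurable_completion) simp
  moreover have "ratio_field p p' X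
      = infdist X \<Gamma> *\<^sub>R (quot p p' X *\<^sub>R (field p X - field p' X))" if "X \<in> space (lebesgue_on (- \<Gamma>))" for X
    using that gradient_quot[OF _ p, of X] by simp
  ultimately show ?thesis by (subst measurable_cong)
qed

end

section \<open>The Carleson estimate\<close>

lemma Lip_mono: "ball x' s' \<subseteq> ball x s \<Longrightarrow> Lip x' s' \<subseteq> Lip x s"
  unfolding Lip_def by blast

text \<open>Each flat measure competes in both infima, and test functions for the smaller ball are
  test functions for the larger one. Only the normalisations differ, by at most 4^(d+1).\<close>

lemma alpha_number_mono:
  fixes x x' :: "real ^ 'n"
  assumes sub: "ball x' s' \<subseteq> ball x s" and s: "0 < s'" "s \<le> 4 * s'" "0 < s"
  shows "ennreal (1 / 4 ^ (d + 1)) * alpha_number d \<sigma> x' s' \<le> alpha_number d \<sigma> x s"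
  unfolding alpha_number_def[of d \<sigma> x s]
proof (rule INF_greatest)
  fix \<mu> :: "(real ^ 'n) measure" assume \<mu>: "\<mu> \<in> flat_measures d"
  have "(1 / 4 ^ (d + 1)) * (1 / s' ^ (d + 1)) \<le> 1 / s ^ (d + 1)"
  proof -
    have "s ^ (d + 1) \<le> (4 * s') ^ (d + 1)" using s by (intro power_mono) auto
    then have "1 / (4 * s') ^ (d + 1) \<le> 1 / s ^ (d + 1)" using s by (intro divide_left_mono) auto
    then show ?thesis by (simp add: power_mult_distrib mult_ac)
  qed
  then have c: "ennreal (1 / 4 ^ (d + 1)) * ennreal (1 / s' ^ (d + 1)) \<le> ennreal (1 / s ^ (d + 1))"
    using s by (subst ennreal_mult'[symmetric]) (auto intro!: ennreal_leI)
  have "ennreal (1 / 4 ^ (d + 1)) * alpha_number d \<sigma> x' s' \<le> ennreal (1 / 4 ^ (d + 1)) * dist_measures d x' s' \<mu> \<sigma>"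
    unfolding alpha_number_def using \<mu> by (intro mult_left_mono INF_lower) auto
  also have "\<dots> \<le> dist_measures d x s \<mu> \<sigma>"
    unfolding dist_measures_def mult.assoc[symmetric]
    by (intro mult_mono c SUP_subset_mono Lip_mono[OF sub]) auto
  finally show "ennreal (1 / 4 ^ (d + 1)) * alpha_number d \<sigma> x' s' \<le> dist_measures d x s \<mu> \<sigma>" .
qed

text \<open>
  The \<open>\<alpha>\<close>-numbers are not known to be measurable. Their supremum over an open range of nearby balls
  is lower semicontinuous, and still bounded by an \<open>\<alpha>\<close>-number of a larger ball.
\<close>

definition alpha_hull :: "nat \<Rightarrow> (real ^ 'n) measure \<Rightarrow> real \<times> (real ^ 'n) \<Rightarrow> ennreal" where
  "alpha_hull d \<sigma> z = (SUP w \<in> {w. dist (snd z) (snd w) < fst z / 2 \<and> fst z / 4 < fst w \<and> fst w < fst z / 2}.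
      alpha_number d \<sigma> (snd w) (fst w))"

lemma alpha_hull_measurable [measurable]: "alpha_hull d \<sigma> \<in> borel_measurable borel"
proof (rule borel_measurableI_greater)
  fix t
  have eq: "{z \<in> UNIV. t < alpha_hull d \<sigma> z} = (\<Union>w \<in> {w. t < alpha_number d \<sigma> (snd w) (fst w)}.
      {z. dist (snd z) (snd w) < fst z / 2 \<and> fst z / 4 < fst w \<and> fst w < fst z / 2})"
    unfolding alpha_hull_def less_SUP_iff by blast
  have op: "open {z :: real \<times> (real ^ 'n). dist (snd z) (snd w) < fst z / 2 \<and> fst z / 4 < fst w \<and> fst w < fst z / 2}"
    for w :: "real \<times> (real ^ 'n)"
    by (intro open_Collect_conj open_Collect_less continuous_intros) auto
  have "open {z \<in> UNIV. t < alpha_hull d \<sigma> z}" unfolding eq by (intro open_UN ballI op)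
  then show "{z \<in> Sigma_Algebra.space borel. t < alpha_hull d \<sigma> z} \<in> sets borel"
    unfolding space_borel by (rule borel_open)
qed

text \<open>The range in \<open>alpha_hull\<close> fits \<open>alpha_number_mono\<close>: centre
  within s / 2 and radius below s / 2 put the ball inside \<open>ball y s\<close>, and a radius
  above s / 4 keeps the ratio below 4.\<close>

lemma alpha_hull_le:
  assumes s: "s > 0"
  shows "ennreal (1 / 4 ^ (d + 1)) * alpha_hull d \<sigma> (s, y) \<le> alpha_number d \<sigma> y s"
proof -
  have "ennreal (1 / 4 ^ (d + 1)) * alpha_number d \<sigma> (snd w) (fst w) \<le> alpha_number d \<sigma> y s"
    if w: "dist y (snd w) < s / 2" "s / 4 < fst w" "fst w < s / 2" for w
  proof (rule alpha_number_mono)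
    show "ball (snd w) (fst w) \<subseteq> ball y s"
    proof
      fix v assume "v \<in> ball (snd w) (fst w)"
      then show "v \<in> ball y s" using dist_triangle[of y v "snd w"] w by simp
    qed
  qed (use w s in auto)
  then show ?thesis
    unfolding alpha_hull_def fst_conv snd_conv
    by (cases "{w. dist y (snd w) < s / 2 \<and> s / 4 < fst w \<and> fst w < s / 2} = {}")
       (auto simp: SUP_mult_left_ennreal intro!: SUP_least)
qed

definition hull_square :: "nat \<Rightarrow> (real ^ 'n) measure \<Rightarrow> real \<times> (real ^ 'n) \<Rightarrow> ennreal" where
  "hull_square d \<sigma> z = (min 1 (alpha_hull d \<sigma> z))\<^sup>2"

lemma hull_square_measurable [measurable]: "hull_square d \<sigma> \<in> borel_measurable borel"
  unfolding hull_square_def by measurable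

lemma hull_square_le_1: "hull_square d \<sigma> z \<le> 1"
  unfolding hull_square_def by (rule power_le_one) auto

lemma hull_square_le:
  assumes s: "s > 0"
  shows "ennreal (1 / 16 ^ (d + 1)) * hull_square d \<sigma> (s, y) \<le> (alpha_number d \<sigma> y s)\<^sup>2"
proof -
  have "(1 / 16 ^ (d + 1) :: real) = (1 / 4 ^ (d + 1))\<^sup>2"
    using power_mult_distrib[of "4::real" 4 "d + 1"] by (simp add: power2_eq_square)
  then have "ennreal (1 / 16 ^ (d + 1)) = (ennreal (1 / 4 ^ (d + 1)))\<^sup>2"
    by (simp only: ennreal_power) (simp add: ennreal_power)
  then have "ennreal (1 / 16 ^ (d + 1)) * hull_square d \<sigma> (s, y) = (ennreal (1 / 4 ^ (d + 1)) * min 1 (alpha_hull d \<sigma> (s, y)))\<^sup>2"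
    unfolding hull_square_def by (simp only: power_mult_distrib)
  also have "\<dots> \<le> (alpha_number d \<sigma> y s)\<^sup>2"
    by (intro power_mono order_trans[OF mult_left_mono alpha_hull_le[OF s]]) auto
  finally show ?thesis .
qed

section \<open>Integrals of the hull over strips of radii\<close>

context ahlfors
begin

abbreviation \<tau> :: "(real \<times> (real ^ 'n)) measure" where
  "\<tau> \<equiv> lborel \<Otimes>\<^sub>M \<sigma>"

lemma measurable_pair [measurable_cong]: "sets \<tau> = sets (borel :: (real \<times> (real ^ 'n)) measure)"
  unfolding borel_prod[symmetric] by (intro sets_pair_measure_cong) (auto simp: sets)

lemma borel_fst_snd [measurable]:
  "(fst :: real \<times> (real ^ 'n) \<Rightarrow> real) \<in> borel_measurable borel"
  "(snd :: real \<times> (real ^ 'n) \<Rightarrow> real ^ 'n) \<in> borel_measurable borel"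
  by (intro borel_measurable_continuous_onI continuous_intros)+

lemma ball_measurable [measurable]: "Measurable.pred borel (\<lambda>y :: real ^ 'n. y \<in> ball x r)"
  unfolding pred_def by (simp add: borel_open)

text \<open>The integral over \<alpha>-numbers in the hypothesis may be one of a non-measurable
  function, but it is monotone all the same; the measurable hull is placed below its
  integrand.\<close>

lemma hull_carleson:
  assumes ur: "uniformly_rectifiable d C0 \<Gamma> \<sigma>" and x: "x \<in> \<Gamma>" and r: "r > 0"
  shows "(\<integral>\<^sup>+s. (\<integral>\<^sup>+y. hull_square d \<sigma> (s, y) * indicator (ball x r) y \<partial>\<sigma>) * ennreal (1 / s) * indicator {0<..<r} s \<partial>lborel)
    \<le> ennreal (16 ^ (d + 1) * C0 * C * r ^ d)" (is "?I \<le> _")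
proof -
  interpret sigma_finite_measure \<sigma> by (rule sigma_finite)
  let ?k = "ennreal (1 / 16 ^ (d + 1))"
  have C0: "C0 \<ge> 0" using ur by (simp add: uniformly_rectifiable_def)
  have "(\<lambda>z. hull_square d \<sigma> z * indicator (ball x r) (snd z)) \<in> borel_measurable \<tau>"
    by measurable
  then have m: "(\<lambda>s. \<integral>\<^sup>+y. hull_square d \<sigma> (s, y) * indicator (ball x r) y \<partial>\<sigma>) \<in> borel_measurable lborel"
    using borel_measurable_nn_integral_fst[of "\<lambda>z. hull_square d \<sigma> z * indicator (ball x r) (snd z)" lborel] by simp
  have "(\<lambda>s. (\<integral>\<^sup>+y. hull_square d \<sigma> (s, y) * indicator (ball x r) y \<partial>\<sigma>) * ennreal (1 / s) * indicator {0<..<r} s) \<in> borel_measurable lborel"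
    using m by measurable
  then have "?k * ?I = (\<integral>\<^sup>+s. ?k * ((\<integral>\<^sup>+y. hull_square d \<sigma> (s, y) * indicator (ball x r) y \<partial>\<sigma>) * ennreal (1 / s) * indicator {0<..<r} s) \<partial>lborel)"
    by (rule nn_integral_cmult[symmetric])
  also have "\<dots> \<le> (\<integral>\<^sup>+s\<in>{0<..<r}. (\<integral>\<^sup>+y\<in>\<Gamma> \<inter> ball x r. (alpha_number d \<sigma> y s)\<^sup>2 \<partial>\<sigma>) * ennreal (1 / s) \<partial>lborel)"
  proof (rule nn_integral_mono)
    fix s
    show "?k * ((\<integral>\<^sup>+y. hull_square d \<sigma> (s, y) * indicator (ball x r) y \<partial>\<sigma>) * ennreal (1 / s) * indicator {0<..<r} s)
      \<le> (\<integral>\<^sup>+y\<in>\<Gamma> \<inter> ball x r. (alpha_number d \<sigma> y s)\<^sup>2 \<partial>\<sigma>) * ennreal (1 / s) * indicator {0<..<r} s"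
    proof (cases "s \<in> {0<..<r}")
      case True
      have "?k * (\<integral>\<^sup>+y. hull_square d \<sigma> (s, y) * indicator (ball x r) y \<partial>\<sigma>)
          = (\<integral>\<^sup>+y. ?k * (hull_square d \<sigma> (s, y) * indicator (ball x r) y) \<partial>\<sigma>)"
        by (rule nn_integral_cmult[symmetric]) measurable
      also have "\<dots> \<le> (\<integral>\<^sup>+y\<in>\<Gamma> \<inter> ball x r. (alpha_number d \<sigma> y s)\<^sup>2 \<partial>\<sigma>)"
      proof (rule nn_integral_mono_AE)
        show "AE y in \<sigma>. ?k * (hull_square d \<sigma> (s, y) * indicator (ball x r) y)
            \<le> (alpha_number d \<sigma> y s)\<^sup>2 * indicator (\<Gamma> \<inter> ball x r) y"
          using AE_support
        proof eventually_elim
          case (elim y)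
          then show ?case using hull_square_le[of s d \<sigma> y] True by (auto simp: indicator_def)
        qed
      qed
      finally show ?thesis
        unfolding mult.assoc[symmetric] by (intro mult_right_mono) auto
    qed simp
  qed
  also have "\<dots> \<le> ennreal C0 * emeasure \<sigma> (ball x r)"
    using ur x r unfolding uniformly_rectifiable_def by blast
  also have "\<dots> \<le> ennreal C0 * ennreal (C * r ^ d)"
    by (intro mult_left_mono upper x r) auto
  finally have le: "?k * ?I \<le> ennreal (C0 * (C * r ^ d))"
    using C0 by (simp add: ennreal_mult')
  have "?I = ennreal (16 ^ (d + 1)) * (?k * ?I)"
    by (simp only: mult.assoc[symmetric] ennreal_mult'[symmetric] zero_le_power zero_le_numeral) simp
  also have "\<dots> \<le> ennreal (16 ^ (d + 1)) * ennreal (C0 * (C * r ^ d))"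
    by (intro mult_left_mono le) auto
  also have "\<dots> = ennreal (16 ^ (d + 1) * C0 * C * r ^ d)"
    by (simp only: ennreal_mult'[symmetric] zero_le_power zero_le_numeral mult.assoc)
  finally show ?thesis .
qed

text \<open>Radii below 3r fall under uniform rectifiability in \<open>ball x (3 * r)\<close>.
  Above, the integrand is at most 1 / s and each slice has measure at most C (3r)^d, so what remains
  is the logarithm of 8 * 2^j / 3, less than j + 3.\<close>

lemma hull_strip:
  assumes ur: "uniformly_rectifiable d C0 \<Gamma> \<sigma>" and x: "x \<in> \<Gamma>" and r: "r > 0"
  shows "(\<integral>\<^sup>+z. hull_square d \<sigma> z * ennreal (1 / fst z) * indicator ({0<..<8 * 2 ^ j * r} \<times> ball x (3 * r)) z \<partial>\<tau>)
    \<le> ennreal (C * (3 * r) ^ d * (16 ^ (d + 1) * C0 + real j + 3))"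
proof -
  interpret sigma_finite_measure \<sigma> by (rule sigma_finite)
  have C0: "C0 \<ge> 0" using ur by (simp add: uniformly_rectifiable_def)
  define T where "T = 8 * 2 ^ j * r"
  have T: "T \<ge> 3 * r" "T > 0"
  proof -
    have "3 * r \<le> 8 * (1 * r)" using r by simp
    also have "\<dots> \<le> 8 * (2 ^ j * r)" using r by (intro mult_left_mono mult_right_mono) auto
    finally show "T \<ge> 3 * r" by (simp add: T_def)
    then show "T > 0" using r by linarith
  qed
  let ?J = "\<lambda>s. \<integral>\<^sup>+y. hull_square d \<sigma> (s, y) * indicator (ball x (3 * r)) y \<partial>\<sigma>"
  have "(\<lambda>z. hull_square d \<sigma> z * indicator (ball x (3 * r)) (snd z)) \<in> borel_measurable \<tau>"
    by measurable
  then have J [measurable]: "?J \<in> borel_measurable lborel"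
    using borel_measurable_nn_integral_fst[of "\<lambda>z. hull_square d \<sigma> z * indicator (ball x (3 * r)) (snd z)" lborel] by simp
  let ?f = "\<lambda>z. hull_square d \<sigma> z * ennreal (1 / fst z) * indicator ({0<..<T} \<times> ball x (3 * r)) z"
  have f: "?f \<in> borel_measurable \<tau>"
  proof -
    have [measurable]: "{0<..<T} \<times> ball x (3 * r) \<in> sets borel" by (intro borel_open open_Times) auto
    have "?f \<in> borel_measurable borel" by measurable
    then show ?thesis by (simp add: measurable_cong_sets[OF measurable_pair refl])
  qed
  have tail: "?J s \<le> ennreal (C * (3 * r) ^ d)" for s
  proof -
    have "?J s \<le> (\<integral>\<^sup>+y. indicator (ball x (3 * r)) y \<partial>\<sigma>)"
      using mult_right_mono[OF hull_square_le_1] by (intro nn_integral_mono) fastforce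
    also have "\<dots> = emeasure \<sigma> (ball x (3 * r))" by (rule nn_integral_indicator) (simp add: sets)
    also have "\<dots> \<le> ennreal (C * (3 * r) ^ d)" using r by (intro upper x) auto
    finally show ?thesis .
  qed
  have "integral\<^sup>N \<tau> ?f = (\<integral>\<^sup>+s. \<integral>\<^sup>+y. ?f (s, y) \<partial>\<sigma> \<partial>lborel)"
    by (rule nn_integral_fst[OF f, symmetric])
  also have "\<dots> = (\<integral>\<^sup>+s. ?J s * ennreal (1 / s) * indicator {0<..<T} s \<partial>lborel)"
  proof (rule nn_integral_cong)
    fix s
    have "(\<integral>\<^sup>+y. ?f (s, y) \<partial>\<sigma>) = (\<integral>\<^sup>+y. hull_square d \<sigma> (s, y) * indicator (ball x (3 * r)) y * (ennreal (1 / s) * indicator {0<..<T} s) \<partial>\<sigma>)"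
      by (intro nn_integral_cong) (simp add: indicator_times mult_ac)
    also have "\<dots> = ?J s * (ennreal (1 / s) * indicator {0<..<T} s)"
      by (rule nn_integral_multc) measurable
    finally show "(\<integral>\<^sup>+y. ?f (s, y) \<partial>\<sigma>) = ?J s * ennreal (1 / s) * indicator {0<..<T} s" by (simp add: mult.assoc)
  qed
  also have "\<dots> \<le> (\<integral>\<^sup>+s. ?J s * ennreal (1 / s) * indicator {0<..<3 * r} s
      + ennreal (C * (3 * r) ^ d) * (ennreal (1 / s) * indicator {3 * r..T} s) \<partial>lborel)"
  proof (rule nn_integral_mono)
    fix s
    have "?J s * ennreal (1 / s) \<le> ennreal (C * (3 * r) ^ d) * ennreal (1 / s)"
      by (intro mult_right_mono tail) auto
    then show "?J s * ennreal (1 / s) * indicator {0<..<T} s \<le> ?J s * ennreal (1 / s) * indicator {0<..<3 * r} s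
      + ennreal (C * (3 * r) ^ d) * (ennreal (1 / s) * indicator {3 * r..T} s)"
      by (auto simp: indicator_def)
  qed
  also have "\<dots> = (\<integral>\<^sup>+s. ?J s * ennreal (1 / s) * indicator {0<..<3 * r} s \<partial>lborel)
      + ennreal (C * (3 * r) ^ d) * (\<integral>\<^sup>+s. ennreal (1 / s) * indicator {3 * r..T} s \<partial>lborel)"
    by (subst nn_integral_add; (subst nn_integral_cmult)?; measurable)
  also have "(\<integral>\<^sup>+s. ennreal (1 / s) * indicator {3 * r..T} s \<partial>lborel) = ennreal (ln T - ln (3 * r))"
    using r T by (subst nn_integral_FTC_Icc[of _ _ _ ln]) (auto intro!: derivative_eq_intros)
  also have "(\<integral>\<^sup>+s. ?J s * ennreal (1 / s) * indicator {0<..<3 * r} s \<partial>lborel) \<le> ennreal (16 ^ (d + 1) * C0 * C * (3 * r) ^ d)"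
    using r by (intro hull_carleson[OF ur x]) simp
  also have "ennreal (C * (3 * r) ^ d) * ennreal (ln T - ln (3 * r)) \<le> ennreal (C * (3 * r) ^ d) * ennreal (real j + 3)"
  proof (intro mult_left_mono ennreal_leI)
    have "ln T - ln (3 * r) = ln (T / (3 * r))" using r T by (simp add: ln_div)
    also have "\<dots> \<le> ln (2 ^ (j + 3))" using r by (subst ln_le_cancel_iff) (auto simp: T_def power_add)
    also have "\<dots> = real (j + 3) * ln 2" by (rule ln_realpow)
    also have "\<dots> \<le> real (j + 3) * 1" using ln_2_less_1 by (intro mult_left_mono) auto
    finally show "ln T - ln (3 * r) \<le> real j + 3" by simp
  qed auto
  also have "ennreal (16 ^ (d + 1) * C0 * C * (3 * r) ^ d) + ennreal (C * (3 * r) ^ d) * ennreal (real j + 3)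
      = ennreal (C * (3 * r) ^ d * (16 ^ (d + 1) * C0 + real j + 3))"
    using C C0 r by (simp add: ennreal_mult'[symmetric] ennreal_plus[symmetric] algebra_simps del: ennreal_plus)
  finally show ?thesis unfolding T_def by (simp add: add_mono)
qed

end

section \<open>Averages over nearby balls and exchange of integrals\<close>

context ahlfors
begin

text \<open>The pairs z = (s, y) for which the ball at X of radius 2 scale X j is in the range of
  \<open>alpha_hull\<close> at z: 2 scale lies strictly between s / 4 and s / 2, and |X - y| < 2
  \<delta> \<le> 2 scale < s / 2.\<close>

definition band :: "nat \<Rightarrow> real ^ 'n \<Rightarrow> (real \<times> (real ^ 'n)) set" where
  "band j X = {4 * scale X j<..<8 * scale X j} \<times> ball X (2 * infdist X \<Gamma>)"

text \<open>The factor compensates for the size of the band: its measure is at least 4 scale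
  \<delta>^d / C, and 1 / s exceeds 1 / (8 scale) on it. With 2 C \<delta>^(-n) the integral is then
  at least \<delta>^(d-n) times the squared \<alpha>-number.\<close>

definition weight :: "nat \<Rightarrow> real ^ 'n \<Rightarrow> real \<times> (real ^ 'n) \<Rightarrow> ennreal" where
  "weight j X z = ennreal (2 * C * infdist X \<Gamma> powr (- real CARD('n))) * indicator (band j X) z
     * (hull_square d \<sigma> z * ennreal (1 / fst z))"

lemma alphas_le_hull:
  assumes X: "X \<notin> \<Gamma>" and z: "z \<in> band j X"
  shows "ennreal ((alphas X j)\<^sup>2) \<le> hull_square d \<sigma> z"
proof -
  have z': "4 * scale X j < fst z" "fst z < 8 * scale X j" "dist X (snd z) < 2 * infdist X \<Gamma>"
    using z by (auto simp: band_def)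
  have "alpha_number d \<sigma> X (2 * scale X j) \<le> alpha_hull d \<sigma> z"
    unfolding alpha_hull_def
    using z' scale(2)[OF X, of j] by (intro SUP_upper2[of "(2 * scale X j, X)"]) (auto simp: dist_commute)
  then have "min 1 (alpha_number d \<sigma> X (2 * scale X j)) \<le> min 1 (alpha_hull d \<sigma> z)"
    by (intro min.mono) auto
  moreover have "ennreal (alphas X j) = min 1 (alpha_number d \<sigma> X (2 * scale X j))"
    unfolding alphas_def alpha_trunc_def by (rule ennreal_enn2real) (auto simp: min_less_iff_disj)
  ultimately have "(ennreal (alphas X j))\<^sup>2 \<le> hull_square d \<sigma> z"
    unfolding hull_square_def by (intro power_mono) auto
  then show ?thesis using alphas_bounds by (simp add: ennreal_power)
qed

lemma alphas_le_average:
  assumes X: "X \<notin> \<Gamma>"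
  shows "ennreal ((alphas X j)\<^sup>2 * infdist X \<Gamma> powr (real d - real CARD('n))) \<le> (\<integral>\<^sup>+z. weight j X z \<partial>\<tau>)"
proof -
  interpret sigma_finite_measure \<sigma> by (rule sigma_finite)
  let ?\<delta> = "infdist X \<Gamma>" and ?n = "real CARD('n)"
  have \<delta>: "?\<delta> > 0" by (rule infdist_pos[OF X])
  have s: "scale X j > 0" by (rule scale(1)[OF X])
  let ?a = "(alphas X j)\<^sup>2"
  let ?c = "2 * C * ?\<delta> powr (- ?n) * ?a * (1 / (8 * scale X j))"
  have "ennreal (?\<delta> ^ d / C) \<le> emeasure \<sigma> (ball X (2 * ?\<delta>))"
  proof -
    obtain x where x: "x \<in> \<Gamma>" "dist X x = ?\<delta>" by (rule nearest)
    have "ball x ?\<delta> \<subseteq> ball X (2 * ?\<delta>)"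
    proof
      fix y assume "y \<in> ball x ?\<delta>"
      then show "y \<in> ball X (2 * ?\<delta>)" using dist_triangle[of X y x] x by simp
    qed
    then have "emeasure \<sigma> (ball x ?\<delta>) \<le> emeasure \<sigma> (ball X (2 * ?\<delta>))"
      by (intro emeasure_mono) (auto simp: sets)
    then show ?thesis using lower[OF x(1) \<delta>] by (rule order_trans[rotated])
  qed
  then have "ennreal (4 * scale X j) * ennreal (?\<delta> ^ d / C) \<le> ennreal (4 * scale X j) * emeasure \<sigma> (ball X (2 * ?\<delta>))"
    by (rule mult_left_mono) simp
  also have "\<dots> = emeasure \<tau> (band j X)"
    unfolding band_def using s by (subst emeasure_pair_measure_Times) (auto simp: sets)
  finally have band: "ennreal (4 * scale X j) * ennreal (?\<delta> ^ d / C) \<le> emeasure \<tau> (band j X)" .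
  have "?a * ?\<delta> powr (real d - ?n) = ?c * (4 * scale X j * (?\<delta> ^ d / C))"
  proof -
    have "?\<delta> powr (real d - ?n) = ?\<delta> powr (- ?n) * ?\<delta> ^ d"
      using \<delta> by (simp add: powr_realpow[symmetric] powr_add[symmetric])
    then show ?thesis using s C by (simp add: field_simps)
  qed
  then have "ennreal (?a * ?\<delta> powr (real d - ?n)) = ennreal ?c * (ennreal (4 * scale X j) * ennreal (?\<delta> ^ d / C))"
    using s C \<delta> by (simp add: ennreal_mult'[symmetric])
  also have "\<dots> \<le> ennreal ?c * emeasure \<tau> (band j X)"
    by (intro mult_left_mono band) auto
  also have "\<dots> = (\<integral>\<^sup>+z. ennreal ?c * indicator (band j X) z \<partial>\<tau>)"
    by (rule nn_integral_cmult_indicator[symmetric]) (auto simp: band_def measurable_pair intro!: borel_open open_Times)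
  also have "\<dots> \<le> (\<integral>\<^sup>+z. weight j X z \<partial>\<tau>)"
  proof (rule nn_integral_mono)
    fix z
    show "ennreal ?c * indicator (band j X) z \<le> weight j X z"
    proof (cases "z \<in> band j X")
      case True
      have f: "1 / (8 * scale X j) \<le> 1 / fst z"
        using True s by (intro divide_left_mono) (auto simp: band_def)
      have "ennreal ?c = ennreal (2 * C * ?\<delta> powr (- ?n)) * (ennreal ?a * ennreal (1 / (8 * scale X j)))"
        using s C by (simp add: ennreal_mult'[symmetric] mult_ac)
      also have "\<dots> \<le> ennreal (2 * C * ?\<delta> powr (- ?n)) * (hull_square d \<sigma> z * ennreal (1 / fst z))"
        by (intro mult_left_mono mult_mono alphas_le_hull[OF X True] ennreal_leI f) auto
      finally show ?thesis using True by (simp add: weight_def)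
    qed simp
  qed
  finally show ?thesis .
qed

lemma weight_measurable: "case_prod (weight j) \<in> borel_measurable (borel :: ((real ^ 'n) \<times> (real \<times> (real ^ 'n))) measure)"
proof -
  let ?W = "{w :: (real ^ 'n) \<times> (real \<times> (real ^ 'n)). 4 * scale (fst w) j < fst (snd w) \<and> fst (snd w) < 8 * scale (fst w) j
      \<and> dist (fst w) (snd (snd w)) < 2 * infdist (fst w) \<Gamma>}"
  have "open ?W"
    unfolding scale_def by (intro open_Collect_conj open_Collect_less continuous_intros)
  then have [measurable]: "?W \<in> sets borel" by (rule borel_open)
  have [measurable]: "(\<lambda>w :: (real ^ 'n) \<times> (real \<times> (real ^ 'n)). infdist (fst w) \<Gamma>) \<in> borel_measurable borel"
    "(\<lambda>w :: (real ^ 'n) \<times> (real \<times> (real ^ 'n)). fst (snd w)) \<in> borel_measurable borel"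
    "(\<lambda>w :: (real ^ 'n) \<times> (real \<times> (real ^ 'n)). snd w) \<in> borel_measurable borel"
    by (intro borel_measurable_continuous_onI continuous_intros)+
  have [measurable]: "(\<lambda>w. hull_square d \<sigma> (snd w)) \<in> borel_measurable (borel :: ((real ^ 'n) \<times> (real \<times> (real ^ 'n))) measure)"
    by (rule measurable_compose[OF _ hull_square_measurable]) measurable
  have "(\<lambda>w. ennreal (2 * C * infdist (fst w) \<Gamma> powr (- real CARD('n))) * indicator ?W w
     * (hull_square d \<sigma> (snd w) * ennreal (1 / fst (snd w)))) \<in> borel_measurable borel"
    by measurable
  moreover have "case_prod (weight j) = (\<lambda>w. ennreal (2 * C * infdist (fst w) \<Gamma> powr (- real CARD('n))) * indicator ?W w
     * (hull_square d \<sigma> (snd w) * ennreal (1 / fst (snd w))))"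
    by (auto simp: weight_def band_def indicator_def fun_eq_iff)
  ultimately show ?thesis by simp
qed

definition vol_c :: real where
  "vol_c = 2 * C * 4 ^ CARD('n) * unit_ball_vol (real CARD('n))"

lemma vol_c_nonneg: "vol_c \<ge> 0"
  using C by (simp add: vol_c_def)

text \<open>For fixed z = (s, y) the admissible X have comparable \<delta> and lie in a ball around
  y with radius comparable to \<delta>; its volume cancels \<delta>^(-n). As \<delta> < r for X in
  \<open>ball x r\<close>, the pair satisfies s < 8 * 2^j r and |x - y| < r + 2 \<delta> <
  3r.\<close>

lemma integral_weight_le:
  assumes x: "x \<in> \<Gamma>" and r: "r > 0"
  shows "(\<integral>\<^sup>+X. weight j X z * indicator (ball x r - \<Gamma>) X \<partial>lborel)
    \<le> ennreal vol_c * (hull_square d \<sigma> z * ennreal (1 / fst z) * indicator ({0<..<8 * 2 ^ j * r} \<times> ball x (3 * r)) z)"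
proof (cases "fst z > 0")
  case False
  have 0: "weight j X z * indicator (ball x r - \<Gamma>) X = 0" for X
    using False infdist_nonneg[of X \<Gamma>]
    by (auto simp: weight_def band_def indicator_def scale_def)
  show ?thesis unfolding 0 by simp
next
  case True
  \<comment> \<open>The two bounds on s in the band say t / 2 < \<delta> < t.\<close>
  define t where "t = fst z / (4 * 2 ^ j)"
  have t: "t > 0" using True by (simp add: t_def)
  let ?n = "CARD('n)"
  let ?h = "hull_square d \<sigma> z * ennreal (1 / fst z) * indicator ({0<..<8 * 2 ^ j * r} \<times> ball x (3 * r)) z"
  have "weight j X z * indicator (ball x r - \<Gamma>) X
      \<le> ennreal (2 * C * (t / 2) powr (- real ?n)) * ?h * indicator (ball (snd z) (2 * t)) X" for X
  proof (cases "X \<in> ball x r - \<Gamma> \<and> z \<in> band j X")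
    case False
    then show ?thesis by (auto simp: weight_def indicator_def)
  next
    case True
    let ?\<delta> = "infdist X \<Gamma>"
    have z: "4 * (2 ^ j * ?\<delta>) < fst z" "fst z < 8 * (2 ^ j * ?\<delta>)" "dist X (snd z) < 2 * ?\<delta>"
      using True by (auto simp: band_def scale_def)
    have \<delta>: "?\<delta> < t" "t / 2 < ?\<delta>" using z by (auto simp: t_def field_simps)
    have "?\<delta> \<le> dist x X" using infdist_le[OF x, of X] by (simp add: dist_commute)
    then have \<delta>r: "?\<delta> < r" "dist x X < r" using True by auto
    have "2 ^ j * ?\<delta> < 2 ^ j * r" using \<delta>r by simp
    then have "fst z < 8 * (2 ^ j * r)" using z(2) by linarith
    then have "fst z < 8 * 2 ^ j * r" by (simp only: mult.assoc)
    moreover have "dist x (snd z) < 3 * r" using dist_triangle[of x "snd z" X] \<delta>r z(3) by simp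
    ultimately have zi: "z \<in> {0<..<8 * 2 ^ j * r} \<times> ball x (3 * r)"
      using \<open>fst z > 0\<close> by (cases z) auto
    have Xi: "X \<in> ball (snd z) (2 * t)" using z(3) \<delta> by (simp add: dist_commute)
    have "?\<delta> powr (- real ?n) \<le> (t / 2) powr (- real ?n)" using \<delta> t by (intro powr_mono2') auto
    then have "2 * C * ?\<delta> powr (- real ?n) \<le> 2 * C * (t / 2) powr (- real ?n)" using C by simp
    then show ?thesis
      using True zi Xi by (simp add: weight_def ennreal_leI mult_right_mono)
  qed
  then have "(\<integral>\<^sup>+X. weight j X z * indicator (ball x r - \<Gamma>) X \<partial>lborel)
      \<le> (\<integral>\<^sup>+X. ennreal (2 * C * (t / 2) powr (- real ?n)) * ?h * indicator (ball (snd z) (2 * t)) X \<partial>lborel)"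
    by (intro nn_integral_mono)
  also have "\<dots> = ennreal (2 * C * (t / 2) powr (- real ?n)) * ?h * emeasure lborel (ball (snd z) (2 * t))"
    by (rule nn_integral_cmult_indicator) simp
  also have "emeasure lborel (ball (snd z) (2 * t)) = ennreal (unit_ball_vol (real ?n) * (2 * t) ^ ?n)"
    using t by (subst emeasure_ball) auto
  also have "ennreal (2 * C * (t / 2) powr (- real ?n)) * ?h * ennreal (unit_ball_vol (real ?n) * (2 * t) ^ ?n)
      = ennreal (2 * C * (t / 2) powr (- real ?n) * (unit_ball_vol (real ?n) * (2 * t) ^ ?n)) * ?h"
    using t C by (subst (2) ennreal_mult') (auto simp: mult_ac)
  also have "2 * C * (t / 2) powr (- real ?n) * (unit_ball_vol (real ?n) * (2 * t) ^ ?n) = vol_c"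
  proof -
    have "(t / 2) powr (- real ?n) = 1 / (t / 2) ^ ?n"
      using t by (simp only: powr_minus_divide) (simp add: powr_realpow)
    moreover have "(2 * t) ^ ?n = 4 ^ ?n * (t / 2) ^ ?n"
    proof -
      have "2 * t = 4 * (t / 2)" by simp
      then show ?thesis by (simp only: power_mult_distrib)
    qed
    moreover have "2 * C * (1 / A) * (u * (k * A)) = 2 * C * k * u" if "A > 0" for A u k :: real
      using that by simp
    ultimately show ?thesis using t by (simp only: vol_c_def) (simp only: zero_less_power half_gt_zero_iff)
  qed
  finally show ?thesis .
qed

lemma integral_average_le:
  assumes ur: "uniformly_rectifiable d C0 \<Gamma> \<sigma>" and x: "x \<in> \<Gamma>" and r: "r > 0"
  shows "(\<integral>\<^sup>+X. (\<integral>\<^sup>+z. weight j X z \<partial>\<tau>) * indicator (ball x r - \<Gamma>) X \<partial>lborel)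
    \<le> ennreal (vol_c * (C * (3 * r) ^ d * (16 ^ (d + 1) * C0 + real j + 3)))"
proof -
  interpret S: sigma_finite_measure \<sigma> by (rule sigma_finite)
  interpret P: pair_sigma_finite lborel \<sigma> ..
  interpret T: sigma_finite_measure \<tau> by (rule P.sigma_finite_measure_axioms)
  interpret Q: pair_sigma_finite lborel \<tau> ..
  have sets3: "sets (lborel \<Otimes>\<^sub>M \<tau>) = sets (borel :: ((real ^ 'n) \<times> (real \<times> (real ^ 'n))) measure)"
    unfolding borel_prod[symmetric, where 'a = "real ^ 'n" and 'b = "real \<times> (real ^ 'n)"]
    by (rule sets_pair_measure_cong[OF sets_lborel measurable_pair])
  have "(\<lambda>(X, z). weight j X z * indicator (ball x r - \<Gamma>) X) \<in> borel_measurable (borel :: ((real ^ 'n) \<times> (real \<times> (real ^ 'n))) measure)"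
  proof -
    have "(ball x r - \<Gamma>) \<times> UNIV \<in> sets (borel :: ((real ^ 'n) \<times> (real \<times> (real ^ 'n))) measure)"
      using closed by (intro borel_open open_Times) (auto intro: open_Diff)
    then have "(\<lambda>w. case_prod (weight j) w * indicator ((ball x r - \<Gamma>) \<times> UNIV) w) \<in> borel_measurable borel"
      using weight_measurable by measurable
    moreover have "(\<lambda>(X, z). weight j X z * indicator (ball x r - \<Gamma>) X)
        = (\<lambda>w. case_prod (weight j) w * indicator ((ball x r - \<Gamma>) \<times> UNIV) w)"
      by (auto simp: indicator_def fun_eq_iff)
    ultimately show ?thesis by simp
  qed
  then have m: "(\<lambda>(X, z). weight j X z * indicator (ball x r - \<Gamma>) X) \<in> borel_measurable (lborel \<Otimes>\<^sub>M \<tau>)"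
    by (simp add: measurable_cong_sets[OF sets3 refl])
  have wm: "weight j X \<in> borel_measurable \<tau>" for X
  proof -
    have "(\<lambda>z. case_prod (weight j) (X, z)) \<in> borel_measurable borel"
      by (rule measurable_compose[OF _ weight_measurable]) (intro borel_measurable_continuous_onI continuous_intros)
    then show ?thesis by (simp add: measurable_cong_sets[OF measurable_pair refl])
  qed
  have "(\<integral>\<^sup>+X. (\<integral>\<^sup>+z. weight j X z \<partial>\<tau>) * indicator (ball x r - \<Gamma>) X \<partial>lborel)
      = (\<integral>\<^sup>+X. \<integral>\<^sup>+z. weight j X z * indicator (ball x r - \<Gamma>) X \<partial>\<tau> \<partial>lborel)"
    by (intro nn_integral_cong nn_integral_multc[symmetric] wm)
  also have "\<dots> = (\<integral>\<^sup>+z. \<integral>\<^sup>+X. weight j X z * indicator (ball x r - \<Gamma>) X \<partial>lborel \<partial>\<tau>)"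
    by (rule Q.Fubini'[OF m, symmetric])
  also have "\<dots> \<le> (\<integral>\<^sup>+z. ennreal vol_c * (hull_square d \<sigma> z * ennreal (1 / fst z) * indicator ({0<..<8 * 2 ^ j * r} \<times> ball x (3 * r)) z) \<partial>\<tau>)"
    by (intro nn_integral_mono integral_weight_le x r)
  also have "\<dots> = ennreal vol_c * (\<integral>\<^sup>+z. hull_square d \<sigma> z * ennreal (1 / fst z) * indicator ({0<..<8 * 2 ^ j * r} \<times> ball x (3 * r)) z \<partial>\<tau>)"
  proof (rule nn_integral_cmult)
    have [measurable]: "{0<..<8 * 2 ^ j * r} \<times> ball x (3 * r) \<in> sets borel" by (intro borel_open open_Times) auto
    have "(\<lambda>z. hull_square d \<sigma> z * ennreal (1 / fst z) * indicator ({0<..<8 * 2 ^ j * r} \<times> ball x (3 * r)) z) \<in> borel_measurable borel"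
      by measurable
    then show "(\<lambda>z. hull_square d \<sigma> z * ennreal (1 / fst z) * indicator ({0<..<8 * 2 ^ j * r} \<times> ball x (3 * r)) z) \<in> borel_measurable \<tau>"
      by (simp add: measurable_cong_sets[OF measurable_pair refl])
  qed
  also have "\<dots> \<le> ennreal vol_c * ennreal (C * (3 * r) ^ d * (16 ^ (d + 1) * C0 + real j + 3))"
    by (intro mult_left_mono hull_strip[OF ur x r]) auto
  also have "\<dots> = ennreal (vol_c * (C * (3 * r) ^ d * (16 ^ (d + 1) * C0 + real j + 3)))"
    using vol_c_nonneg by (simp add: ennreal_mult')
  finally show ?thesis .
qed

definition car_c :: "real \<Rightarrow> real \<Rightarrow> real" where
  "car_c C0 p = (\<Sum>j. (2 powr (- p)) ^ j * (16 ^ (d + 1) * C0 + real j + 3))"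

lemma car_c_summable:
  assumes "p > 0"
  shows "summable (\<lambda>j. (2 powr (- p)) ^ j * (16 ^ (d + 1) * C0 + real j + 3))"
proof -
  have t: "norm (2 powr (- p) :: real) < 1" using assms by (simp add: powr_less_one)
  have "summable (\<lambda>j. of_nat (Suc j) * (2 powr (- p) :: real) ^ j + (16 ^ (d + 1) * C0 + 2) * (2 powr (- p)) ^ j)"
    by (intro summable_add sums_summable[OF geometric_deriv_sums[OF t]] summable_mult summable_geometric t)
  then show ?thesis by (simp add: algebra_simps)
qed

text \<open>Measurable substitute for \<open>square_sum p X\<close> times \<delta>^(d-n) on the
  ball, built from averages of the hull; sums and integrals are exchanged for it, since the
  \<alpha>-numbers themselves may fail to be measurable.\<close>

definition majorant :: "real ^ 'n \<Rightarrow> real \<Rightarrow> real \<Rightarrow> real ^ 'n \<Rightarrow> ennreal" where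
  "majorant x r p X = (\<Sum>j. ennreal ((2 powr (- p)) ^ j)
     * ((\<integral>\<^sup>+z. weight j X z \<partial>\<tau>) * indicator (ball x r - \<Gamma>) X))"

lemma square_sum_carleson:
  assumes ur: "uniformly_rectifiable d C0 \<Gamma> \<sigma>" and x: "x \<in> \<Gamma>" and r: "r > 0" and p: "p > 0"
  shows "majorant x r p \<in> borel_measurable lborel"
    and "ennreal (square_sum p X * infdist X \<Gamma> powr (real d - real CARD('n))) * indicator (ball x r - \<Gamma>) X \<le> majorant x r p X"
    and "(\<integral>\<^sup>+X. majorant x r p X \<partial>lborel) \<le> ennreal (vol_c * (C * (3 * r) ^ d) * car_c C0 p)"
proof -
  interpret S: sigma_finite_measure \<sigma> by (rule sigma_finite)
  interpret P: pair_sigma_finite lborel \<sigma> ..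
  let ?t = "2 powr (- p) :: real"
  let ?A = "\<lambda>j X. \<integral>\<^sup>+z. weight j X z \<partial>\<tau>"
  have C0: "C0 \<ge> 0" using ur by (simp add: uniformly_rectifiable_def)
  have o [measurable]: "ball x r - \<Gamma> \<in> sets borel" using closed by (intro borel_open) (auto intro: open_Diff)
  have sets3: "sets (lborel \<Otimes>\<^sub>M \<tau>) = sets (borel :: ((real ^ 'n) \<times> (real \<times> (real ^ 'n))) measure)"
    unfolding borel_prod[symmetric, where 'a = "real ^ 'n" and 'b = "real \<times> (real ^ 'n)"]
    by (rule sets_pair_measure_cong[OF sets_lborel measurable_pair])
  have A: "?A j \<in> borel_measurable lborel" for j
    using sigma_finite_measure.borel_measurable_nn_integral_fst[OF P.sigma_finite_measure_axioms, of "case_prod (weight j)" lborel]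
      weight_measurable[of j]
    by (simp add: measurable_cong_sets[OF sets3 refl])
  have Ai: "(\<lambda>X. ?A j X * indicator (ball x r - \<Gamma>) X) \<in> borel_measurable lborel" for j
    using A[of j] by measurable
  show "majorant x r p \<in> borel_measurable lborel"
    unfolding majorant_def[abs_def] using Ai by measurable
  show "ennreal (square_sum p X * infdist X \<Gamma> powr (real d - real CARD('n))) * indicator (ball x r - \<Gamma>) X \<le> majorant x r p X"
  proof -
    let ?w = "infdist X \<Gamma> powr (real d - real CARD('n))"
    have "ennreal (square_sum p X * ?w) * indicator (ball x r - \<Gamma>) X \<le> (\<Sum>j. ennreal (?t ^ j) * (?A j X * indicator (ball x r - \<Gamma>) X))"
    proof (cases "X \<in> ball x r - \<Gamma>")
      case True
      have "ennreal (square_sum p X * ?w) = (\<Sum>j. ennreal (?t ^ j * (alphas X j)\<^sup>2 * ?w))"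
        unfolding square_sum_def suminf_mult2[OF square_sum_summable[OF p]]
        by (rule suminf_ennreal2[symmetric]) (auto intro!: summable_mult2 square_sum_summable p)
      also have "\<dots> \<le> (\<Sum>j. ennreal (?t ^ j) * ?A j X)"
      proof (intro suminf_le summableI)
        fix j
        have "ennreal (?t ^ j * (alphas X j)\<^sup>2 * ?w) = ennreal (?t ^ j) * ennreal ((alphas X j)\<^sup>2 * ?w)"
          by (simp add: ennreal_mult'[symmetric] mult.assoc)
        also have "\<dots> \<le> ennreal (?t ^ j) * ?A j X"
          using True by (intro mult_left_mono alphas_le_average) auto
        finally show "ennreal (?t ^ j * (alphas X j)\<^sup>2 * ?w) \<le> ennreal (?t ^ j) * ?A j X" .
      qed
      finally show ?thesis using True by simp
    qed simp
    then show ?thesis by (simp add: majorant_def)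
  qed
  have "(\<integral>\<^sup>+X. majorant x r p X \<partial>lborel) = (\<Sum>j. \<integral>\<^sup>+X. ennreal (?t ^ j) * (?A j X * indicator (ball x r - \<Gamma>) X) \<partial>lborel)"
    unfolding majorant_def by (rule nn_integral_suminf) (intro borel_measurable_times_ennreal borel_measurable_const Ai)
  also have "\<dots> = (\<Sum>j. ennreal (?t ^ j) * (\<integral>\<^sup>+X. ?A j X * indicator (ball x r - \<Gamma>) X \<partial>lborel))"
    by (intro suminf_cong nn_integral_cmult Ai)
  also have "\<dots> \<le> (\<Sum>j. ennreal (vol_c * (C * (3 * r) ^ d) * (?t ^ j * (16 ^ (d + 1) * C0 + real j + 3))))"
  proof (intro suminf_le summableI)
    fix j
    have "ennreal (?t ^ j) * (\<integral>\<^sup>+X. ?A j X * indicator (ball x r - \<Gamma>) X \<partial>lborel)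
        \<le> ennreal (?t ^ j) * ennreal (vol_c * (C * (3 * r) ^ d * (16 ^ (d + 1) * C0 + real j + 3)))"
      by (intro mult_left_mono integral_average_le ur x r) auto
    also have "\<dots> = ennreal (vol_c * (C * (3 * r) ^ d) * (?t ^ j * (16 ^ (d + 1) * C0 + real j + 3)))"
      by (simp add: ennreal_mult'[symmetric] mult_ac)
    finally show "ennreal (?t ^ j) * (\<integral>\<^sup>+X. ?A j X * indicator (ball x r - \<Gamma>) X \<partial>lborel)
        \<le> ennreal (vol_c * (C * (3 * r) ^ d) * (?t ^ j * (16 ^ (d + 1) * C0 + real j + 3)))" .
  qed
  also have "\<dots> = ennreal (\<Sum>j. vol_c * (C * (3 * r) ^ d) * (?t ^ j * (16 ^ (d + 1) * C0 + real j + 3)))"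
    using vol_c_nonneg C C0 r
    by (intro suminf_ennreal2 summable_mult car_c_summable p mult_nonneg_nonneg add_nonneg_nonneg) auto
  also have "(\<Sum>j. vol_c * (C * (3 * r) ^ d) * (?t ^ j * (16 ^ (d + 1) * C0 + real j + 3))) = vol_c * (C * (3 * r) ^ d) * car_c C0 p"
    unfolding car_c_def by (rule suminf_mult[OF car_c_summable[OF p]])
  finally show "(\<integral>\<^sup>+X. majorant x r p X \<partial>lborel) \<le> ennreal (vol_c * (C * (3 * r) ^ d) * car_c C0 p)" .
qed

definition carleson_c :: "real \<Rightarrow> real \<Rightarrow> real \<Rightarrow> real" where
  "carleson_c C0 p p' = grad_c p p' * (vol_c * (C * 3 ^ d) * (car_c C0 p + car_c C0 p')) * C"

lemma gradient_carleson:
  assumes ur: "uniformly_rectifiable d C0 \<Gamma> \<sigma>" and p: "p > 0" "p' > 0"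
  shows "carleson_measure_condition d \<Gamma> \<sigma> (carleson_c C0 p p')
    (ratio_field p p')"
  unfolding carleson_measure_condition_def
proof (intro conjI ballI allI impI)
  let ?f = "ratio_field p p'"
  show "?f \<in> borel_measurable (lebesgue_on (- \<Gamma>))" by (rule gradient_measurable[OF p])
  note le = gradient_square_le[OF _ p]
  \<comment> \<open>Boundedness rests on the truncation: all \<open>alphas\<close> are at most 1, so
    the square sums are at most geometric series.\<close>
  have "norm (?f X) \<le> sqrt (grad_c p p' * (geo_c p + geo_c p'))" if "X \<in> - \<Gamma>" for X
  proof (rule real_le_rsqrt)
    have "(norm (?f X))\<^sup>2 \<le> grad_c p p' * (square_sum p X + square_sum p' X)" using le that by simp
    also have "\<dots> \<le> grad_c p p' * (geo_c p + geo_c p')"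
      by (intro mult_left_mono add_mono square_sum_bounds(2) p grad_c_nonneg)
    finally show "(norm (?f X))\<^sup>2 \<le> grad_c p p' * (geo_c p + geo_c p')" .
  qed
  then show "\<exists>M. AE X in lebesgue_on (- \<Gamma>). norm (?f X) \<le> M"
    by (intro exI AE_I2) auto
  fix x :: "real ^ 'n" and r :: real assume x: "x \<in> \<Gamma>" and r: "r > 0"
  let ?w = "\<lambda>X. infdist X \<Gamma> powr (real d - real CARD('n))"
  let ?g = "\<lambda>X. ennreal ((norm (?f X))\<^sup>2 * ?w X) * indicator (ball x r - \<Gamma>) X"
  let ?k = "grad_c p p'" and ?M = "vol_c * (C * (3 * r) ^ d)"
  note maj = square_sum_carleson[OF ur x r p(1)] and maj' = square_sum_carleson[OF ur x r p(2)]
  have C0: "C0 \<ge> 0" using ur by (simp add: uniformly_rectifiable_def)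
  have k: "?k \<ge> 0" by (rule grad_c_nonneg[OF p])
  have M: "?M \<ge> 0" using vol_c_nonneg C r by simp
  have car: "car_c C0 q \<ge> 0" if "q > 0" for q
    unfolding car_c_def using C0 by (intro suminf_nonneg car_c_summable that mult_nonneg_nonneg) auto
  have "?g X \<le> ennreal ?k * (majorant x r p X + majorant x r p' X)" for X
  proof (cases "X \<in> ball x r - \<Gamma>")
    case True
    have "(norm (?f X))\<^sup>2 * ?w X \<le> ?k * (square_sum p X + square_sum p' X) * ?w X"
      using True by (intro mult_right_mono le) auto
    then have "?g X \<le> ennreal (?k * (square_sum p X * ?w X + square_sum p' X * ?w X))"
      using True by (simp add: ennreal_leI algebra_simps)
    also have "\<dots> = ennreal ?k * (ennreal (square_sum p X * ?w X) + ennreal (square_sum p' X * ?w X))"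
      using k square_sum_bounds(1)[OF p(1), of X] square_sum_bounds(1)[OF p(2), of X]
      by (simp add: ennreal_mult')
    also have "\<dots> \<le> ennreal ?k * (majorant x r p X + majorant x r p' X)"
      using maj(2)[of X] maj'(2)[of X] True by (intro mult_left_mono add_mono) auto
    finally show ?thesis .
  qed simp
  then have "(\<integral>\<^sup>+X. ?g X \<partial>lebesgue) \<le> (\<integral>\<^sup>+X. ennreal ?k * (majorant x r p X + majorant x r p' X) \<partial>lborel)"
    unfolding nn_integral_completion by (rule nn_integral_mono)
  also have "\<dots> = ennreal ?k * ((\<integral>\<^sup>+X. majorant x r p X \<partial>lborel) + (\<integral>\<^sup>+X. majorant x r p' X \<partial>lborel))"
    using maj(1) maj'(1) by (subst nn_integral_cmult) (auto simp: nn_integral_add)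
  also have "\<dots> \<le> ennreal ?k * (ennreal (?M * car_c C0 p) + ennreal (?M * car_c C0 p'))"
    by (intro mult_left_mono add_mono maj(3) maj'(3)) auto
  also have "\<dots> = ennreal (?k * (?M * car_c C0 p + ?M * car_c C0 p'))"
    using k M car[OF p(1)] car[OF p(2)] by (simp add: ennreal_mult')
  \<comment> \<open>The last factor C of \<open>carleson_c\<close> turns r^d into r^d / C, which
    lower regularity bounds by the measure of the ball.\<close>
  also have "?k * (?M * car_c C0 p + ?M * car_c C0 p') = carleson_c C0 p p' * (r ^ d / C)"
    using C by (simp add: carleson_c_def power_mult_distrib field_simps)
  also have "ennreal (carleson_c C0 p p' * (r ^ d / C)) = ennreal (carleson_c C0 p p') * ennreal (r ^ d / C)"
    using C r by (intro ennreal_mult'') simp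
  also have "\<dots> \<le> ennreal (carleson_c C0 p p') * emeasure \<sigma> (ball x r)"
    by (intro mult_left_mono lower x r) auto
  finally show "(\<integral>\<^sup>+X\<in>ball x r - \<Gamma>. ennreal ((norm (?f X))\<^sup>2 * ?w X) \<partial>lebesgue)
      \<le> ennreal (carleson_c C0 p p') * emeasure \<sigma> (ball x r)" .
qed

end

section \<open>Uniformity of the constant\<close>

lemma carleson_measure_condition_mono:
  fixes f :: "real ^ 'n \<Rightarrow> 'b::real_normed_vector"
  assumes f: "carleson_measure_condition d \<Gamma> \<sigma> C f" and C: "C \<le> C'"
  shows "carleson_measure_condition d \<Gamma> \<sigma> C' f"
  unfolding carleson_measure_condition_def
proof (intro conjI ballI allI impI)
  note f' = f[unfolded carleson_measure_condition_def]
  show "f \<in> borel_measurable (lebesgue_on (- \<Gamma>))" "\<exists>M. AE X in lebesgue_on (- \<Gamma>). norm (f X) \<le> M"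
    using f' by auto
  fix x :: "real ^ 'n" and r :: real assume "x \<in> \<Gamma>" "r > 0"
  then have "(\<integral>\<^sup>+X\<in>ball x r - \<Gamma>. ennreal ((norm (f X))\<^sup>2 * infdist X \<Gamma> powr (real d - real CARD('n))) \<partial>lebesgue)
      \<le> ennreal C * emeasure \<sigma> (ball x r)"
    using f' by blast
  also have "\<dots> \<le> ennreal C' * emeasure \<sigma> (ball x r)"
    by (intro mult_right_mono ennreal_leI C) auto
  finally show "(\<integral>\<^sup>+X\<in>ball x r - \<Gamma>. ennreal ((norm (f X))\<^sup>2 * infdist X \<Gamma> powr (real d - real CARD('n))) \<partial>lebesgue)
      \<le> ennreal C' * emeasure \<sigma> (ball x r)" .
qed

theorem lemma1p27:
  fixes d :: nat and C\<^sub>\<sigma> C\<^sub>0 \<alpha> \<beta> :: real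
  assumes "0 < d" and "d < CARD('n::finite)"
    and "\<alpha> > 0" and "\<beta> > 0"
  shows "\<exists>C>0. \<forall>(\<Gamma> :: (real ^ 'n) set) \<sigma>.
           ahlfors_regular d C\<^sub>\<sigma> \<Gamma> \<sigma> \<and> uniformly_rectifiable d C\<^sub>0 \<Gamma> \<sigma> \<longrightarrow>
           carleson_measure_condition d \<Gamma> \<sigma> C
             (\<lambda>X. infdist X \<Gamma> *\<^sub>R gradient (\<lambda>Y. D_dist d \<Gamma> \<sigma> \<beta> Y / D_dist d \<Gamma> \<sigma> \<alpha> Y) X)"
proof -
  \<comment> \<open>Outside its locale \<open>carleson_c\<close> takes the type of the space and
    numerical parameters, but neither \<Gamma> nor \<sigma>; this is the required uniformity. The
    maximum with 1 ensures positivity for all values of the parameters.\<close>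
  let ?K = "max 1 (ahlfors.carleson_c TYPE('n) d C\<^sub>\<sigma> C\<^sub>0 \<beta> \<alpha>)"
  have "carleson_measure_condition d \<Gamma> \<sigma> ?K
      (\<lambda>X. infdist X \<Gamma> *\<^sub>R gradient (\<lambda>Y. D_dist d \<Gamma> \<sigma> \<beta> Y / D_dist d \<Gamma> \<sigma> \<alpha> Y) X)"
    if reg: "ahlfors_regular d C\<^sub>\<sigma> \<Gamma> \<sigma>" and ur: "uniformly_rectifiable d C\<^sub>0 \<Gamma> \<sigma>"
    for \<Gamma> :: "(real ^ 'n) set" and \<sigma>
  \<comment> \<open>For empty \<Gamma> the value of \<open>infdist\<close> is 0 by convention, so
    the function is 0 and the integral condition is vacuous.\<close>
  proof (cases "\<Gamma> = {}")
    case True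
    then show ?thesis
      by (auto simp: carleson_measure_condition_def infdist_def intro!: exI[of _ 0])
  next
    case False
    interpret ahlfors d C\<^sub>\<sigma> \<Gamma> \<sigma>
      using assms(1) reg False by unfold_locales
    show ?thesis
      by (rule carleson_measure_condition_mono[OF gradient_carleson[OF ur assms(4,3)]]) simp
  qed
  then show ?thesis by (intro exI[of _ ?K]) auto
qed

end
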